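(* Assume that $A,\hat A,A_1,\hat A_1\in L^\infty(0,T;\mathbb R^{n\times n})$, $B,\hat B,B_1,\hat B_1\in L^\infty(0,T;\mathbb R^{n\times m})$, $Q,\hat Q\in L^\infty(0,T;\mathcal S^n)$, $R,\hat R\in L^\infty(0,T;\mathcal S^m)$, $G,\hat G\in\mathcal S^n$, and that $\Theta_2\ge0$. Let $x\in\mathbb R^n$ and suppose $(\bar X(\cdot),\bar u(\cdot),Y(\cdot),Z(\cdot))$ is an adapted solution of the mean-field forward-backward stochastic differential equation (with the time variable $s$ suppressed) $$\begin{cases} d\bar X=\big(A\bar X+B\bar u+\hat A\,\mathbb E[\bar X]+\hat B\,\mathbb E[\bar u]\big)ds+\big(A_1\bar X+B_1\bar u+\hat A_1\mathbb E[\bar X]+\hat B_1\mathbb E[\bar u]\big)dW(s),\\ dY=-\big(A^TY+A_1^TZ+Q\bar X+\hat A^T\mathbb E[Y]+\hat A_1^T\mathbb E[Z]+\hat Q\,\mathbb E[\bar X]\big)ds+Z\,dW(s),\\ \bar X(0)=x,\qquad Y(T)=G\bar X(T)+\hat G\,\mathbb E[\bar X(T)],\\ R\bar u+\hat R\,\mathbb E[\bar u]+B^TY+B_1^TZ+\hat B^T\mathbb E[Y]+\hat B_1^T\mathbb E[Z]=0.\end{cases}$$ Then $(\bar X(\cdot),\bar u(\cdot))$ is an optimal pair of Problem (MF) with initial state $x$.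
   Context: Let $T>0$ and let $(\Omega,\mathcal F,\mathbb P,\mathbb F)$ be a complete filtered probability space carrying a one-dimensional standard Brownian motion $W$, where $\mathbb F=\{\mathcal F_t\}_{t\ge0}$ is the natural filtration of $W$ augmented by all $\mathbb P$-null sets. $\mathcal S^k$ is the set of symmetric $k\times k$ real matrices. $L^2_{\mathbb F}(0,T;H)$ is the set of $\mathbb F$-adapted $H$-valued processes $\varphi$ with $\mathbb E\int_0^T|\varphi(s)|^2ds<\infty$. The set of admissible controls is $\mathcal U[0,T]=L^2_{\mathbb F}(0,T;\mathbb R^m)$. $\hat{\mathcal X}[0,T]$ is the set of $\mathbb F$-adapted $\mathbb R^n$-valued processes $X$ with continuous paths and $\mathbb E[\sup_{s\in[0,T]}|X(s)|^2]<\infty$. All coefficients $A,\hat A,A_1,\hat A_1,B,\hat B,B_1,\hat B_1,Q,\hat Q,R,\hat R,G,\hat G$ are deterministic. For $x\in\mathbb R^n$ and $u\in\mathcal U[0,T]$, the state process $X=X(\cdot\,;x,u)\in\hat{\mathcal X}[0,T]$ is the unique solution of $$\begin{cases} dX=\{AX+Bu+\hat A\,\mathbb E[X]+\hat B\,\mathbb E[u]\}ds+\{A_1X+B_1u+\hat A_1\mathbb E[X]+\hat B_1\mathbb E[u]\}dW(s),\quad s\in[0,T],\\ X(0)=x,\end{cases}$$ and the cost functional is $$J(x;u)=\mathbb E\Big\{\int_0^T\big[\langle QX,X\rangle+\langle\hat Q\,\mathbb E[X],\mathbb E[X]\rangle+\langle Ru,u\rangle+\langle\hat R\,\mathbb E[u],\mathbb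 E[u]\rangle\big]ds+\langle GX(T),X(T)\rangle+\langle\hat G\,\mathbb E[X(T)],\mathbb E[X(T)]\rangle\Big\}.$$ Problem (MF): given $x\in\mathbb R^n$, find $\bar u\in\mathcal U[0,T]$ with $J(x;\bar u)=\inf_{u\in\mathcal U[0,T]}J(x;u)$. Such a $\bar u$ is an optimal control, $\bar X=X(\cdot\,;x,\bar u)$ is the corresponding optimal state process, and $(\bar X,\bar u)$ is an optimal pair. The operator $\Theta_2$: since $X(\cdot\,;x,u)$ is affine in $u$, the cost can be written $J(x;u)=\langle\Theta_2u,u\rangle+2\langle\Theta_1x,u\rangle+\langle\Theta_0x,x\rangle$, where $\Theta_2$ is the bounded self-adjoint operator on the Hilbert space $\mathcal U[0,T]$ determined by $\langle\Theta_2u,u\rangle=J(0;u)$ for all $u\in\mathcal U[0,T]$. $\Theta_2\ge0$ means $\langle\Theta_2u,u\rangle\ge0$ for all $u\in\mathcal U[0,T]$. An adapted solution of the forward-backward system is a 4-tuple $(\bar X,\bar u,Y,Z)\in\hat{\mathcal X}[0,T]\times\mathcal U[0,T]\times\hat{\mathcal X}[0,T]\times L^2_{\mathbb F}(0,T;\mathbb R^n)$ of $\mathbb F$-adapted processes satisfying it (the last relation for almost every $s$, almost surely). *)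

theory Defs
  imports "HOL-Probability.Probability"
begin

text \<open>
  Processes are functions \<open>real \<Rightarrow> 'a \<Rightarrow> 'b\<close> (time, then sample point); only times in
  \<open>{0..T}\<close> are ever inspected.  Elements of \<open>L\<^sup>2\<close> are representatives, not classes.
\<close>

section \<open>Brownian motion and its augmented filtration\<close>

definition brownian_filtration :: "'a measure \<Rightarrow> (real \<Rightarrow> 'a \<Rightarrow> real) \<Rightarrow> real \<Rightarrow> 'a measure" where
  "brownian_filtration M W t =
     sigma (space M)
       ({W s -` S \<inter> space M | s S. s \<in> {0..t} \<and> S \<in> sets borel} \<union> null_sets M)"

definition brownian_motion :: "'a measure \<Rightarrow> (real \<Rightarrow> 'a \<Rightarrow> real) \<Rightarrow> bool" where
  "brownian_motion M W \<longleftrightarrow>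
     (\<forall>t\<ge>0. W t \<in> borel_measurable M) \<and>
     (AE \<omega> in M. W 0 \<omega> = 0) \<and>
     (AE \<omega> in M. continuous_on {0..} (\<lambda>t. W t \<omega>)) \<and>
     (\<forall>s t. 0 \<le> s \<and> s < t \<longrightarrow>
        distributed M lborel (\<lambda>\<omega>. W t \<omega> - W s \<omega>) (\<lambda>y. ennreal (normal_density 0 (sqrt (t - s)) y)) \<and>
        prob_space.indep_set M (sets (brownian_filtration M W s))
          {(\<lambda>\<omega>. W t \<omega> - W s \<omega>) -` S \<inter> space M | S. S \<in> sets borel})"

section \<open>Spaces of processes\<close>

definition mean :: "'a measure \<Rightarrow> (real \<Rightarrow> 'a \<Rightarrow> 'b::euclidean_space) \<Rightarrow> real \<Rightarrow> 'b" where
  "mean M X s = (LINT \<omega>|M. X s \<omega>)"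

definition adapted ::
  "'a measure \<Rightarrow> (real \<Rightarrow> 'a \<Rightarrow> real) \<Rightarrow> real \<Rightarrow> (real \<Rightarrow> 'a \<Rightarrow> 'b::euclidean_space) \<Rightarrow> bool" where
  "adapted M W T X \<longleftrightarrow> (\<forall>t\<in>{0..T}. X t \<in> borel_measurable (brownian_filtration M W t))"

text \<open>
  The joint measurability of \<open>\<phi>\<close> is what gives the iterated integral its meaning.
\<close>

definition L2_processes ::
  "'a measure \<Rightarrow> (real \<Rightarrow> 'a \<Rightarrow> real) \<Rightarrow> real \<Rightarrow> (real \<Rightarrow> 'a \<Rightarrow> 'b::euclidean_space) set" where
  "L2_processes M W T =
     {\<phi>. adapted M W T \<phi> \<and>
         (\<lambda>(s, \<omega>). \<phi> s \<omega>) \<in> borel_measurable (restrict_space lborel {0..T} \<Otimes>\<^sub>M M) \<and>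
         (\<integral>\<^sup>+\<omega>. (\<integral>\<^sup>+s\<in>{0..T}. ennreal ((norm (\<phi> s \<omega>))\<^sup>2) \<partial>lborel) \<partial>M) < \<infinity>}"

definition sup_L2_processes ::
  "'a measure \<Rightarrow> (real \<Rightarrow> 'a \<Rightarrow> real) \<Rightarrow> real \<Rightarrow> (real \<Rightarrow> 'a \<Rightarrow> 'b::euclidean_space) set" where
  "sup_L2_processes M W T =
     {X. adapted M W T X \<and>
         (\<forall>\<omega>\<in>space M. continuous_on {0..T} (\<lambda>t. X t \<omega>)) \<and>
         (\<integral>\<^sup>+\<omega>. (SUP s\<in>{0..T}. ennreal ((norm (X s \<omega>))\<^sup>2)) \<partial>M) < \<infinity>}"

definition L2_inner ::
  "'a measure \<Rightarrow> real \<Rightarrow> (real \<Rightarrow> 'a \<Rightarrow> 'b::euclidean_space) \<Rightarrow> (real \<Rightarrow> 'a \<Rightarrow> 'b) \<Rightarrow> real" where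
  "L2_inner M T \<phi> \<psi> = (LINT \<omega>|M. (LBINT s:{0..T}. \<phi> s \<omega> \<bullet> \<psi> s \<omega>))"

definition process_eq ::
  "'a measure \<Rightarrow> real \<Rightarrow> (real \<Rightarrow> 'a \<Rightarrow> 'b::euclidean_space) \<Rightarrow> (real \<Rightarrow> 'a \<Rightarrow> 'b) \<Rightarrow> bool" where
  "process_eq M T \<phi> \<psi> \<longleftrightarrow>
     (AE s in lborel. s \<in> {0..T} \<longrightarrow> (AE \<omega> in M. \<phi> s \<omega> = \<psi> s \<omega>))"

definition L_infty :: "real \<Rightarrow> (real \<Rightarrow> 'b::euclidean_space) \<Rightarrow> bool" where
  "L_infty T f \<longleftrightarrow>
     f \<in> borel_measurable (restrict_space lborel {0..T}) \<and>
     (\<exists>C. AE s in lborel. s \<in> {0..T} \<longrightarrow> norm (f s) \<le> C)"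

definition symmetric_matrix :: "real^'k^'k \<Rightarrow> bool" where
  "symmetric_matrix S \<longleftrightarrow> transpose S = S"

section \<open>The Ito integral\<close>

text \<open>
  A simple integrand takes the bounded, \<open>\<F>\<^bsub>t i\<^esub>\<close>-measurable value \<open>\<xi> i\<close> on \<open>(t i, t (i + 1)]\<close>.
\<close>

definition simple_integrand ::
  "'a measure \<Rightarrow> (real \<Rightarrow> 'a \<Rightarrow> real) \<Rightarrow> real \<Rightarrow>
   nat \<Rightarrow> (nat \<Rightarrow> real) \<Rightarrow> (nat \<Rightarrow> 'a \<Rightarrow> 'b::euclidean_space) \<Rightarrow> bool" where
  "simple_integrand M W T k t \<xi> \<longleftrightarrow>
     0 \<le> t 0 \<and> t k \<le> T \<and> (\<forall>i<k. t i \<le> t (Suc i)) \<and>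
     (\<forall>i<k. \<xi> i \<in> borel_measurable (brownian_filtration M W (t i)) \<and>
            (\<exists>C. \<forall>\<omega>\<in>space M. norm (\<xi> i \<omega>) \<le> C))"

definition simple_process ::
  "nat \<Rightarrow> (nat \<Rightarrow> real) \<Rightarrow> (nat \<Rightarrow> 'a \<Rightarrow> 'b::euclidean_space) \<Rightarrow> real \<Rightarrow> 'a \<Rightarrow> 'b" where
  "simple_process k t \<xi> s \<omega> = (\<Sum>i<k. indicator {t i<..t (Suc i)} s *\<^sub>R \<xi> i \<omega>)"

definition simple_integral ::
  "(real \<Rightarrow> 'a \<Rightarrow> real) \<Rightarrow> nat \<Rightarrow> (nat \<Rightarrow> real) \<Rightarrow> (nat \<Rightarrow> 'a \<Rightarrow> 'b::euclidean_space) \<Rightarrow>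
   real \<Rightarrow> 'a \<Rightarrow> 'b" where
  "simple_integral W k t \<xi> r \<omega> =
     (\<Sum>i<k. (W (min (t (Suc i)) r) \<omega> - W (min (t i) r) \<omega>) *\<^sub>R \<xi> i \<omega>)"

text \<open>
  \<open>I\<close> is (a continuous version of) the process \<open>r \<mapsto> \<integral>\<^sub>0\<^sup>r \<sigma> dW\<close>: the \<open>L\<^sup>2\<close>-limit of the integrals
  of simple integrands converging to \<open>\<sigma>\<close>.  It is a relation because \<open>I\<close> is determined only up to
  indistinguishability.
\<close>

definition ito_integral ::
  "'a measure \<Rightarrow> (real \<Rightarrow> 'a \<Rightarrow> real) \<Rightarrow> real \<Rightarrow>
   (real \<Rightarrow> 'a \<Rightarrow> 'b::euclidean_space) \<Rightarrow> (real \<Rightarrow> 'a \<Rightarrow> 'b) \<Rightarrow> bool" where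
  "ito_integral M W T \<sigma> I \<longleftrightarrow>
     \<sigma> \<in> L2_processes M W T \<and>
     adapted M W T I \<and>
     (\<forall>\<omega>\<in>space M. continuous_on {0..T} (\<lambda>t. I t \<omega>)) \<and>
     (\<exists>k t \<xi>.
        (\<forall>j::nat. simple_integrand M W T (k j) (t j) (\<xi> j)) \<and>
        (\<lambda>j. \<integral>\<^sup>+\<omega>. (\<integral>\<^sup>+s\<in>{0..T}.
            ennreal ((norm (simple_process (k j) (t j) (\<xi> j) s \<omega> - \<sigma> s \<omega>))\<^sup>2) \<partial>lborel) \<partial>M)
          \<longlonglongrightarrow> 0 \<and>
        (\<forall>r\<in>{0..T}.
          (\<lambda>j. \<integral>\<^sup>+\<omega>. ennreal ((norm (simple_integral W (k j) (t j) (\<xi> j) r \<omega> - I r \<omega>))\<^sup>2) \<partial>M)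
            \<longlonglongrightarrow> 0))"

text \<open>\<open>dX = b ds + \<sigma> dW\<close> on \<open>[0, T]\<close>.\<close>

definition ito_differential ::
  "'a measure \<Rightarrow> (real \<Rightarrow> 'a \<Rightarrow> real) \<Rightarrow> real \<Rightarrow> (real \<Rightarrow> 'a \<Rightarrow> 'b::euclidean_space) \<Rightarrow>
   (real \<Rightarrow> 'a \<Rightarrow> 'b) \<Rightarrow> (real \<Rightarrow> 'a \<Rightarrow> 'b) \<Rightarrow> bool" where
  "ito_differential M W T X b \<sigma> \<longleftrightarrow>
     (AE \<omega> in M. set_integrable lborel {0..T} (\<lambda>s. b s \<omega>)) \<and>
     (\<exists>I. ito_integral M W T \<sigma> I \<and>
        (AE \<omega> in M. \<forall>t\<in>{0..T}. X t \<omega> = X 0 \<omega> + (LBINT s:{0..t}. b s \<omega>) + I t \<omega>))"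

section \<open>The mean-field linear-quadratic problem\<close>

record ('n, 'm) mf_coeffs =
  cA :: "real \<Rightarrow> real^'n^'n"
  cA_hat :: "real \<Rightarrow> real^'n^'n"
  cA1 :: "real \<Rightarrow> real^'n^'n"
  cA1_hat :: "real \<Rightarrow> real^'n^'n"
  cB :: "real \<Rightarrow> real^'m^'n"
  cB_hat :: "real \<Rightarrow> real^'m^'n"
  cB1 :: "real \<Rightarrow> real^'m^'n"
  cB1_hat :: "real \<Rightarrow> real^'m^'n"
  cQ :: "real \<Rightarrow> real^'n^'n"
  cQ_hat :: "real \<Rightarrow> real^'n^'n"
  cR :: "real \<Rightarrow> real^'m^'m"
  cR_hat :: "real \<Rightarrow> real^'m^'m"
  cG :: "real^'n^'n"
  cG_hat :: "real^'n^'n"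

definition state_process ::
  "'a measure \<Rightarrow> (real \<Rightarrow> 'a \<Rightarrow> real) \<Rightarrow> real \<Rightarrow> ('n::finite, 'm::finite) mf_coeffs \<Rightarrow>
   real^'n \<Rightarrow> (real \<Rightarrow> 'a \<Rightarrow> real^'m) \<Rightarrow> (real \<Rightarrow> 'a \<Rightarrow> real^'n) \<Rightarrow> bool" where
  "state_process M W T c x u X \<longleftrightarrow>
     X \<in> sup_L2_processes M W T \<and>
     ito_differential M W T X
       (\<lambda>s \<omega>. cA c s *v X s \<omega> + cB c s *v u s \<omega>
              + cA_hat c s *v mean M X s + cB_hat c s *v mean M u s)
       (\<lambda>s \<omega>. cA1 c s *v X s \<omega> + cB1 c s *v u s \<omega>
              + cA1_hat c s *v mean M X s + cB1_hat c s *v mean M u s) \<and>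
     (AE \<omega> in M. X 0 \<omega> = x)"

definition cost_functional ::
  "'a measure \<Rightarrow> real \<Rightarrow> ('n::finite, 'm::finite) mf_coeffs \<Rightarrow>
   (real \<Rightarrow> 'a \<Rightarrow> real^'n) \<Rightarrow> (real \<Rightarrow> 'a \<Rightarrow> real^'m) \<Rightarrow> real" where
  "cost_functional M T c X u =
     (LINT \<omega>|M.
        (LBINT s:{0..T}.
           (cQ c s *v X s \<omega>) \<bullet> X s \<omega> + (cQ_hat c s *v mean M X s) \<bullet> mean M X s
           + (cR c s *v u s \<omega>) \<bullet> u s \<omega> + (cR_hat c s *v mean M u s) \<bullet> mean M u s)
        + (cG c *v X T \<omega>) \<bullet> X T \<omega> + (cG_hat c *v mean M X T) \<bullet> mean M X T)"

text \<open>
  \<open>J(x; u)\<close> is the cost at \<open>X(\<cdot>; x, u)\<close>.  The state equation has a solution that is unique up to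
  indistinguishability, and indistinguishable processes have equal cost, so the infimum below
  ranges over a single number; it merely turns the relation \<open>state_process\<close> into a function
  without choosing a version of the state.  The value is extended real because the infimum of
  \<open>J(x; u)\<close> over \<open>u\<close> may be \<open>-\<infinity>\<close>.
\<close>

definition mf_J ::
  "'a measure \<Rightarrow> (real \<Rightarrow> 'a \<Rightarrow> real) \<Rightarrow> real \<Rightarrow> ('n::finite, 'm::finite) mf_coeffs \<Rightarrow>
   real^'n \<Rightarrow> (real \<Rightarrow> 'a \<Rightarrow> real^'m) \<Rightarrow> ereal" where
  "mf_J M W T c x u = (INF X \<in> {X. state_process M W T c x u X}. ereal (cost_functional M T c X u))"

definition optimal_control ::
  "'a measure \<Rightarrow> (real \<Rightarrow> 'a \<Rightarrow> real) \<Rightarrow> real \<Rightarrow> ('n::finite, 'm::finite) mf_coeffs \<Rightarrow>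
   real^'n \<Rightarrow> (real \<Rightarrow> 'a \<Rightarrow> real^'m) \<Rightarrow> bool" where
  "optimal_control M W T c x u \<longleftrightarrow>
     u \<in> L2_processes M W T \<and>
     mf_J M W T c x u = (INF v \<in> L2_processes M W T. mf_J M W T c x v)"

definition optimal_pair ::
  "'a measure \<Rightarrow> (real \<Rightarrow> 'a \<Rightarrow> real) \<Rightarrow> real \<Rightarrow> ('n::finite, 'm::finite) mf_coeffs \<Rightarrow>
   real^'n \<Rightarrow> (real \<Rightarrow> 'a \<Rightarrow> real^'n) \<Rightarrow> (real \<Rightarrow> 'a \<Rightarrow> real^'m) \<Rightarrow> bool" where
  "optimal_pair M W T c x X u \<longleftrightarrow>
     optimal_control M W T c x u \<and> state_process M W T c x u X"

definition bounded_selfadjoint_operator ::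
  "'a measure \<Rightarrow> (real \<Rightarrow> 'a \<Rightarrow> real) \<Rightarrow> real \<Rightarrow>
   ((real \<Rightarrow> 'a \<Rightarrow> 'b::euclidean_space) \<Rightarrow> (real \<Rightarrow> 'a \<Rightarrow> 'b)) \<Rightarrow> bool" where
  "bounded_selfadjoint_operator M W T \<Theta> \<longleftrightarrow>
     (\<forall>u\<in>L2_processes M W T. \<Theta> u \<in> L2_processes M W T) \<and>
     (\<forall>u\<in>L2_processes M W T. \<forall>v\<in>L2_processes M W T. \<forall>a b.
        process_eq M T (\<Theta> (\<lambda>s \<omega>. a *\<^sub>R u s \<omega> + b *\<^sub>R v s \<omega>)) (\<lambda>s \<omega>. a *\<^sub>R \<Theta> u s \<omega> + b *\<^sub>R \<Theta> v s \<omega>)) \<and>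
     (\<exists>C. \<forall>u\<in>L2_processes M W T. sqrt (L2_inner M T (\<Theta> u) (\<Theta> u)) \<le> C * sqrt (L2_inner M T u u)) \<and>
     (\<forall>u\<in>L2_processes M W T. \<forall>v\<in>L2_processes M W T.
        L2_inner M T (\<Theta> u) v = L2_inner M T u (\<Theta> v))"

definition is_Theta2 ::
  "'a measure \<Rightarrow> (real \<Rightarrow> 'a \<Rightarrow> real) \<Rightarrow> real \<Rightarrow> ('n::finite, 'm::finite) mf_coeffs \<Rightarrow>
   ((real \<Rightarrow> 'a \<Rightarrow> real^'m) \<Rightarrow> (real \<Rightarrow> 'a \<Rightarrow> real^'m)) \<Rightarrow> bool" where
  "is_Theta2 M W T c \<Theta> \<longleftrightarrow>
     bounded_selfadjoint_operator M W T \<Theta> \<and>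
     (\<forall>u\<in>L2_processes M W T. ereal (L2_inner M T (\<Theta> u) u) = mf_J M W T c 0 u)"

definition nonneg_operator ::
  "'a measure \<Rightarrow> (real \<Rightarrow> 'a \<Rightarrow> real) \<Rightarrow> real \<Rightarrow>
   ((real \<Rightarrow> 'a \<Rightarrow> 'b::euclidean_space) \<Rightarrow> (real \<Rightarrow> 'a \<Rightarrow> 'b)) \<Rightarrow> bool" where
  "nonneg_operator M W T \<Theta> \<longleftrightarrow> (\<forall>u\<in>L2_processes M W T. 0 \<le> L2_inner M T (\<Theta> u) u)"

text \<open>Adapted solutions of the mean-field forward-backward system (optimality system).\<close>

definition mf_fbsde_solution ::
  "'a measure \<Rightarrow> (real \<Rightarrow> 'a \<Rightarrow> real) \<Rightarrow> real \<Rightarrow> ('n::finite, 'm::finite) mf_coeffs \<Rightarrow> real^'n \<Rightarrow>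
   (real \<Rightarrow> 'a \<Rightarrow> real^'n) \<Rightarrow> (real \<Rightarrow> 'a \<Rightarrow> real^'m) \<Rightarrow>
   (real \<Rightarrow> 'a \<Rightarrow> real^'n) \<Rightarrow> (real \<Rightarrow> 'a \<Rightarrow> real^'n) \<Rightarrow> bool" where
  "mf_fbsde_solution M W T c x X u Y Z \<longleftrightarrow>
     X \<in> sup_L2_processes M W T \<and> u \<in> L2_processes M W T \<and>
     Y \<in> sup_L2_processes M W T \<and> Z \<in> L2_processes M W T \<and>
     ito_differential M W T X
       (\<lambda>s \<omega>. cA c s *v X s \<omega> + cB c s *v u s \<omega>
              + cA_hat c s *v mean M X s + cB_hat c s *v mean M u s)
       (\<lambda>s \<omega>. cA1 c s *v X s \<omega> + cB1 c s *v u s \<omega>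
              + cA1_hat c s *v mean M X s + cB1_hat c s *v mean M u s) \<and>
     ito_differential M W T Y
       (\<lambda>s \<omega>. - (transpose (cA c s) *v Y s \<omega> + transpose (cA1 c s) *v Z s \<omega> + cQ c s *v X s \<omega>
              + transpose (cA_hat c s) *v mean M Y s + transpose (cA1_hat c s) *v mean M Z s
              + cQ_hat c s *v mean M X s))
       Z \<and>
     (AE \<omega> in M. X 0 \<omega> = x) \<and>
     (AE \<omega> in M. Y T \<omega> = cG c *v X T \<omega> + cG_hat c *v mean M X T) \<and>
     (AE s in lborel. s \<in> {0..T} \<longrightarrow> (AE \<omega> in M.
        cR c s *v u s \<omega> + cR_hat c s *v mean M u s
        + transpose (cB c s) *v Y s \<omega> + transpose (cB1 c s) *v Z s \<omega>
        + transpose (cB_hat c s) *v mean M Y s + transpose (cB1_hat c s) *v mean M Z s = 0))"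

end

theory Submission
  imports Defs
begin

text \<open>
Let \<open>u'\<close> be an admissible control with state \<open>X'\<close> starting at \<open>x\<close>, and put \<open>v = u' - u\<close>,
\<open>\<xi> = X' - X\<close>.  The state equation is linear, so \<open>\<xi>\<close> is a state started at \<open>0\<close> and driven by \<open>v\<close>
(\<open>state_process_diff\<close>).  The cost is quadratic with symmetric weights, hence
\<open>J(x; u') = J(x; u) + 2 K + J(0; v)\<close>, where \<open>K\<close> is the polar form of the cost evaluated at
\<open>(X, u)\<close> and \<open>(\<xi>, v)\<close> (\<open>cost_form_expansion\<close>).  The last term is \<open>\<langle>\<Theta>\<^sub>2 v, v\<rangle> \<ge> 0\<close>, so everything
reduces to \<open>K = 0\<close>, the vanishing of the first variation (\<open>cost_form_stationary\<close>).

The terminal condition of \<open>Y\<close> turns the terminal part of \<open>K\<close> into \<open>E \<langle>Y(T), \<xi>(T)\<rangle>\<close>, and the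
product rule for \<open>\<langle>Y, \<xi>\<rangle>\<close> turns this into a time integral.  The drift of \<open>Y\<close> is chosen so that all
terms in \<open>\<xi>\<close>, including those of the running part of \<open>K\<close>, cancel: those with \<open>A\<close>, \<open>A\<^sub>1\<close>, \<open>Q\<close> pointwise, and those
containing means because \<open>E \<langle>C E[\<phi>], \<psi>\<rangle> = E \<langle>C\<^sup>T E[\<psi>], \<phi>\<rangle>\<close> for a deterministic matrix \<open>C\<close>
(\<open>integral_mean_adjoint\<close>).  What is left is the stationarity relation paired with \<open>v\<close>, which is
zero.

The analytic core is the product rule (\<open>expected_product_rule\<close>), which is wanted only in
expectation.  Split each process into initial value, absolutely continuous part and stochastic
integral, \<open>X = X(0) + B + I\<close>, and expand \<open>\<langle>X(T), Y(T)\<rangle>\<close>.  A product of two absolutely continuous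
parts is handled path by path with Fubini's theorem on the two triangles of the square
(\<open>integral_product_triangles\<close>); in a mixed product the integral \<open>I(T)\<close> may be replaced by \<open>I(s)\<close>,
because the increment \<open>I(T) - I(s)\<close> is orthogonal to everything known at time \<open>s\<close>
(\<open>ito_orthogonal\<close>); and the product of two stochastic integrals is the isometry (\<open>ito_isometry\<close>).
The last two facts are computed for simple integrands from the independence and the moments of
Brownian increments, and pass to the limit because the inner product is continuous in \<open>L\<^sup>2\<close>.

Throughout, a process is viewed as one function on the product of \<open>[0, T]\<close> with the sample space,
so that the iterated integrals of the problem become single integrals and square integrability
there is all that has to be propagated.
\<close>

section \<open>Square-integrable functions\<close>

definition square_integrable :: "'c measure \<Rightarrow> ('c \<Rightarrow> 'b::euclidean_space) \<Rightarrow> bool" where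
  "square_integrable N f \<longleftrightarrow> f \<in> borel_measurable N \<and> integrable N (\<lambda>x. (norm (f x))\<^sup>2)"

lemma square_integrableI:
  assumes "f \<in> borel_measurable N" "(\<integral>\<^sup>+x. ennreal ((norm (f x))\<^sup>2) \<partial>N) < \<infinity>"
  shows "square_integrable N f"
  unfolding square_integrable_def
  using assms by (auto intro!: integrableI_bounded)

lemma square_integrable_nn_integral:
  assumes "square_integrable N f"
  shows "(\<integral>\<^sup>+x. ennreal ((norm (f x))\<^sup>2) \<partial>N) = ennreal (\<integral>x. (norm (f x))\<^sup>2 \<partial>N)"
  using assms by (auto simp: square_integrable_def intro!: nn_integral_eq_integral)

lemma square_integrable_measurable:
  "square_integrable N f \<Longrightarrow> f \<in> borel_measurable N"
  by (simp add: square_integrable_def)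

lemma square_integrable_iff_nn_integral:
  "square_integrable N f \<longleftrightarrow>
    f \<in> borel_measurable N \<and> (\<integral>\<^sup>+x. ennreal ((norm (f x))\<^sup>2) \<partial>N) < \<infinity>"
proof
  assume "square_integrable N f"
  then show "f \<in> borel_measurable N \<and> (\<integral>\<^sup>+x. ennreal ((norm (f x))\<^sup>2) \<partial>N) < \<infinity>"
    by (simp add: square_integrable_nn_integral square_integrable_measurable)
qed (auto intro: square_integrableI)

lemma square_integrable_mono:
  fixes f :: "'c \<Rightarrow> 'b::euclidean_space" and g :: "'c \<Rightarrow> real"
  assumes f: "f \<in> borel_measurable N" and g: "integrable N g"
    and le: "AE x in N. (norm (f x))\<^sup>2 \<le> g x"
  shows "square_integrable N f"
  unfolding square_integrable_def
proof
  show "integrable N (\<lambda>x. (norm (f x))\<^sup>2)"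
    by (rule Bochner_Integration.integrable_bound[OF g]) (use f le in auto)
qed fact

lemma norm_add_sq_le:
  fixes a b :: "'b::real_normed_vector"
  shows "(norm (a + b))\<^sup>2 \<le> 2 * (norm a)\<^sup>2 + 2 * (norm b)\<^sup>2"
proof -
  have "(norm (a + b))\<^sup>2 \<le> (norm a + norm b)\<^sup>2"
    by (intro power_mono norm_triangle_ineq norm_ge_zero)
  also have "\<dots> \<le> 2 * (norm a)\<^sup>2 + 2 * (norm b)\<^sup>2"
    using sum_squares_bound[of "norm a" "norm b"] by (simp add: power2_sum)
  finally show ?thesis .
qed

lemma square_integrable_add [intro]:
  assumes "square_integrable N f" "square_integrable N g"
  shows "square_integrable N (\<lambda>x. f x + g x)"
  by (rule square_integrable_mono[where g = "\<lambda>x. 2 * (norm (f x))\<^sup>2 + 2 * (norm (g x))\<^sup>2"])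
     (use assms in \<open>auto simp: square_integrable_def norm_add_sq_le\<close>)

lemma square_integrable_minus [intro]:
  assumes "square_integrable N f"
  shows "square_integrable N (\<lambda>x. - f x)"
  using assms by (auto simp: square_integrable_def)

lemma square_integrable_diff [intro]:
  assumes "square_integrable N f" "square_integrable N g"
  shows "square_integrable N (\<lambda>x. f x - g x)"
  using square_integrable_add[OF assms(1) square_integrable_minus[OF assms(2)]] by simp

lemma square_integrable_sum [intro]:
  assumes "\<And>i. i \<in> I \<Longrightarrow> square_integrable N (f i)"
  shows "square_integrable N (\<lambda>x. \<Sum>i\<in>I. f i x)"
  using assms by (induction I rule: infinite_finite_induct) (auto simp: square_integrable_def[of N "\<lambda>_. 0"])

lemma integrable_inner_square_integrable [intro]:
  assumes f: "square_integrable N f" and g: "square_integrable N g"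
  shows "integrable N (\<lambda>x. f x \<bullet> g x)"
proof (rule Bochner_Integration.integrable_bound)
  show "integrable N (\<lambda>x. (norm (f x))\<^sup>2 + (norm (g x))\<^sup>2)"
    using f g by (auto simp: square_integrable_def)
  show "(\<lambda>x. f x \<bullet> g x) \<in> borel_measurable N"
    using f g by (auto simp: square_integrable_def)
  have "\<bar>f x \<bullet> g x\<bar> \<le> (norm (f x))\<^sup>2 + (norm (g x))\<^sup>2" for x
  proof -
    have "\<bar>f x \<bullet> g x\<bar> \<le> norm (f x) * norm (g x)" by (rule Cauchy_Schwarz_ineq2)
    moreover have "2 * (norm (f x) * norm (g x)) \<le> (norm (f x))\<^sup>2 + (norm (g x))\<^sup>2"
      using sum_squares_bound[of "norm (f x)" "norm (g x)"] by simp
    moreover have "0 \<le> norm (f x) * norm (g x)" by simp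
    ultimately show ?thesis by linarith
  qed
  then show "AE x in N. norm (f x \<bullet> g x) \<le> norm ((norm (f x))\<^sup>2 + (norm (g x))\<^sup>2)" by auto
qed

text \<open>
One member of the sequence at finite distance from the limit suffices.
\<close>

lemma square_integrable_limit:
  assumes f: "\<And>j::nat. square_integrable N (f j)" and h: "h \<in> borel_measurable N"
    and lim: "(\<lambda>j. \<integral>\<^sup>+x. ennreal ((norm (f j x - h x))\<^sup>2) \<partial>N) \<longlonglongrightarrow> 0"
  shows "square_integrable N h"
proof -
  have "eventually (\<lambda>j. (\<integral>\<^sup>+x. ennreal ((norm (f j x - h x))\<^sup>2) \<partial>N) < 1) sequentially"
    using lim by (rule order_tendstoD) simp
  then obtain j where j: "(\<integral>\<^sup>+x. ennreal ((norm (f j x - h x))\<^sup>2) \<partial>N) < 1"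
    by (auto simp: eventually_sequentially)
  then have "square_integrable N (\<lambda>x. f j x - h x)"
    using f[of j] h order_less_trans[OF j, of \<infinity>]
    by (intro square_integrableI) (auto simp: square_integrable_def)
  from square_integrable_diff[OF f[of j] this] show ?thesis by simp
qed

text \<open>
The Cauchy--Schwarz inequality in \<open>L\<^sup>2\<close>, obtained from the one for nonnegative integrals.
\<close>

lemma integral_inner_le:
  assumes f: "square_integrable N f" and g: "square_integrable N g"
  shows "\<bar>\<integral>x. f x \<bullet> g x \<partial>N\<bar> \<le> sqrt (\<integral>x. (norm (f x))\<^sup>2 \<partial>N) * sqrt (\<integral>x. (norm (g x))\<^sup>2 \<partial>N)"
proof -
  let ?A = "\<integral>x. (norm (f x))\<^sup>2 \<partial>N" and ?B = "\<integral>x. (norm (g x))\<^sup>2 \<partial>N"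
  note [measurable] = f[THEN square_integrable_measurable] g[THEN square_integrable_measurable]
  have pos: "0 \<le> ?A" "0 \<le> ?B" by (auto intro!: integral_nonneg_AE)
  have i: "integrable N (\<lambda>x. norm (f x) * norm (g x))"
    using integrable_inner_square_integrable[of N "\<lambda>x. norm (f x)" "\<lambda>x. norm (g x)"] f g
    by (simp add: square_integrable_def)
  have "ennreal ((\<integral>x. norm (f x) * norm (g x) \<partial>N)\<^sup>2) = (\<integral>\<^sup>+x. ennreal (norm (f x)) * ennreal (norm (g x)) \<partial>N)\<^sup>2"
    using i by (simp add: nn_integral_eq_integral ennreal_power flip: ennreal_mult)
  also have "\<dots> \<le> (\<integral>\<^sup>+x. (ennreal (norm (f x)))\<^sup>2 \<partial>N) * (\<integral>\<^sup>+x. (ennreal (norm (g x)))\<^sup>2 \<partial>N)"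
    by (rule Cauchy_Schwarz_nn_integral) auto
  also have "\<dots> = ennreal (?A * ?B)"
    using f g pos by (simp add: square_integrable_nn_integral ennreal_power ennreal_mult)
  finally have "(\<integral>x. norm (f x) * norm (g x) \<partial>N)\<^sup>2 \<le> ?A * ?B"
    using pos by simp
  then have "(\<integral>x. norm (f x) * norm (g x) \<partial>N) \<le> sqrt (?A * ?B)"
    by (rule real_le_rsqrt)
  moreover have "\<bar>\<integral>x. f x \<bullet> g x \<partial>N\<bar> \<le> (\<integral>x. norm (f x) * norm (g x) \<partial>N)"
  proof -
    have "\<bar>\<integral>x. f x \<bullet> g x \<partial>N\<bar> \<le> (\<integral>x. \<bar>f x \<bullet> g x\<bar> \<partial>N)"
      using integral_norm_bound[of N "\<lambda>x. f x \<bullet> g x"] by simp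
    also have "\<dots> \<le> (\<integral>x. norm (f x) * norm (g x) \<partial>N)"
      using f g i by (intro integral_mono) (auto simp: Cauchy_Schwarz_ineq2 intro!: integrable_abs)
    finally show ?thesis .
  qed
  ultimately show ?thesis by (simp add: real_sqrt_mult)
qed

text \<open>
Continuity of the inner product of \<open>L\<^sup>2\<close>: every identity for simple integrands reaches general
integrands through this lemma.
\<close>

lemma integral_inner_tendsto:
  assumes f: "\<And>j::nat. square_integrable N (f j)" and h: "h \<in> borel_measurable N"
    and limf: "(\<lambda>j. \<integral>\<^sup>+x. ennreal ((norm (f j x - h x))\<^sup>2) \<partial>N) \<longlonglongrightarrow> 0"
    and g: "\<And>j::nat. square_integrable N (g j)" and k: "k \<in> borel_measurable N"
    and limg: "(\<lambda>j. \<integral>\<^sup>+x. ennreal ((norm (g j x - k x))\<^sup>2) \<partial>N) \<longlonglongrightarrow> 0"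
  shows "(\<lambda>j. \<integral>x. f j x \<bullet> g j x \<partial>N) \<longlonglongrightarrow> (\<integral>x. h x \<bullet> k x \<partial>N)"
proof -
  note h' = square_integrable_limit[OF f h limf] and k' = square_integrable_limit[OF g k limg]
  have fh: "square_integrable N (\<lambda>x. f j x - h x)" and gk: "square_integrable N (\<lambda>x. g j x - k x)" for j
    using f g h' k' by auto
  define a where "a j = sqrt (\<integral>x. (norm (f j x - h x))\<^sup>2 \<partial>N)" for j
  define b where "b j = sqrt (\<integral>x. (norm (g j x - k x))\<^sup>2 \<partial>N)" for j
  define A where "A = sqrt (\<integral>x. (norm (h x))\<^sup>2 \<partial>N)"
  define B where "B = sqrt (\<integral>x. (norm (k x))\<^sup>2 \<partial>N)"
  have lim_real: "(\<lambda>j. sqrt (\<integral>x. (norm (p j x))\<^sup>2 \<partial>N)) \<longlonglongrightarrow> 0"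
    if "\<And>j. square_integrable N (p j)" "(\<lambda>j. \<integral>\<^sup>+x. ennreal ((norm (p j x))\<^sup>2) \<partial>N) \<longlonglongrightarrow> 0"
    for p :: "nat \<Rightarrow> 'a \<Rightarrow> 'b"
  proof -
    have "(\<lambda>j. ennreal (\<integral>x. (norm (p j x))\<^sup>2 \<partial>N)) \<longlonglongrightarrow> ennreal 0"
      using that by (simp add: square_integrable_nn_integral)
    then have "(\<lambda>j. \<integral>x. (norm (p j x))\<^sup>2 \<partial>N) \<longlonglongrightarrow> 0"
      by (subst (asm) tendsto_ennreal_iff) (auto intro!: always_eventually)
    from tendsto_real_sqrt[OF this] show ?thesis by simp
  qed
  have a: "a \<longlonglongrightarrow> 0" and b: "b \<longlonglongrightarrow> 0"
    unfolding a_def b_def using lim_real[OF fh limf] lim_real[OF gk limg] by auto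
  have "\<bar>(\<integral>x. f j x \<bullet> g j x \<partial>N) - (\<integral>x. h x \<bullet> k x \<partial>N)\<bar> \<le> a j * b j + a j * B + A * b j" for j
  proof -
    have "f j x \<bullet> g j x = h x \<bullet> k x + ((f j x - h x) \<bullet> (g j x - k x) + (f j x - h x) \<bullet> k x + h x \<bullet> (g j x - k x))" for x
      by (simp add: inner_diff_left inner_diff_right)
    then have "(\<integral>x. f j x \<bullet> g j x \<partial>N) = (\<integral>x. h x \<bullet> k x \<partial>N) + ((\<integral>x. (f j x - h x) \<bullet> (g j x - k x) \<partial>N)
       + (\<integral>x. (f j x - h x) \<bullet> k x \<partial>N) + (\<integral>x. h x \<bullet> (g j x - k x) \<partial>N))"
      using integrable_inner_square_integrable[OF h' k'] integrable_inner_square_integrable[OF fh gk, of j j]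
        integrable_inner_square_integrable[OF fh k', of j] integrable_inner_square_integrable[OF h' gk, of j]
      by simp
    moreover have "\<bar>\<integral>x. (f j x - h x) \<bullet> (g j x - k x) \<partial>N\<bar> \<le> a j * b j"
      "\<bar>\<integral>x. (f j x - h x) \<bullet> k x \<partial>N\<bar> \<le> a j * B" "\<bar>\<integral>x. h x \<bullet> (g j x - k x) \<partial>N\<bar> \<le> A * b j"
      unfolding a_def b_def A_def B_def by (intro integral_inner_le fh gk h' k')+
    ultimately show ?thesis by linarith
  qed
  moreover have "(\<lambda>j. a j * b j + a j * B + A * b j) \<longlonglongrightarrow> 0"
    using tendsto_add[OF tendsto_add[OF tendsto_mult[OF a b] tendsto_mult[OF a tendsto_const[of B]]]
        tendsto_mult[OF tendsto_const[of A] b]] by simp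
  ultimately have "(\<lambda>j. (\<integral>x. f j x \<bullet> g j x \<partial>N) - (\<integral>x. h x \<bullet> k x \<partial>N)) \<longlonglongrightarrow> 0"
    using Lim_null_comparison[of "\<lambda>j. (\<integral>x. f j x \<bullet> g j x \<partial>N) - (\<integral>x. h x \<bullet> k x \<partial>N)"
        "\<lambda>j. a j * b j + a j * B + A * b j" sequentially]
    by (simp add: always_eventually)
  then show ?thesis by (simp add: LIM_zero_iff)
qed

section \<open>Continuous paths seen on a grid\<close>

definition left_grid :: "nat \<Rightarrow> real \<Rightarrow> real" where
  "left_grid n s = real_of_int \<lfloor>s * real (Suc n)\<rfloor> / real (Suc n)"

lemma left_grid_bounds: "left_grid n s \<le> s" "s - 1 / real (Suc n) \<le> left_grid n s"
proof -
  have "real_of_int \<lfloor>s * real (Suc n)\<rfloor> / real (Suc n) \<le> (s * real (Suc n)) / real (Suc n)"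
    by (intro divide_right_mono of_int_floor_le) simp
  then show "left_grid n s \<le> s" by (simp add: left_grid_def del: of_nat_Suc)
  have "(s * real (Suc n) - 1) / real (Suc n) \<le> real_of_int \<lfloor>s * real (Suc n)\<rfloor> / real (Suc n)"
    by (intro divide_right_mono) linarith+
  then show "s - 1 / real (Suc n) \<le> left_grid n s"
    by (simp add: left_grid_def diff_divide_distrib del: of_nat_Suc)
qed

lemma left_grid_nonneg: "0 \<le> s \<Longrightarrow> 0 \<le> left_grid n s"
  by (simp add: left_grid_def)

lemma left_grid_Rats: "left_grid n s \<in> \<rat>"
  by (simp add: left_grid_def)

lemma left_grid_tendsto: "(\<lambda>n. left_grid n s) \<longlonglongrightarrow> s"
proof (rule tendsto_sandwich[where h = "\<lambda>_. s"])
  have "(\<lambda>n. s - 1 / real (Suc n)) \<longlonglongrightarrow> s - 0"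
    by (intro tendsto_diff tendsto_const LIMSEQ_Suc lim_1_over_n)
  then show "(\<lambda>n. s - 1 / real (Suc n)) \<longlonglongrightarrow> s" by simp
qed (auto simp: left_grid_bounds simp del: of_nat_Suc intro!: always_eventually)

lemma left_grid_in: "s \<in> {0..T} \<Longrightarrow> left_grid n s \<in> {0..T}"
  using left_grid_bounds(1)[of n s] left_grid_nonneg[of s n] by auto

lemma continuous_on_left_grid_tendsto:
  fixes f :: "real \<Rightarrow> 'b::topological_space"
  assumes "continuous_on {0..T} f" "s \<in> {0..T}"
  shows "(\<lambda>n. f (left_grid n s)) \<longlonglongrightarrow> f s"
  using assms(1) left_grid_tendsto assms(2)
  by (rule continuous_on_tendsto_compose) (use left_grid_in[OF assms(2)] in auto)

text \<open>
The grid points are rational and approach every time, so a continuous path never exceeds its supremum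
over rational times.  This is what makes the supremum of a continuous process a random variable.
\<close>

lemma SUP_interval_eq_SUP_Rats:
  fixes f :: "real \<Rightarrow> real"
  assumes "continuous_on {0..T} f"
  shows "(SUP s\<in>{0..T}. ennreal (f s)) = (SUP s\<in>{0..T} \<inter> \<rat>. ennreal (f s))"
proof (rule antisym)
  show "(SUP s\<in>{0..T}. ennreal (f s)) \<le> (SUP s\<in>{0..T} \<inter> \<rat>. ennreal (f s))"
  proof (rule SUP_least)
    fix s assume s: "s \<in> {0..T}"
    have "(\<lambda>n. ennreal (f (left_grid n s))) \<longlonglongrightarrow> ennreal (f s)"
      by (intro tendsto_ennrealI continuous_on_left_grid_tendsto[OF assms s])
    then show "ennreal (f s) \<le> (SUP s\<in>{0..T} \<inter> \<rat>. ennreal (f s))"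
      by (rule LIMSEQ_le_const2) (use left_grid_in[OF s] left_grid_Rats in \<open>auto intro!: SUP_upper\<close>)
  qed
qed (auto intro: SUP_subset_mono)

section \<open>Matrices acting on vectors\<close>

lemma bounded_bilinear_matrix_vector_mult:
  "bounded_bilinear ((*v) :: real^'k^'l \<Rightarrow> real^'k \<Rightarrow> real^'l)"
  unfolding bilinear_conv_bounded_bilinear[symmetric] bilinear_def
  by (auto intro!: linearI simp: matrix_vector_mult_add_rdistrib matrix_vector_right_distrib
      scaleR_matrix_vector_assoc matrix_vector_mult_scaleR)

lemma borel_measurable_matrix_vector_mult [measurable (raw)]:
  fixes A :: "'c \<Rightarrow> real^'k^'l"
  assumes "A \<in> borel_measurable N" "f \<in> borel_measurable N"
  shows "(\<lambda>x. A x *v f x) \<in> borel_measurable N"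
  by (rule borel_measurable_continuous_Pair[OF assms])
     (intro bounded_bilinear.continuous_on[OF bounded_bilinear_matrix_vector_mult] continuous_intros)

lemma L_infty_transpose:
  fixes A :: "real \<Rightarrow> real^'k^'l"
  assumes "L_infty T A"
  shows "L_infty T (\<lambda>s. transpose (A s))"
proof -
  have lin: "bounded_linear (transpose :: real^'k^'l \<Rightarrow> real^'l^'k)"
    unfolding linear_conv_bounded_linear[symmetric]
    by (auto intro!: linearI simp: transpose_def vec_eq_iff)
  obtain K where K: "\<And>B :: real^'k^'l. norm (transpose B) \<le> norm B * K" and "0 \<le> K"
    using bounded_linear.nonneg_bounded[OF lin] by blast
  obtain C where C: "AE s in lborel. s \<in> {0..T} \<longrightarrow> norm (A s) \<le> C"
    using assms by (auto simp: L_infty_def)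
  have "AE s in lborel. s \<in> {0..T} \<longrightarrow> norm (transpose (A s)) \<le> C * K"
    using C by eventually_elim (use K \<open>0 \<le> K\<close> in \<open>blast intro: order_trans mult_right_mono\<close>)
  moreover have "(\<lambda>s. transpose (A s)) \<in> borel_measurable (restrict_space lborel {0..T})"
    using assms measurable_compose[OF _ borel_measurable_continuous_onI[OF linear_continuous_on[OF lin]]]
    by (auto simp: L_infty_def)
  ultimately show ?thesis by (auto simp: L_infty_def)
qed

lemma inner_transpose:
  fixes A :: "real^'k^'l"
  shows "(transpose A *v y) \<bullet> x = (A *v x) \<bullet> y"
  by (metis dot_lmul_matrix inner_commute transpose_matrix_vector)

lemma square_integrable_matrix_vector_mult:
  fixes A :: "real^'k^'l"
  assumes f: "square_integrable N f"
  shows "square_integrable N (\<lambda>x. A *v f x)"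
proof -
  obtain K where K: "\<And>v. norm (A *v v) \<le> norm v * K" and "0 \<le> K"
    using bounded_linear.nonneg_bounded[OF matrix_vector_mul_bounded_linear[of A]] by blast
  have le: "(norm (A *v v))\<^sup>2 \<le> K\<^sup>2 * (norm v)\<^sup>2" for v
    using power_mono[OF K[of v] norm_ge_zero, of 2] by (simp add: power_mult_distrib mult.commute)
  have "integrable N (\<lambda>x. K\<^sup>2 * (norm (f x))\<^sup>2)" using f by (simp add: square_integrable_def)
  then show ?thesis
    by (rule square_integrable_mono[rotated])
       (use le square_integrable_measurable[OF f] in \<open>auto intro!: borel_measurable_matrix_vector_mult\<close>)
qed

text \<open>
Taylor expansion of a quadratic form at \<open>x\<close>, exact to second order.
\<close>

lemma quadratic_expansion:
  fixes S :: "real^'k^'k"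
  assumes "symmetric_matrix S"
  shows "(S *v y) \<bullet> y = (S *v x) \<bullet> x + 2 * ((S *v x) \<bullet> (y - x)) + (S *v (y - x)) \<bullet> (y - x)"
proof -
  have "(S *v x) \<bullet> y = (S *v y) \<bullet> x"
    using assms by (metis inner_transpose symmetric_matrix_def)
  then show ?thesis
    by (simp add: matrix_vector_mult_diff_distrib inner_diff_left inner_diff_right)
qed

section \<open>The filtration and the product of time and sample space\<close>

text \<open>
The final time \<open>T\<close> is part of the setting because all processes live on the product of \<open>[0, T]\<close>
with the sample space.
\<close>

locale brownian_setup = prob_space M
  for M :: "'a measure" +
  fixes W :: "real \<Rightarrow> 'a \<Rightarrow> real" and T :: real
  assumes T_pos: "0 < T" and brownian: "brownian_motion M W"
begin

abbreviation F :: "real \<Rightarrow> 'a measure" where "F t \<equiv> brownian_filtration M W t"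
abbreviation time :: "real measure" where "time \<equiv> restrict_space lborel {0..T}"
abbreviation PT :: "(real \<times> 'a) measure" where "PT \<equiv> time \<Otimes>\<^sub>M M"

lemma space_time: "space time = {0..T}"
  by (simp add: space_restrict_space)

sublocale time: finite_measure time
  by (rule finite_measureI) (simp add: space_time emeasure_restrict_space emeasure_lborel_Icc_eq)

sublocale PT: pair_sigma_finite time M ..

sublocale PT: finite_measure PT
proof (rule finite_measureI)
  have "space PT = {0..T} \<times> space M" by (simp add: space_pair_measure space_time)
  moreover have "{0..T} \<in> sets time" using space_time sets.top[of time] by auto
  ultimately have "emeasure PT (space PT) = emeasure time {0..T} * emeasure M (space M)"
    by (simp add: emeasure_pair_measure_Times)
  then show "emeasure PT (space PT) \<noteq> \<infinity>"
    by (simp add: emeasure_restrict_space emeasure_space_1 emeasure_lborel_Icc_eq)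
qed

lemma AE_time_iff: "(AE s in time. P s) \<longleftrightarrow> (AE s in lborel. s \<in> {0..T} \<longrightarrow> P s)"
  by (rule AE_restrict_space_iff) simp

lemma space_F [simp]: "space (F t) = space M"
  by (simp add: brownian_filtration_def space_measure_of_conv)

lemma generators_F_subset:
  "{W s -` S \<inter> space M | s S. s \<in> {0..t} \<and> S \<in> sets borel} \<union> null_sets M \<subseteq> sets M"
  using brownian by (auto simp: brownian_motion_def dest: measurable_sets)

lemma generators_F_Pow:
  "{W s -` S \<inter> space M | s S. s \<in> {0..t} \<and> S \<in> sets borel} \<union> null_sets M \<subseteq> Pow (space M)"
  using generators_F_subset sets.sets_into_space by fast

lemma sets_F:
  "sets (F t) = sigma_sets (space M)
     ({W s -` S \<inter> space M | s S. s \<in> {0..t} \<and> S \<in> sets borel} \<union> null_sets M)"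
  unfolding brownian_filtration_def by (rule sets_measure_of[OF generators_F_Pow])

lemma sets_F_subset: "sets (F t) \<subseteq> sets M"
  unfolding sets_F by (rule sets.sigma_sets_subset[OF generators_F_subset])

lemma sets_F_mono:
  assumes "s \<le> t"
  shows "sets (F s) \<subseteq> sets (F t)"
proof -
  have "{0..s} \<subseteq> {0..t}" using assms by auto
  then show ?thesis
    unfolding sets_F by (intro sigma_sets_mono') blast
qed

lemma measurable_F_mono: "f \<in> measurable (F s) N \<Longrightarrow> s \<le> t \<Longrightarrow> f \<in> measurable (F t) N"
  using measurable_mono[OF order_refl refl sets_F_mono[of s t]] by auto

lemma measurable_F_M: "f \<in> measurable (F s) N \<Longrightarrow> f \<in> measurable M N"
  using measurable_mono[OF order_refl refl sets_F_subset[of s]] by auto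

lemma W_measurable_F:
  assumes "0 \<le> s" "s \<le> t" shows "W s \<in> borel_measurable (F t)"
proof (rule measurableI)
  fix A :: "real set" assume "A \<in> sets borel"
  then show "W s -` A \<inter> space (F t) \<in> sets (F t)"
    using assms by (auto simp: sets_F intro!: sigma_sets.Basic)
qed simp

lemma iterated_nn_integral:
  assumes "(\<lambda>p. f (fst p) (snd p)) \<in> borel_measurable PT"
  shows "(\<integral>\<^sup>+\<omega>. (\<integral>\<^sup>+s\<in>{0..T}. f s \<omega> \<partial>lborel) \<partial>M) = (\<integral>\<^sup>+p. f (fst p) (snd p) \<partial>PT)"
  using PT.nn_integral_snd[of "\<lambda>p. f (fst p) (snd p)"] assms
  by (simp add: nn_integral_restrict_space case_prod_beta')

lemma iterated_integral:
  fixes f :: "real \<Rightarrow> 'a \<Rightarrow> real"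
  assumes "integrable PT (\<lambda>p. f (fst p) (snd p))"
  shows "(LINT \<omega>|M. (LBINT s:{0..T}. f s \<omega>)) = (\<integral>p. f (fst p) (snd p) \<partial>PT)"
    and "integrable M (\<lambda>\<omega>. (LBINT s:{0..T}. f s \<omega>))"
  using PT.integral_snd[of f] PT.integrable_snd[of f] assms
  by (simp_all add: integral_restrict_space set_lebesgue_integral_def case_prod_beta')

lemma integral_PT_fst:
  fixes f :: "real \<Rightarrow> 'a \<Rightarrow> real"
  assumes "integrable PT (\<lambda>p. f (fst p) (snd p))"
  shows "(\<integral>p. f (fst p) (snd p) \<partial>PT) = (\<integral>s. (\<integral>\<omega>. f s \<omega> \<partial>M) \<partial>time)"
  using PT.integral_fst[of f] assms by (simp add: case_prod_beta')

lemma L2_processes_iff: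
  "\<phi> \<in> L2_processes M W T \<longleftrightarrow> adapted M W T \<phi> \<and> square_integrable PT (\<lambda>p. \<phi> (fst p) (snd p))"
proof -
  have "(\<integral>\<^sup>+\<omega>. (\<integral>\<^sup>+s\<in>{0..T}. ennreal ((norm (\<phi> s \<omega>))\<^sup>2) \<partial>lborel) \<partial>M)
      = (\<integral>\<^sup>+p. ennreal ((norm (\<phi> (fst p) (snd p)))\<^sup>2) \<partial>PT)"
    if [measurable]: "(\<lambda>p. \<phi> (fst p) (snd p)) \<in> borel_measurable PT"
    by (rule iterated_nn_integral[of "\<lambda>s \<omega>. ennreal ((norm (\<phi> s \<omega>))\<^sup>2)"]) simp
  then show ?thesis
    by (auto simp: L2_processes_def case_prod_beta' square_integrable_iff_nn_integral)
qed

lemma L2_processesD: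
  assumes "\<phi> \<in> L2_processes M W T"
  shows "square_integrable PT (\<lambda>p. \<phi> (fst p) (snd p))"
    and "\<And>t. t \<in> {0..T} \<Longrightarrow> \<phi> t \<in> borel_measurable (F t)"
    and "\<And>t. t \<in> {0..T} \<Longrightarrow> \<phi> t \<in> borel_measurable M"
  using assms by (auto simp: L2_processes_iff adapted_def intro: measurable_F_M)

text \<open>
By Fubini, almost every time slice and almost every path of a square-integrable process is square
integrable.
\<close>

lemma AE_square_integrable_section:
  assumes "square_integrable PT (\<lambda>p. \<phi> (fst p) (snd p))"
  shows "AE s in time. square_integrable M (\<phi> s)"
    and "AE \<omega> in M. square_integrable time (\<lambda>s. \<phi> s \<omega>)"
proof -
  have m: "(\<lambda>p. \<phi> (fst p) (snd p)) \<in> borel_measurable PT"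
    and i: "integrable PT (\<lambda>p. (norm (\<phi> (fst p) (snd p)))\<^sup>2)"
    using assms by (auto simp: square_integrable_def)
  show "AE s in time. square_integrable M (\<phi> s)"
    using PT.AE_integrable_fst'[OF i] AE_space
  proof eventually_elim
    case (elim s)
    with measurable_compose[OF measurable_Pair1'[of s time M] m]
    show ?case by (simp add: square_integrable_def)
  qed
  have "AE \<omega> in M. integrable time (\<lambda>s. (norm (\<phi> s \<omega>))\<^sup>2)"
    using PT.AE_integrable_snd[of "\<lambda>s \<omega>. (norm (\<phi> s \<omega>))\<^sup>2"] i by (simp add: case_prod_beta')
  with AE_space show "AE \<omega> in M. square_integrable time (\<lambda>s. \<phi> s \<omega>)"
  proof eventually_elim
    case (elim \<omega>)
    with measurable_compose[OF measurable_Pair2'[of \<omega> M time] m]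
    show ?case by (simp add: square_integrable_def)
  qed
qed

lemma square_integrable_integrable:
  "square_integrable M f \<Longrightarrow> integrable M f"
  "square_integrable time h \<Longrightarrow> integrable time h"
  "square_integrable PT k \<Longrightarrow> integrable PT k"
proof -
  have *: "integrable N g" if "finite_measure N" "square_integrable N g" for N :: "'x measure" and g :: "'x \<Rightarrow> 'y::euclidean_space"
  proof -
    have "integrable N (\<lambda>x. norm (g x))"
      by (rule finite_measure.square_integrable_imp_integrable[OF that(1)])
         (use that(2) in \<open>auto simp: square_integrable_def\<close>)
    then show ?thesis
      using that by (auto simp: square_integrable_def integrable_norm_iff)
  qed
  show "square_integrable M f \<Longrightarrow> integrable M f"
    "square_integrable time h \<Longrightarrow> integrable time h"
    "square_integrable PT k \<Longrightarrow> integrable PT k"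
    by (auto intro!: * time.finite_measure_axioms PT.finite_measure_axioms finite_measure_axioms)
qed

lemma set_integrable_time:
  fixes f :: "real \<Rightarrow> 'b::{banach, second_countable_topology}"
  shows "set_integrable lborel {0..T} f \<longleftrightarrow> integrable time f"
  by (simp add: set_integrable_def integrable_restrict_space)

lemma set_integral_time:
  fixes f :: "real \<Rightarrow> 'b::{banach, second_countable_topology}"
  shows "(LBINT s:{0..T}. f s) = (\<integral>s. f s \<partial>time)"
  by (simp add: set_lebesgue_integral_def integral_restrict_space)

lemma L2_processes_add:
  assumes "\<phi> \<in> L2_processes M W T" "\<psi> \<in> L2_processes M W T"
  shows "(\<lambda>s \<omega>. \<phi> s \<omega> + \<psi> s \<omega>) \<in> L2_processes M W T"
  using assms by (auto simp: L2_processes_iff adapted_def intro!: borel_measurable_add)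

lemma L2_processes_minus:
  assumes "\<phi> \<in> L2_processes M W T"
  shows "(\<lambda>s \<omega>. - \<phi> s \<omega>) \<in> L2_processes M W T"
  using assms by (auto simp: L2_processes_iff adapted_def)

lemma L2_processes_diff:
  assumes "\<phi> \<in> L2_processes M W T" "\<psi> \<in> L2_processes M W T"
  shows "(\<lambda>s \<omega>. \<phi> s \<omega> - \<psi> s \<omega>) \<in> L2_processes M W T"
  using L2_processes_add[OF assms(1) L2_processes_minus[OF assms(2)]] by simp

section \<open>Processes with continuous paths\<close>

text \<open>
A continuous process is the pointwise limit of the processes frozen at the last grid point; these
are jointly measurable because they run through countably many random variables.
\<close>

lemma continuous_jointly_measurable:
  fixes X :: "real \<Rightarrow> 'a \<Rightarrow> 'b::euclidean_space"
  assumes m: "\<And>t. t \<in> {0..T} \<Longrightarrow> X t \<in> borel_measurable M"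
    and c: "\<And>\<omega>. \<omega> \<in> space M \<Longrightarrow> continuous_on {0..T} (\<lambda>t. X t \<omega>)"
  shows "(\<lambda>p. X (fst p) (snd p)) \<in> borel_measurable PT"
proof (rule borel_measurable_LIMSEQ_metric)
  fix n
  \<comment> \<open>Truncation to \<open>[0, T]\<close> keeps the frozen process inside the times where it is measurable.\<close>
  define f where "f i p = X (max 0 (min T (real_of_int i / real (Suc n)))) (snd p)" for i :: int and p :: "real \<times> 'a"
  have [measurable]: "f i \<in> borel_measurable PT" for i
    unfolding f_def using T_pos by (intro measurable_compose[OF measurable_snd] m) auto
  have [measurable]: "(\<lambda>s::real. s) \<in> borel_measurable time"
    by (rule measurable_restrict_space1) simp
  have "(\<lambda>p. f \<lfloor>fst p * real (Suc n)\<rfloor> p) \<in> borel_measurable PT"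
    by (rule measurable_compose_countable[where f = f]) measurable
  moreover have "f \<lfloor>fst p * real (Suc n)\<rfloor> p = X (left_grid n (fst p)) (snd p)" if "p \<in> space PT" for p
    using left_grid_in[of "fst p" T n] that
    by (auto simp: f_def space_pair_measure space_time left_grid_def[symmetric] simp del: of_nat_Suc)
  ultimately show "(\<lambda>p. X (left_grid n (fst p)) (snd p)) \<in> borel_measurable PT"
    by (subst measurable_cong[where g = "\<lambda>p. f \<lfloor>fst p * real (Suc n)\<rfloor> p"]) auto
next
  fix p assume "p \<in> space PT"
  then show "(\<lambda>n. X (left_grid n (fst p)) (snd p)) \<longlonglongrightarrow> X (fst p) (snd p)"
    by (intro continuous_on_left_grid_tendsto[OF c]) (auto simp: space_pair_measure space_time)
qed

lemma measurable_SUP: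
  fixes X :: "real \<Rightarrow> 'a \<Rightarrow> 'b::euclidean_space"
  assumes m: "\<And>t. t \<in> {0..T} \<Longrightarrow> X t \<in> borel_measurable M"
    and c: "\<And>\<omega>. \<omega> \<in> space M \<Longrightarrow> continuous_on {0..T} (\<lambda>t. X t \<omega>)"
  shows "(\<lambda>\<omega>. SUP s\<in>{0..T}. ennreal ((norm (X s \<omega>))\<^sup>2)) \<in> borel_measurable M"
proof -
  have "(\<lambda>\<omega>. SUP s\<in>{0..T} \<inter> \<rat>. ennreal ((norm (X s \<omega>))\<^sup>2)) \<in> borel_measurable M"
    by (rule borel_measurable_SUP) (use m countable_rat in \<open>auto intro!: measurable_compose[OF _ measurable_ennreal] borel_measurable_power borel_measurable_norm\<close>)
  then show ?thesis
    by (subst measurable_cong[OF SUP_interval_eq_SUP_Rats]) (auto intro!: continuous_intros c)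
qed

lemma sup_L2_processesD:
  assumes "X \<in> sup_L2_processes M W T"
  shows "adapted M W T X"
    and "\<And>t. t \<in> {0..T} \<Longrightarrow> X t \<in> borel_measurable (F t)"
    and "\<And>t. t \<in> {0..T} \<Longrightarrow> X t \<in> borel_measurable M"
    and "\<And>\<omega>. \<omega> \<in> space M \<Longrightarrow> continuous_on {0..T} (\<lambda>t. X t \<omega>)"
    and "(\<integral>\<^sup>+\<omega>. (SUP s\<in>{0..T}. ennreal ((norm (X s \<omega>))\<^sup>2)) \<partial>M) < \<infinity>"
  using assms by (auto simp: sup_L2_processes_def adapted_def intro: measurable_F_M)

lemma sup_L2_square_integrable:
  assumes X: "X \<in> sup_L2_processes M W T" and t: "t \<in> {0..T}"
  shows "square_integrable M (X t)"
proof (rule square_integrableI)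
  have "(\<integral>\<^sup>+\<omega>. ennreal ((norm (X t \<omega>))\<^sup>2) \<partial>M) \<le> (\<integral>\<^sup>+\<omega>. (SUP s\<in>{0..T}. ennreal ((norm (X s \<omega>))\<^sup>2)) \<partial>M)"
    by (intro nn_integral_mono SUP_upper t)
  also note sup_L2_processesD(5)[OF X]
  finally show "(\<integral>\<^sup>+\<omega>. ennreal ((norm (X t \<omega>))\<^sup>2) \<partial>M) < \<infinity>" .
qed (use sup_L2_processesD(3)[OF X t] in simp)

text \<open>
The time integral of \<open>|X|\<^sup>2\<close> is at most \<open>T\<close> times its supremum.
\<close>

lemma sup_L2_subset_L2:
  assumes X: "X \<in> sup_L2_processes M W T"
  shows "X \<in> L2_processes M W T"
  unfolding L2_processes_def
proof (safe)
  note D = sup_L2_processesD[OF X]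
  show "adapted M W T X" by (rule D)
  show "(\<lambda>(s, \<omega>). X s \<omega>) \<in> borel_measurable PT"
    using continuous_jointly_measurable[OF D(3,4)] by (simp add: case_prod_beta')
  have "(\<integral>\<^sup>+\<omega>. (\<integral>\<^sup>+s\<in>{0..T}. ennreal ((norm (X s \<omega>))\<^sup>2) \<partial>lborel) \<partial>M)
      \<le> (\<integral>\<^sup>+\<omega>. (SUP s\<in>{0..T}. ennreal ((norm (X s \<omega>))\<^sup>2)) * ennreal T \<partial>M)"
  proof (rule nn_integral_mono)
    fix \<omega>
    have "(\<integral>\<^sup>+s\<in>{0..T}. ennreal ((norm (X s \<omega>))\<^sup>2) \<partial>lborel)
       \<le> (\<integral>\<^sup>+s. (SUP s\<in>{0..T}. ennreal ((norm (X s \<omega>))\<^sup>2)) * indicator {0..T} s \<partial>lborel)"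
      by (intro nn_integral_mono) (auto split: split_indicator intro: SUP_upper)
    also have "\<dots> = (SUP s\<in>{0..T}. ennreal ((norm (X s \<omega>))\<^sup>2)) * ennreal T"
      using T_pos by (subst nn_integral_cmult_indicator) auto
    finally show "(\<integral>\<^sup>+s\<in>{0..T}. ennreal ((norm (X s \<omega>))\<^sup>2) \<partial>lborel)
       \<le> (SUP s\<in>{0..T}. ennreal ((norm (X s \<omega>))\<^sup>2)) * ennreal T" .
  qed
  also have "\<dots> = (\<integral>\<^sup>+\<omega>. (SUP s\<in>{0..T}. ennreal ((norm (X s \<omega>))\<^sup>2)) \<partial>M) * ennreal T"
    by (rule nn_integral_multc[OF measurable_SUP[OF D(3,4)]])
  also have "\<dots> < \<infinity>"
    using D(5) by (auto simp: ennreal_mult_less_top)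
  finally show "(\<integral>\<^sup>+\<omega>. (\<integral>\<^sup>+s\<in>{0..T}. ennreal ((norm (X s \<omega>))\<^sup>2) \<partial>lborel) \<partial>M) < \<infinity>" .
qed

lemma sup_L2_diff:
  assumes X: "X \<in> sup_L2_processes M W T" and Y: "Y \<in> sup_L2_processes M W T"
  shows "(\<lambda>s \<omega>. X s \<omega> - Y s \<omega>) \<in> sup_L2_processes M W T"
proof -
  note D = sup_L2_processesD[OF X] and E = sup_L2_processesD[OF Y]
  let ?S = "\<lambda>Z \<omega>. SUP s\<in>{0..T}. ennreal ((norm (Z s \<omega>))\<^sup>2)"
  have "(\<integral>\<^sup>+\<omega>. ?S (\<lambda>s \<omega>. X s \<omega> - Y s \<omega>) \<omega> \<partial>M) \<le> (\<integral>\<^sup>+\<omega>. 2 * ?S X \<omega> + 2 * ?S Y \<omega> \<partial>M)"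
  proof (intro nn_integral_mono SUP_least)
    fix \<omega> s assume s: "s \<in> {0..T}"
    have "ennreal ((norm (X s \<omega> - Y s \<omega>))\<^sup>2) \<le> ennreal (2 * (norm (X s \<omega>))\<^sup>2 + 2 * (norm (Y s \<omega>))\<^sup>2)"
      using norm_add_sq_le[of "X s \<omega>" "- Y s \<omega>"] by (intro ennreal_leI) simp
    also have "\<dots> = 2 * ennreal ((norm (X s \<omega>))\<^sup>2) + 2 * ennreal ((norm (Y s \<omega>))\<^sup>2)"
      by (simp add: ennreal_mult)
    also have "\<dots> \<le> 2 * ?S X \<omega> + 2 * ?S Y \<omega>"
      by (intro add_mono mult_left_mono SUP_upper s) auto
    finally show "ennreal ((norm (X s \<omega> - Y s \<omega>))\<^sup>2) \<le> 2 * ?S X \<omega> + 2 * ?S Y \<omega>" .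
  qed
  also have "\<dots> = 2 * (\<integral>\<^sup>+\<omega>. ?S X \<omega> \<partial>M) + 2 * (\<integral>\<^sup>+\<omega>. ?S Y \<omega> \<partial>M)"
    using measurable_SUP[OF D(3,4)] measurable_SUP[OF E(3,4)]
    by (simp add: nn_integral_add nn_integral_cmult)
  also have "\<dots> < \<infinity>"
    using D(5) E(5) by (simp add: ennreal_mult_less_top)
  finally show ?thesis
    using D E by (auto simp: sup_L2_processes_def adapted_def intro!: continuous_intros)
qed

section \<open>Means and deterministic coefficients\<close>

text \<open>
Jensen's inequality for the square.  Where \<open>\<phi> s\<close> is not square integrable the right-hand side is
infinite, so the estimate holds at every time.
\<close>

lemma norm_mean_sq_le:
  assumes "\<phi> s \<in> borel_measurable M"
  shows "ennreal ((norm (mean M \<phi> s))\<^sup>2) \<le> (\<integral>\<^sup>+\<omega>. ennreal ((norm (\<phi> s \<omega>))\<^sup>2) \<partial>M)"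
proof (cases "square_integrable M (\<phi> s)")
  case True
  have n: "square_integrable M (\<lambda>\<omega>. norm (\<phi> s \<omega>))"
    using True by (auto simp: square_integrable_def)
  have "norm (mean M \<phi> s) \<le> (\<integral>\<omega>. norm (\<phi> s \<omega>) \<partial>M)"
    unfolding mean_def by (rule integral_norm_bound)
  also have "\<dots> \<le> sqrt (\<integral>\<omega>. (norm (\<phi> s \<omega>))\<^sup>2 \<partial>M)"
    using integral_inner_le[OF n, of "\<lambda>_. 1"] by (simp add: square_integrable_def prob_space)
  finally have "(norm (mean M \<phi> s))\<^sup>2 \<le> (\<integral>\<omega>. (norm (\<phi> s \<omega>))\<^sup>2 \<partial>M)"
    by (metis norm_ge_zero real_sqrt_le_iff real_sqrt_unique)
  then show ?thesis
    by (simp add: square_integrable_nn_integral[OF True])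
next
  case False
  then have "(\<integral>\<^sup>+\<omega>. ennreal ((norm (\<phi> s \<omega>))\<^sup>2) \<partial>M) = \<infinity>"
    using assms square_integrableI by (metis infinity_ennreal_def top.not_eq_extremum)
  then show ?thesis by simp
qed

lemma measurable_mean:
  fixes \<phi> :: "real \<Rightarrow> 'a \<Rightarrow> 'b::euclidean_space"
  assumes "(\<lambda>p. \<phi> (fst p) (snd p)) \<in> borel_measurable PT"
  shows "mean M \<phi> \<in> borel_measurable time"
  using borel_measurable_lebesgue_integral[of \<phi> time] assms
  by (simp add: mean_def[abs_def] case_prod_beta')

text \<open>
A mean is deterministic, hence adapted; its norm is controlled slice by slice by Jensen's
inequality.
\<close>

lemma L2_mean:
  fixes \<phi> :: "real \<Rightarrow> 'a \<Rightarrow> 'b::euclidean_space"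
  assumes \<phi>: "\<phi> \<in> L2_processes M W T"
  shows "(\<lambda>s \<omega>. mean M \<phi> s) \<in> L2_processes M W T"
proof -
  note D = L2_processesD[OF \<phi>]
  have [measurable]: "(\<lambda>p. \<phi> (fst p) (snd p)) \<in> borel_measurable PT" using D(1) by (rule square_integrable_measurable)
  note [measurable] = measurable_mean[OF this]
  have "(\<integral>\<^sup>+p. ennreal ((norm (mean M \<phi> (fst p)))\<^sup>2) \<partial>PT) = (\<integral>\<^sup>+s. ennreal ((norm (mean M \<phi> s))\<^sup>2) \<partial>time)"
    using nn_integral_fst[of "\<lambda>p. ennreal ((norm (mean M \<phi> (fst p)))\<^sup>2)" time]
    by (simp add: emeasure_space_1)
  also have "\<dots> \<le> (\<integral>\<^sup>+s. (\<integral>\<^sup>+\<omega>. ennreal ((norm (\<phi> s \<omega>))\<^sup>2) \<partial>M) \<partial>time)"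
    by (intro nn_integral_mono norm_mean_sq_le D) (simp add: space_time)
  also have "\<dots> = (\<integral>\<^sup>+p. ennreal ((norm (\<phi> (fst p) (snd p)))\<^sup>2) \<partial>PT)"
    using nn_integral_fst[of "\<lambda>p. ennreal ((norm (\<phi> (fst p) (snd p)))\<^sup>2)" time] by simp
  also have "\<dots> < \<infinity>"
    by (simp add: square_integrable_nn_integral[OF D(1)])
  finally show ?thesis
    unfolding L2_processes_iff by (auto simp: adapted_def intro!: square_integrableI)
qed

lemma L2_coefficient:
  fixes A :: "real \<Rightarrow> real^'k^'l" and \<phi> :: "real \<Rightarrow> 'a \<Rightarrow> real^'k"
  assumes A: "L_infty T A" and \<phi>: "\<phi> \<in> L2_processes M W T"
  shows "(\<lambda>s \<omega>. A s *v \<phi> s \<omega>) \<in> L2_processes M W T"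
proof -
  note D = L2_processesD[OF \<phi>]
  have [measurable]: "A \<in> borel_measurable time"
    using A by (auto simp: L_infty_def)
  have m [measurable]: "(\<lambda>p. \<phi> (fst p) (snd p)) \<in> borel_measurable PT" using D(1) by (rule square_integrable_measurable)
  obtain K where K: "\<And>(B :: real^'k^'l) v. norm (B *v v) \<le> norm B * norm v * K" and "0 \<le> K"
    using bounded_bilinear.nonneg_bounded[OF bounded_bilinear_matrix_vector_mult] by blast
  obtain C where C: "AE s in time. norm (A s) \<le> C"
    using A by (auto simp: L_infty_def AE_time_iff)
  have "AE s in time. AE \<omega> in M. norm (A (fst (s, \<omega>))) \<le> C"
    using C by eventually_elim simp
  then have "AE p in PT. norm (A (fst p)) \<le> C"
    by (intro PT.AE_pair_measure) measurable
  then have "AE p in PT. (norm (A (fst p) *v \<phi> (fst p) (snd p)))\<^sup>2 \<le> (C * K)\<^sup>2 * (norm (\<phi> (fst p) (snd p)))\<^sup>2"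
  proof eventually_elim
    case (elim p)
    have "norm (A (fst p) *v \<phi> (fst p) (snd p)) \<le> norm (A (fst p)) * norm (\<phi> (fst p) (snd p)) * K"
      by (rule K)
    also have "\<dots> \<le> C * norm (\<phi> (fst p) (snd p)) * K"
      by (intro mult_right_mono elim \<open>0 \<le> K\<close> norm_ge_zero)
    finally have "norm (A (fst p) *v \<phi> (fst p) (snd p)) \<le> (C * K) * norm (\<phi> (fst p) (snd p))"
      by (simp add: algebra_simps)
    then show ?case by (metis norm_ge_zero power_mono power_mult_distrib)
  qed
  then have "square_integrable PT (\<lambda>p. A (fst p) *v \<phi> (fst p) (snd p))"
    using D(1) by (intro square_integrable_mono) (auto simp: square_integrable_def)
  then show ?thesis
    unfolding L2_processes_iff adapted_def using D(2) by (auto intro!: borel_measurable_matrix_vector_mult)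
qed

end

section \<open>Refinement of time grids\<close>

lemma grid_mono:
  fixes t :: "nat \<Rightarrow> real"
  assumes "\<forall>i<k. t i \<le> t (Suc i)" "i \<le> j" "j \<le> k"
  shows "t i \<le> t j"
  using assms(2,3)
proof (induction j rule: dec_induct)
  case (step n)
  then have "t i \<le> t n" "t n \<le> t (Suc n)" using assms(1) by simp_all
  then show ?case by (rule order_trans)
qed simp

lemma grid_strict_mono_iff:
  fixes \<tau> :: "nat \<Rightarrow> real"
  assumes "\<forall>j<N. \<tau> j < \<tau> (Suc j)" "a \<le> N" "b \<le> N"
  shows "\<tau> a \<le> \<tau> b \<longleftrightarrow> a \<le> b"
proof -
  have less: "\<tau> i < \<tau> j" if "i < j" "j \<le> N" for i j
    using that
  proof (induction j)
    case (Suc j)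
    then have "\<tau> i \<le> \<tau> j" by (cases "i = j") auto
    also have "\<tau> j < \<tau> (Suc j)" using Suc.prems assms(1) by auto
    finally show ?case .
  qed simp
  show ?thesis
    using less[of a b] less[of b a] assms(2,3) by (cases a b rule: linorder_cases) auto
qed

text \<open>
The grid intervals contained in \<open>[p, q]\<close> are consecutive, so the increments of \<open>g\<close> over them
telescope.
\<close>

lemma grid_telescope:
  fixes \<tau> :: "nat \<Rightarrow> real" and g :: "real \<Rightarrow> 'v::ab_group_add"
  assumes \<tau>: "\<forall>j<N. \<tau> j < \<tau> (Suc j)" and p: "p \<in> \<tau> ` {..N}" and q: "q \<in> \<tau> ` {..N}" and "p \<le> q"
  shows "(\<Sum>j<N. if p \<le> \<tau> j \<and> \<tau> (Suc j) \<le> q then g (\<tau> (Suc j)) - g (\<tau> j) else 0) = g q - g p"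
proof -
  from p q obtain a b where ab: "p = \<tau> a" "q = \<tau> b" "a \<le> N" "b \<le> N" by auto
  with \<open>p \<le> q\<close> have "a \<le> b" using grid_strict_mono_iff[OF \<tau>] by auto
  have "(\<Sum>j<N. if p \<le> \<tau> j \<and> \<tau> (Suc j) \<le> q then g (\<tau> (Suc j)) - g (\<tau> j) else 0)
      = (\<Sum>j\<in>{j\<in>{..<N}. p \<le> \<tau> j \<and> \<tau> (Suc j) \<le> q}. g (\<tau> (Suc j)) - g (\<tau> j))"
    by (rule sum.inter_filter[symmetric]) simp
  also have "{j\<in>{..<N}. p \<le> \<tau> j \<and> \<tau> (Suc j) \<le> q} = {a..<b}"
    using ab grid_strict_mono_iff[OF \<tau>, of a] grid_strict_mono_iff[OF \<tau>, of "Suc _" b] by (auto simp: Suc_le_eq)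
  also have "(\<Sum>j = a..<b. g (\<tau> (Suc j)) - g (\<tau> j)) = g (\<tau> b) - g (\<tau> a)"
    by (rule sum_Suc_diff'[OF \<open>a \<le> b\<close>])
  finally show ?thesis using ab by simp
qed

lemma finite_set_strict_grid:
  fixes P :: "real set"
  assumes "finite P" "P \<noteq> {}"
  obtains N \<tau> where "\<forall>j<N. \<tau> j < \<tau> (Suc j)" "\<tau> ` {..N} = P"
proof -
  define \<tau> where "\<tau> j = sorted_list_of_set P ! j" for j
  define N where "N = card P - 1"
  have len: "length (sorted_list_of_set P) = Suc N"
    using assms by (simp add: N_def card_gt_0_iff)
  have "\<forall>j<N. \<tau> j < \<tau> (Suc j)"
    unfolding \<tau>_def using len
    by (auto intro!: sorted_wrt_nth_less[OF strict_sorted_list_of_set])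
  moreover have "\<tau> ` {..N} = set (sorted_list_of_set P)"
    unfolding \<tau>_def set_conv_nth len by (auto simp: less_Suc_eq_le)
  ultimately show ?thesis using that assms by simp
qed

text \<open>
On a strictly increasing grid through all points of \<open>t\<close>, a grid interval lies in at most one interval
of \<open>t\<close>; the sum picks the value attached to it.
\<close>

definition refined_values :: "nat \<Rightarrow> (nat \<Rightarrow> real) \<Rightarrow> (nat \<Rightarrow> 'c \<Rightarrow> 'b::real_vector) \<Rightarrow> (nat \<Rightarrow> real) \<Rightarrow> nat \<Rightarrow> 'c \<Rightarrow> 'b" where
  "refined_values k t \<xi> \<tau> j \<omega> = (\<Sum>i<k. if t i \<le> \<tau> j \<and> \<tau> (Suc j) \<le> t (Suc i) then \<xi> i \<omega> else 0)"

text \<open>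
A simple process and its stochastic integral are both sums of increments of some function \<open>g\<close>
weighted by the values of the integrand: \<open>g\<close> is the indicator of \<open>[s, \<infinity>)\<close> in the first case and a
stopped Brownian path in the second.  Treating \<open>g\<close> abstractly shows at once that neither depends on
the grid.
\<close>

lemma sum_refined_values:
  fixes g :: "real \<Rightarrow> real"
  assumes \<tau>: "\<forall>j<N. \<tau> j < \<tau> (Suc j)" and sub: "t ` {..k} \<subseteq> \<tau> ` {..N}" and t: "\<forall>i<k. t i \<le> t (Suc i)"
  shows "(\<Sum>j<N. (g (\<tau> (Suc j)) - g (\<tau> j)) *\<^sub>R refined_values k t \<xi> \<tau> j \<omega>) = (\<Sum>i<k. (g (t (Suc i)) - g (t i)) *\<^sub>R \<xi> i \<omega>)"
proof -
  have "(\<Sum>j<N. (g (\<tau> (Suc j)) - g (\<tau> j)) *\<^sub>R refined_values k t \<xi> \<tau> j \<omega>)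
     = (\<Sum>j<N. \<Sum>i<k. (if t i \<le> \<tau> j \<and> \<tau> (Suc j) \<le> t (Suc i) then g (\<tau> (Suc j)) - g (\<tau> j) else 0) *\<^sub>R \<xi> i \<omega>)"
    unfolding refined_values_def scaleR_sum_right by (intro sum.cong refl) auto
  also have "\<dots> = (\<Sum>i<k. (\<Sum>j<N. if t i \<le> \<tau> j \<and> \<tau> (Suc j) \<le> t (Suc i) then g (\<tau> (Suc j)) - g (\<tau> j) else 0) *\<^sub>R \<xi> i \<omega>)"
    by (subst sum.swap) (simp add: scaleR_sum_left)
  also have "\<dots> = (\<Sum>i<k. (g (t (Suc i)) - g (t i)) *\<^sub>R \<xi> i \<omega>)"
    using t sub by (intro sum.cong refl arg_cong2[where f = scaleR] grid_telescope[OF \<tau>]) auto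
  finally show ?thesis .
qed

lemma indicator_eq_diff:
  "a \<le> b \<Longrightarrow> indicator {a<..b} s = indicator {s..} b - (indicator {s..} a :: real)" for a b s :: real
  by (auto split: split_indicator)

lemma simple_process_eq_diff:
  assumes "\<forall>i<k. t i \<le> t (Suc i)"
  shows "simple_process k t \<xi> s \<omega> = (\<Sum>i<k. (indicator {s..} (t (Suc i)) - indicator {s..} (t i)) *\<^sub>R \<xi> i \<omega>)"
  unfolding simple_process_def using assms by (intro sum.cong) (auto simp: indicator_eq_diff)

lemma simple_process_refined_values:
  assumes \<tau>: "\<forall>j<N. \<tau> j < \<tau> (Suc j)" and sub: "t ` {..k} \<subseteq> \<tau> ` {..N}" and t: "\<forall>i<k. t i \<le> t (Suc i)"
  shows "simple_process N \<tau> (refined_values k t \<xi> \<tau>) = simple_process k t \<xi>"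
proof (intro ext)
  fix s \<omega>
  have \<tau>': "\<forall>j<N. \<tau> j \<le> \<tau> (Suc j)" using \<tau> by (auto intro: less_imp_le)
  show "simple_process N \<tau> (refined_values k t \<xi> \<tau>) s \<omega> = simple_process k t \<xi> s \<omega>"
    unfolding simple_process_eq_diff[OF \<tau>'] simple_process_eq_diff[OF t] by (rule sum_refined_values[OF \<tau> sub t])
qed

lemma simple_integral_refined_values:
  assumes \<tau>: "\<forall>j<N. \<tau> j < \<tau> (Suc j)" and sub: "t ` {..k} \<subseteq> \<tau> ` {..N}" and t: "\<forall>i<k. t i \<le> t (Suc i)"
  shows "simple_integral W N \<tau> (refined_values k t \<xi> \<tau>) = simple_integral W k t \<xi>"
  by (intro ext) (use sum_refined_values[OF \<tau> sub t, of "\<lambda>x. W (min x _) _"] in \<open>simp add: simple_integral_def\<close>)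

context brownian_setup
begin

section \<open>Brownian increments and simple integrals\<close>

text \<open>
Independence of the increment from the past is given for two families of events;
both families are closed under intersections, so independence extends to the generated
\<open>\<sigma>\<close>-algebras.
\<close>

lemma indep_increment:
  fixes \<zeta> :: "'a \<Rightarrow> real"
  assumes st: "0 \<le> s" "s < t" and \<zeta>: "\<zeta> \<in> borel_measurable (F s)"
  shows "indep_var borel \<zeta> borel (\<lambda>\<omega>. W t \<omega> - W s \<omega>)"
proof -
  let ?D = "\<lambda>\<omega>. W t \<omega> - W s \<omega>"
  let ?C = "{?D -` S \<inter> space M | S. S \<in> sets borel}"
  have W: "W t \<in> borel_measurable M" "W s \<in> borel_measurable M"
    using brownian st by (auto simp: brownian_motion_def)
  have "indep_set (sets (F s)) ?C"
    using brownian st by (auto simp: brownian_motion_def)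
  moreover have "Int_stable ?C"
  proof (rule Int_stableI)
    fix a b assume "a \<in> ?C" "b \<in> ?C"
    then obtain S S' where "a = ?D -` S \<inter> space M" "b = ?D -` S' \<inter> space M" "S \<in> sets borel" "S' \<in> sets borel"
      by blast
    then have "a \<inter> b = ?D -` (S \<inter> S') \<inter> space M" "S \<inter> S' \<in> sets borel" by auto
    then show "a \<inter> b \<in> ?C" by blast
  qed
  moreover have "Int_stable (sets (F s))"
    by (rule Int_stableI) auto
  ultimately have "indep_set (sigma_sets (space M) (sets (F s))) (sigma_sets (space M) ?C)"
    by (intro indep_set_sigma_sets)
  moreover have "sigma_sets (space M) {\<zeta> -` A \<inter> space M | A. A \<in> sets borel} \<subseteq> sigma_sets (space M) (sets (F s))"
    by (rule sigma_sets_mono') (use measurable_sets[OF \<zeta>] in auto)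
  ultimately have "indep_set (sigma_sets (space M) {\<zeta> -` A \<inter> space M | A. A \<in> sets borel}) (sigma_sets (space M) ?C)"
    unfolding indep_sets2_eq by blast
  then show ?thesis
    unfolding indep_var_eq using W measurable_F_M[OF \<zeta>] by auto
qed

lemma increment_moments:
  assumes "0 \<le> s" "s < t"
  shows "integrable M (\<lambda>\<omega>. W t \<omega> - W s \<omega>)" "(\<integral>\<omega>. W t \<omega> - W s \<omega> \<partial>M) = 0"
    and "integrable M (\<lambda>\<omega>. (W t \<omega> - W s \<omega>)\<^sup>2)" "(\<integral>\<omega>. (W t \<omega> - W s \<omega>)\<^sup>2 \<partial>M) = t - s"
proof -
  define \<sigma> where "\<sigma> = sqrt (t - s)"
  have \<sigma>: "0 < \<sigma>" "\<sigma>\<^sup>2 = t - s" using assms by (auto simp: \<sigma>_def)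
  have D: "distributed M lborel (\<lambda>\<omega>. W t \<omega> - W s \<omega>) (normal_density 0 \<sigma>)"
    using brownian assms by (simp add: brownian_motion_def \<sigma>_def)
  show "(\<integral>\<omega>. W t \<omega> - W s \<omega> \<partial>M) = 0"
    by (rule normal_distributed_expectation[OF \<sigma>(1) D])
  show "integrable M (\<lambda>\<omega>. W t \<omega> - W s \<omega>)"
    using distributed_integrable[OF D, of "\<lambda>x. x"] integrable_normal_moment[OF \<sigma>(1), of 0 1] by simp
  show "integrable M (\<lambda>\<omega>. (W t \<omega> - W s \<omega>)\<^sup>2)"
    using distributed_integrable[OF D, of "\<lambda>x. x\<^sup>2"] integrable_normal_moment[OF \<sigma>(1), of 0 2] by simp
  show "(\<integral>\<omega>. (W t \<omega> - W s \<omega>)\<^sup>2 \<partial>M) = t - s"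
    using normal_distributed_variance[OF \<sigma>(1) D] normal_distributed_expectation[OF \<sigma>(1) D] \<sigma>(2) by simp
qed

text \<open>
A factor known at time \<open>s\<close> is independent of the centred increment after \<open>s\<close>.
\<close>

lemma integral_mult_increment:
  fixes \<zeta> :: "'a \<Rightarrow> real"
  assumes st: "0 \<le> s" "s \<le> t" and \<zeta>: "\<zeta> \<in> borel_measurable (F s)" "integrable M \<zeta>"
  shows "integrable M (\<lambda>\<omega>. \<zeta> \<omega> * (W t \<omega> - W s \<omega>))" "(\<integral>\<omega>. \<zeta> \<omega> * (W t \<omega> - W s \<omega>) \<partial>M) = 0"
proof -
  have "integrable M (\<lambda>\<omega>. \<zeta> \<omega> * (W t \<omega> - W s \<omega>)) \<and> (\<integral>\<omega>. \<zeta> \<omega> * (W t \<omega> - W s \<omega>) \<partial>M) = 0"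
  proof (cases "s = t")
    case False
    then have "s < t" using st by simp
    note ind = indep_increment[OF st(1) this \<zeta>(1)] and m = increment_moments[OF st(1) this]
    show ?thesis
      using indep_var_lebesgue_integral[OF ind \<zeta>(2) m(1)] indep_var_integrable[OF ind \<zeta>(2) m(1)] m(2) by simp
  qed simp
  then show "integrable M (\<lambda>\<omega>. \<zeta> \<omega> * (W t \<omega> - W s \<omega>))" "(\<integral>\<omega>. \<zeta> \<omega> * (W t \<omega> - W s \<omega>) \<partial>M) = 0" by auto
qed

text \<open>
The squared increment is independent of the past and has mean \<open>t - s\<close>.
\<close>

lemma integral_mult_increment_sq:
  fixes \<zeta> :: "'a \<Rightarrow> real"
  assumes st: "0 \<le> s" "s \<le> t" and \<zeta>: "\<zeta> \<in> borel_measurable (F s)" "integrable M \<zeta>"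
  shows "integrable M (\<lambda>\<omega>. \<zeta> \<omega> * (W t \<omega> - W s \<omega>)\<^sup>2)"
    and "(\<integral>\<omega>. \<zeta> \<omega> * (W t \<omega> - W s \<omega>)\<^sup>2 \<partial>M) = (t - s) * (\<integral>\<omega>. \<zeta> \<omega> \<partial>M)"
proof -
  have "integrable M (\<lambda>\<omega>. \<zeta> \<omega> * (W t \<omega> - W s \<omega>)\<^sup>2) \<and> (\<integral>\<omega>. \<zeta> \<omega> * (W t \<omega> - W s \<omega>)\<^sup>2 \<partial>M) = (t - s) * (\<integral>\<omega>. \<zeta> \<omega> \<partial>M)"
  proof (cases "s = t")
    case False
    then have st': "s < t" using st by simp
    have ind: "indep_var borel \<zeta> borel (\<lambda>\<omega>. (W t \<omega> - W s \<omega>)\<^sup>2)"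
      using indep_var_compose[OF indep_increment[OF st(1) st' \<zeta>(1)], of "\<lambda>x. x" borel "\<lambda>x. x\<^sup>2" borel]
      by (simp add: comp_def)
    note m = increment_moments[OF st(1) st']
    show ?thesis
      using indep_var_lebesgue_integral[OF ind \<zeta>(2) m(3)] indep_var_integrable[OF ind \<zeta>(2) m(3)] m(4) by simp
  qed simp
  then show "integrable M (\<lambda>\<omega>. \<zeta> \<omega> * (W t \<omega> - W s \<omega>)\<^sup>2)"
    "(\<integral>\<omega>. \<zeta> \<omega> * (W t \<omega> - W s \<omega>)\<^sup>2 \<partial>M) = (t - s) * (\<integral>\<omega>. \<zeta> \<omega> \<partial>M)" by auto
qed

lemma simple_integrandD:
  assumes "simple_integrand M W T k t \<xi>"
  shows "\<forall>i<k. t i \<le> t (Suc i)" "\<And>i. i \<le> k \<Longrightarrow> t i \<in> {0..T}"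
    and "\<And>i. i < k \<Longrightarrow> \<xi> i \<in> borel_measurable (F (t i))"
    and "\<And>i. i < k \<Longrightarrow> \<exists>C. \<forall>\<omega>\<in>space M. norm (\<xi> i \<omega>) \<le> C"
proof -
  show m: "\<forall>i<k. t i \<le> t (Suc i)" using assms by (auto simp: simple_integrand_def)
  show "t i \<in> {0..T}" if "i \<le> k" for i
    using grid_mono[OF m, of 0 i] grid_mono[OF m, of i k] that assms by (auto simp: simple_integrand_def)
qed (use assms in \<open>auto simp: simple_integrand_def\<close>)

lemma square_integrable_bounded:
  fixes f :: "'a \<Rightarrow> 'b::euclidean_space"
  assumes "f \<in> borel_measurable M" "\<exists>C. \<forall>\<omega>\<in>space M. norm (f \<omega>) \<le> C"
  shows "square_integrable M f"
proof -
  obtain C where "\<forall>\<omega>\<in>space M. norm (f \<omega>) \<le> C" using assms(2) by auto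
  then show ?thesis
    by (intro square_integrable_mono[where g = "\<lambda>_. C\<^sup>2"] assms(1)) (auto intro!: AE_I2 power_mono)
qed

lemma integrable_inner_bounded:
  fixes f g :: "'a \<Rightarrow> 'b::euclidean_space"
  assumes "square_integrable M f" "g \<in> borel_measurable M" "\<exists>C. \<forall>\<omega>\<in>space M. norm (g \<omega>) \<le> C"
  shows "integrable M (\<lambda>\<omega>. f \<omega> \<bullet> g \<omega>)"
  by (intro integrable_inner_square_integrable assms square_integrable_bounded)

lemma square_integrable_increment_scaleR:
  fixes \<xi> :: "'a \<Rightarrow> 'b::euclidean_space"
  assumes st: "0 \<le> s" "s \<le> t" and \<xi>: "\<xi> \<in> borel_measurable M" "\<exists>C. \<forall>\<omega>\<in>space M. norm (\<xi> \<omega>) \<le> C"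
  shows "square_integrable M (\<lambda>\<omega>. (W t \<omega> - W s \<omega>) *\<^sub>R \<xi> \<omega>)"
proof -
  obtain C where C: "\<forall>\<omega>\<in>space M. norm (\<xi> \<omega>) \<le> C" using \<xi>(2) by auto
  have [measurable]: "W t \<in> borel_measurable M" "W s \<in> borel_measurable M"
    using brownian st by (auto simp: brownian_motion_def)
  have "integrable M (\<lambda>\<omega>. C\<^sup>2 * (W t \<omega> - W s \<omega>)\<^sup>2)"
    by (rule integral_mult_increment_sq[OF st]) auto
  moreover have "(norm ((W t \<omega> - W s \<omega>) *\<^sub>R \<xi> \<omega>))\<^sup>2 \<le> C\<^sup>2 * (W t \<omega> - W s \<omega>)\<^sup>2" if "\<omega> \<in> space M" for \<omega>
    using C that by (auto simp: power_mult_distrib mult.commute[of "C\<^sup>2"] intro!: mult_left_mono power_mono)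
  ultimately show ?thesis
    using \<xi>(1) by (intro square_integrable_mono[where g = "\<lambda>\<omega>. C\<^sup>2 * (W t \<omega> - W s \<omega>)\<^sup>2"]) (auto intro!: AE_I2)
qed

lemma square_integrable_simple_integral:
  assumes S: "simple_integrand M W T k t \<xi>" and r: "0 \<le> r"
  shows "square_integrable M (simple_integral W k t \<xi> r)"
  unfolding simple_integral_def
proof (intro square_integrable_sum square_integrable_increment_scaleR)
  fix i assume i: "i \<in> {..<k}"
  note D = simple_integrandD[OF S]
  show "0 \<le> min (t i) r" using D(2)[of i] i r by auto
  show "min (t i) r \<le> min (t (Suc i)) r" using D(1) i by auto
  show "\<xi> i \<in> borel_measurable M" using D(3)[of i] i by (auto intro: measurable_F_M)
  show "\<exists>C. \<forall>\<omega>\<in>space M. norm (\<xi> i \<omega>) \<le> C" using D(4)[of i] i by auto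
qed

text \<open>
Clamping the grid to \<open>[s, r]\<close> expresses the increment of a simple integral by Brownian increments
over subintervals of \<open>[s, r]\<close>.
\<close>

lemma simple_integral_diff_eq:
  assumes "s \<le> r"
  shows "simple_integral W k t \<xi> r \<omega> - simple_integral W k t \<xi> s \<omega>
    = (\<Sum>i<k. (W (max s (min (t (Suc i)) r)) \<omega> - W (max s (min (t i) r)) \<omega>) *\<^sub>R \<xi> i \<omega>)"
proof -
  have *: "W (min x r) \<omega> - W (min x s) \<omega> = W (max s (min x r)) \<omega> - W s \<omega>" for x
    using assms by (auto simp: min_def max_def)
  have "W (min x r) \<omega> - W (min y r) \<omega> - (W (min x s) \<omega> - W (min y s) \<omega>)
      = W (max s (min x r)) \<omega> - W (max s (min y r)) \<omega>" for x y
    using *[of x] *[of y] by simp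
  then show ?thesis
    by (simp add: simple_integral_def sum_subtractf[symmetric] scaleR_diff_left[symmetric])
qed

text \<open>
After clamping, the increment in each summand begins no earlier than \<open>s\<close> and no earlier than
\<open>t i\<close>, so both \<open>\<eta>\<close> and the value \<open>\<xi> i\<close> are known when it starts.
\<close>

lemma simple_integral_orthogonal:
  fixes \<eta> :: "'a \<Rightarrow> 'b::euclidean_space"
  assumes S: "simple_integrand M W T k t \<xi>" and sr: "0 \<le> s" "s \<le> r"
    and \<eta>: "\<eta> \<in> borel_measurable (F s)" "square_integrable M \<eta>"
  shows "(\<integral>\<omega>. \<eta> \<omega> \<bullet> (simple_integral W k t \<xi> r \<omega> - simple_integral W k t \<xi> s \<omega>) \<partial>M) = 0"
proof -
  note D = simple_integrandD[OF S]
  let ?c = "\<lambda>x. max s (min x r)"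
  have *: "integrable M (\<lambda>\<omega>. (\<eta> \<omega> \<bullet> \<xi> i \<omega>) * (W (?c (t (Suc i))) \<omega> - W (?c (t i)) \<omega>))"
     "(\<integral>\<omega>. (\<eta> \<omega> \<bullet> \<xi> i \<omega>) * (W (?c (t (Suc i))) \<omega> - W (?c (t i)) \<omega>) \<partial>M) = 0" if i: "i < k" for i
  proof -
    have le: "t i \<le> t (Suc i)" using D(1) i by simp
    have int: "integrable M (\<lambda>\<omega>. \<eta> \<omega> \<bullet> \<xi> i \<omega>)"
      using i by (intro integrable_inner_bounded \<eta> measurable_F_M[OF D(3)] D(4))
    have "integrable M (\<lambda>\<omega>. (\<eta> \<omega> \<bullet> \<xi> i \<omega>) * (W (?c (t (Suc i))) \<omega> - W (?c (t i)) \<omega>)) \<and>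
       (\<integral>\<omega>. (\<eta> \<omega> \<bullet> \<xi> i \<omega>) * (W (?c (t (Suc i))) \<omega> - W (?c (t i)) \<omega>) \<partial>M) = 0"
    \<comment> \<open>If the interval starts after \<open>r\<close>, clamping collapses it and the increment vanishes.\<close>
    proof (cases "t i \<le> r")
      case True
      then have "(\<lambda>\<omega>. \<eta> \<omega> \<bullet> \<xi> i \<omega>) \<in> borel_measurable (F (?c (t i)))"
        using measurable_F_mono[OF \<eta>(1), of "?c (t i)"] measurable_F_mono[OF D(3)[OF i], of "?c (t i)"] by simp
      then show ?thesis
        using integral_mult_increment[of "?c (t i)" "?c (t (Suc i))"] int sr le by (auto simp: min_def max_def)
    next
      case False
      then have "?c (t (Suc i)) = ?c (t i)" using le by auto
      then show ?thesis by simp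
    qed
    then show "integrable M (\<lambda>\<omega>. (\<eta> \<omega> \<bullet> \<xi> i \<omega>) * (W (?c (t (Suc i))) \<omega> - W (?c (t i)) \<omega>))"
     "(\<integral>\<omega>. (\<eta> \<omega> \<bullet> \<xi> i \<omega>) * (W (?c (t (Suc i))) \<omega> - W (?c (t i)) \<omega>) \<partial>M) = 0" by auto
  qed
  have "\<eta> \<omega> \<bullet> (simple_integral W k t \<xi> r \<omega> - simple_integral W k t \<xi> s \<omega>)
     = (\<Sum>i<k. (\<eta> \<omega> \<bullet> \<xi> i \<omega>) * (W (?c (t (Suc i))) \<omega> - W (?c (t i)) \<omega>))" for \<omega>
    unfolding simple_integral_diff_eq[OF sr(2)] by (simp add: inner_sum_right mult.commute)
  then show ?thesis
    using * by simp
qed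

text \<open>
The union of the two sets of grid points, sorted, refines both grids.
\<close>

lemma common_grid:
  fixes \<xi> \<xi>' :: "nat \<Rightarrow> 'a \<Rightarrow> 'b::euclidean_space"
  assumes S: "simple_integrand M W T k t \<xi>" and S': "simple_integrand M W T k' t' \<xi>'"
  obtains N \<tau> \<zeta> \<zeta>' where "simple_integrand M W T N \<tau> \<zeta>" "simple_integrand M W T N \<tau> \<zeta>'"
    "simple_process N \<tau> \<zeta> = simple_process k t \<xi>" "simple_process N \<tau> \<zeta>' = simple_process k' t' \<xi>'"
    "simple_integral W N \<tau> \<zeta> = simple_integral W k t \<xi>" "simple_integral W N \<tau> \<zeta>' = simple_integral W k' t' \<xi>'"
proof -
  note D = simple_integrandD[OF S] and D' = simple_integrandD[OF S']
  obtain N \<tau> where \<tau>: "\<forall>j<N. \<tau> j < \<tau> (Suc j)" and P: "\<tau> ` {..N} = t ` {..k} \<union> t' ` {..k'}"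
    by (rule finite_set_strict_grid[of "t ` {..k} \<union> t' ` {..k'}"]) auto
  have in_T: "\<tau> j \<in> {0..T}" if "j \<le> N" for j
  proof -
    have "\<tau> j \<in> t ` {..k} \<union> t' ` {..k'}" using P that by auto
    then show ?thesis using D(2) D'(2) by auto
  qed
  have ref: "simple_integrand M W T N \<tau> (refined_values l v \<gamma> \<tau>)" if V: "simple_integrand M W T l v \<gamma>" for l v and \<gamma> :: "nat \<Rightarrow> 'a \<Rightarrow> 'b"
    unfolding simple_integrand_def
  proof (intro conjI allI impI)
    note E = simple_integrandD[OF V]
    show "0 \<le> \<tau> 0" "\<tau> N \<le> T" using in_T[of 0] in_T[of N] by auto
    fix j assume j: "j < N"
    show "\<tau> j \<le> \<tau> (Suc j)" using \<tau> j by (auto intro: less_imp_le)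
    have "(\<lambda>\<omega>. if v i \<le> \<tau> j \<and> \<tau> (Suc j) \<le> v (Suc i) then \<gamma> i \<omega> else 0) \<in> borel_measurable (F (\<tau> j))" if "i < l" for i
      using measurable_F_mono[OF E(3)[OF that]] by (cases "v i \<le> \<tau> j \<and> \<tau> (Suc j) \<le> v (Suc i)") auto
    then show "refined_values l v \<gamma> \<tau> j \<in> borel_measurable (F (\<tau> j))"
      unfolding refined_values_def by (intro borel_measurable_sum) auto
    have "\<forall>i. \<exists>C. i < l \<longrightarrow> (\<forall>\<omega>\<in>space M. norm (\<gamma> i \<omega>) \<le> C)" using E(4) by auto
    then obtain C where C: "\<And>i \<omega>. i < l \<Longrightarrow> \<omega> \<in> space M \<Longrightarrow> norm (\<gamma> i \<omega>) \<le> C i" by metis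
    have "norm (refined_values l v \<gamma> \<tau> j \<omega>) \<le> (\<Sum>i<l. \<bar>C i\<bar>)" if "\<omega> \<in> space M" for \<omega>
      unfolding refined_values_def
    proof (rule sum_norm_le)
      fix i assume "i \<in> {..<l}"
      then show "norm (if v i \<le> \<tau> j \<and> \<tau> (Suc j) \<le> v (Suc i) then \<gamma> i \<omega> else 0) \<le> \<bar>C i\<bar>"
        using C[of i \<omega>] that by auto
    qed
    then show "\<exists>C. \<forall>\<omega>\<in>space M. norm (refined_values l v \<gamma> \<tau> j \<omega>) \<le> C" by blast
  qed
  have sub: "t ` {..k} \<subseteq> \<tau> ` {..N}" "t' ` {..k'} \<subseteq> \<tau> ` {..N}" using P by auto
  show ?thesis
    by (rule that[OF ref[OF S] ref[OF S'] simple_process_refined_values[OF \<tau> sub(1) D(1)] simple_process_refined_values[OF \<tau> sub(2) D'(1)]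
        simple_integral_refined_values[OF \<tau> sub(1) D(1)] simple_integral_refined_values[OF \<tau> sub(2) D'(1)]])
qed

end

section \<open>The Ito integral\<close>

lemma nn_integral_norm_diff_tendsto:
  fixes h k :: "'c \<Rightarrow> 'b::euclidean_space"
  assumes f: "\<And>j::nat. f j \<in> borel_measurable N" and h: "h \<in> borel_measurable N"
    and limf: "(\<lambda>j. \<integral>\<^sup>+x. ennreal ((norm (f j x - h x))\<^sup>2) \<partial>N) \<longlonglongrightarrow> 0"
    and g: "\<And>j::nat. g j \<in> borel_measurable N" and k: "k \<in> borel_measurable N"
    and limg: "(\<lambda>j. \<integral>\<^sup>+x. ennreal ((norm (g j x - k x))\<^sup>2) \<partial>N) \<longlonglongrightarrow> 0"
  shows "(\<lambda>j. \<integral>\<^sup>+x. ennreal ((norm ((f j x - g j x) - (h x - k x)))\<^sup>2) \<partial>N) \<longlonglongrightarrow> 0"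
proof (rule tendsto_sandwich[OF _ _ tendsto_const])
  note [measurable] = f h g k
  let ?A = "\<lambda>j. \<integral>\<^sup>+x. ennreal ((norm (f j x - h x))\<^sup>2) \<partial>N" and ?B = "\<lambda>j. \<integral>\<^sup>+x. ennreal ((norm (g j x - k x))\<^sup>2) \<partial>N"
  have "(\<integral>\<^sup>+x. ennreal ((norm ((f j x - g j x) - (h x - k x)))\<^sup>2) \<partial>N) \<le> 2 * ?A j + 2 * ?B j" for j
  proof -
    have "(\<integral>\<^sup>+x. ennreal ((norm ((f j x - g j x) - (h x - k x)))\<^sup>2) \<partial>N)
      \<le> (\<integral>\<^sup>+x. 2 * ennreal ((norm (f j x - h x))\<^sup>2) + 2 * ennreal ((norm (g j x - k x))\<^sup>2) \<partial>N)"
    proof (rule nn_integral_mono)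
      fix x
      have "ennreal ((norm ((f j x - g j x) - (h x - k x)))\<^sup>2)
         \<le> ennreal (2 * (norm (f j x - h x))\<^sup>2 + 2 * (norm (g j x - k x))\<^sup>2)"
        using norm_add_sq_le[of "f j x - h x" "- (g j x - k x)"]
        by (intro ennreal_leI) (simp add: algebra_simps norm_minus_commute)
      also have "\<dots> = 2 * ennreal ((norm (f j x - h x))\<^sup>2) + 2 * ennreal ((norm (g j x - k x))\<^sup>2)"
        by (simp add: ennreal_mult)
      finally show "ennreal ((norm ((f j x - g j x) - (h x - k x)))\<^sup>2)
         \<le> 2 * ennreal ((norm (f j x - h x))\<^sup>2) + 2 * ennreal ((norm (g j x - k x))\<^sup>2)" .
    qed
    also have "\<dots> = 2 * ?A j + 2 * ?B j"
      by (simp add: nn_integral_add nn_integral_cmult)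
    finally show ?thesis .
  qed
  then show "\<forall>\<^sub>F j in sequentially. (\<integral>\<^sup>+x. ennreal ((norm ((f j x - g j x) - (h x - k x)))\<^sup>2) \<partial>N) \<le> 2 * ?A j + 2 * ?B j"
    by simp
  have "(\<lambda>j. 2 * ?A j + 2 * ?B j) \<longlonglongrightarrow> 2 * 0 + 2 * 0"
    by (intro tendsto_add ennreal_tendsto_cmult limf limg) auto
  then show "(\<lambda>j. 2 * ?A j + 2 * ?B j) \<longlonglongrightarrow> 0" by simp
qed simp

lemma integral_double_sum:
  fixes h :: "nat \<Rightarrow> nat \<Rightarrow> 'c \<Rightarrow> real"
  assumes "\<And>i j. i < N \<Longrightarrow> j < N \<Longrightarrow> integrable Q (h i j)"
  shows "(\<integral>x. (\<Sum>i<N. \<Sum>j<N. h i j x) \<partial>Q) = (\<Sum>i<N. \<Sum>j<N. \<integral>x. h i j x \<partial>Q)"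
proof -
  have "(\<integral>x. (\<Sum>i<N. \<Sum>j<N. h i j x) \<partial>Q) = (\<Sum>i<N. \<integral>x. (\<Sum>j<N. h i j x) \<partial>Q)"
    by (rule Bochner_Integration.integral_sum) (use assms in \<open>auto intro!: Bochner_Integration.integrable_sum\<close>)
  also have "\<dots> = (\<Sum>i<N. \<Sum>j<N. \<integral>x. h i j x \<partial>Q)"
    by (intro sum.cong refl Bochner_Integration.integral_sum) (use assms in auto)
  finally show ?thesis .
qed

context brownian_setup
begin

lemma square_integrable_simple_process:
  assumes S: "simple_integrand M W T k t \<xi>"
  shows "\<And>i. i < k \<Longrightarrow> square_integrable PT (\<lambda>p. indicator {t i<..t (Suc i)} (fst p) *\<^sub>R \<xi> i (snd p))"
    and "square_integrable PT (\<lambda>p. simple_process k t \<xi> (fst p) (snd p))"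
proof -
  note D = simple_integrandD[OF S]
  show *: "square_integrable PT (\<lambda>p. indicator {t i<..t (Suc i)} (fst p) *\<^sub>R \<xi> i (snd p))" if i: "i < k" for i
  proof -
    obtain C where C: "\<forall>\<omega>\<in>space M. norm (\<xi> i \<omega>) \<le> C" using D(4)[OF i] by auto
    have [measurable]: "\<xi> i \<in> borel_measurable M" using D(3)[OF i] by (rule measurable_F_M)
    have [measurable]: "(indicator {t i<..t (Suc i)} :: real \<Rightarrow> real) \<in> borel_measurable time"
      by (rule measurable_restrict_space1) simp
    have "(norm (indicator {t i<..t (Suc i)} (fst p) *\<^sub>R \<xi> i (snd p)))\<^sup>2 \<le> C\<^sup>2" if "p \<in> space PT" for p
      using C that by (auto simp: space_pair_measure indicator_def intro!: power_mono)
    then show ?thesis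
      by (intro square_integrable_mono[where g = "\<lambda>_. C\<^sup>2"]) (auto intro!: AE_I2)
  qed
  show "square_integrable PT (\<lambda>p. simple_process k t \<xi> (fst p) (snd p))"
    unfolding simple_process_def by (intro square_integrable_sum *) simp
qed

text \<open>
Everything except the last increment is known at its left end, and that increment is centred.
\<close>

lemma simple_offdiagonal:
  fixes \<zeta> \<zeta>' :: "nat \<Rightarrow> 'a \<Rightarrow> 'b::euclidean_space"
  assumes S: "simple_integrand M W T N \<tau> \<zeta>" and S': "simple_integrand M W T N \<tau> \<zeta>'" and ij: "i < j" "j < N"
  shows "(\<integral>\<omega>. ((W (\<tau> (Suc i)) \<omega> - W (\<tau> i) \<omega>) *\<^sub>R \<zeta> i \<omega>) \<bullet> ((W (\<tau> (Suc j)) \<omega> - W (\<tau> j) \<omega>) *\<^sub>R \<zeta>' j \<omega>) \<partial>M) = 0"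
proof -
  note D = simple_integrandD[OF S] and D' = simple_integrandD[OF S']
  let ?A = "\<lambda>\<omega>. (W (\<tau> (Suc i)) \<omega> - W (\<tau> i) \<omega>) *\<^sub>R \<zeta> i \<omega>"
  have le: "\<tau> i \<le> \<tau> (Suc i)" "\<tau> (Suc i) \<le> \<tau> j" "0 \<le> \<tau> i" "0 \<le> \<tau> (Suc i)" "0 \<le> \<tau> j" "\<tau> j \<le> \<tau> (Suc j)"
    using grid_mono[OF D(1), of i "Suc i"] grid_mono[OF D(1), of "Suc i" j] grid_mono[OF D(1), of j "Suc j"]
      D(2)[of i] D(2)[of "Suc i"] D(2)[of j] ij by auto
  have [measurable]: "\<zeta> i \<in> borel_measurable (F (\<tau> j))" "\<zeta>' j \<in> borel_measurable (F (\<tau> j))"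
    "W (\<tau> (Suc i)) \<in> borel_measurable (F (\<tau> j))" "W (\<tau> i) \<in> borel_measurable (F (\<tau> j))"
    using D(3)[of i] D'(3)[of j] ij le by (auto intro: measurable_F_mono W_measurable_F)
  have "square_integrable M ?A"
    using ij le by (intro square_integrable_increment_scaleR measurable_F_M[OF D(3)] D(4)) auto
  then have "integrable M (\<lambda>\<omega>. ?A \<omega> \<bullet> \<zeta>' j \<omega>)"
    using ij by (intro integrable_inner_bounded measurable_F_M[OF D'(3)] D'(4)) auto
  then have "(\<integral>\<omega>. (?A \<omega> \<bullet> \<zeta>' j \<omega>) * (W (\<tau> (Suc j)) \<omega> - W (\<tau> j) \<omega>) \<partial>M) = 0"
    using le by (intro integral_mult_increment(2)) auto
  then show ?thesis by (simp add: algebra_simps)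
qed

text \<open>
Expand both sides into double sums over the common grid: off the diagonal both vanish, on the
diagonal both equal the length of the interval times the expected inner product of the values.
\<close>

lemma simple_isometry:
  fixes \<zeta> \<zeta>' :: "nat \<Rightarrow> 'a \<Rightarrow> 'b::euclidean_space"
  assumes S: "simple_integrand M W T N \<tau> \<zeta>" and S': "simple_integrand M W T N \<tau> \<zeta>'"
  shows "(\<integral>\<omega>. simple_integral W N \<tau> \<zeta> T \<omega> \<bullet> simple_integral W N \<tau> \<zeta>' T \<omega> \<partial>M)
    = (\<integral>p. simple_process N \<tau> \<zeta> (fst p) (snd p) \<bullet> simple_process N \<tau> \<zeta>' (fst p) (snd p) \<partial>PT)"
proof -
  note D = simple_integrandD[OF S] and D' = simple_integrandD[OF S']
  define \<Delta> where "\<Delta> i \<omega> = W (\<tau> (Suc i)) \<omega> - W (\<tau> i) \<omega>" for i \<omega>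
  define c where "c i j = (if i = j then (\<tau> (Suc i) - \<tau> i) * (\<integral>\<omega>. \<zeta> i \<omega> \<bullet> \<zeta>' i \<omega> \<partial>M) else 0)" for i j
  have le: "\<tau> i \<le> \<tau> (Suc i)" "0 \<le> \<tau> i" "\<tau> (Suc i) \<le> T" if "i < N" for i
    using D(1) D(2)[of i] D(2)[of "Suc i"] that by auto
  have min: "min (\<tau> (Suc i)) T = \<tau> (Suc i)" "min (\<tau> i) T = \<tau> i" if "i < N" for i
    using le[OF that] by auto
  have si: "simple_integral W N \<tau> \<xi> T \<omega> = (\<Sum>i<N. \<Delta> i \<omega> *\<^sub>R \<xi> i \<omega>)" for \<xi> :: "nat \<Rightarrow> 'a \<Rightarrow> 'b" and \<omega>
    unfolding simple_integral_def \<Delta>_def by (intro sum.cong refl) (simp add: min)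
  have sq: "square_integrable M (\<lambda>\<omega>. \<Delta> i \<omega> *\<^sub>R \<zeta> i \<omega>)" "square_integrable M (\<lambda>\<omega>. \<Delta> i \<omega> *\<^sub>R \<zeta>' i \<omega>)" if "i < N" for i
    unfolding \<Delta>_def using le[OF that] that
    by (auto intro!: square_integrable_increment_scaleR measurable_F_M[OF D(3)] D(4) measurable_F_M[OF D'(3)] D'(4))
  have int: "integrable M (\<lambda>\<omega>. (\<Delta> i \<omega> *\<^sub>R \<zeta> i \<omega>) \<bullet> (\<Delta> j \<omega> *\<^sub>R \<zeta>' j \<omega>))" if "i < N" "j < N" for i j
    using sq that by (intro integrable_inner_square_integrable) auto
  have diag: "integrable M (\<lambda>\<omega>. \<zeta> i \<omega> \<bullet> \<zeta>' i \<omega>)" "(\<lambda>\<omega>. \<zeta> i \<omega> \<bullet> \<zeta>' i \<omega>) \<in> borel_measurable (F (\<tau> i))" if "i < N" for i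
    using D(3)[OF that] D'(3)[OF that]
    by (auto intro!: integrable_inner_bounded square_integrable_bounded D(4) D'(4) that intro: measurable_F_M)
  have lhs: "(\<integral>\<omega>. (\<Delta> i \<omega> *\<^sub>R \<zeta> i \<omega>) \<bullet> (\<Delta> j \<omega> *\<^sub>R \<zeta>' j \<omega>) \<partial>M) = c i j" if "i < N" "j < N" for i j
  proof (cases i j rule: linorder_cases)
    case less
    then show ?thesis using simple_offdiagonal[OF S S' less that(2)] by (simp add: \<Delta>_def c_def)
  next
    case greater
    then show ?thesis using simple_offdiagonal[OF S' S greater that(1)] by (simp add: \<Delta>_def c_def inner_commute)
  next
    case equal
    have "(\<integral>\<omega>. (\<zeta> i \<omega> \<bullet> \<zeta>' i \<omega>) * (\<Delta> i \<omega>)\<^sup>2 \<partial>M) = (\<tau> (Suc i) - \<tau> i) * (\<integral>\<omega>. \<zeta> i \<omega> \<bullet> \<zeta>' i \<omega> \<partial>M)"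
      unfolding \<Delta>_def using le[OF that(1)] diag[OF that(1)] by (intro integral_mult_increment_sq(2)) auto
    then show ?thesis by (simp add: equal c_def power2_eq_square algebra_simps)
  qed
  let ?J = "\<lambda>i. {\<tau> i<..\<tau> (Suc i)}"
  let ?f = "\<lambda>\<zeta> i p. (indicator (?J i) (fst p) :: real) *\<^sub>R (\<zeta> i (snd p) :: 'b)"
  have int': "integrable PT (\<lambda>p. ?f \<zeta> i p \<bullet> ?f \<zeta>' j p)" if "i < N" "j < N" for i j
    by (intro integrable_inner_square_integrable square_integrable_simple_process(1)[OF S] square_integrable_simple_process(1)[OF S'] that)
  have rhs: "(\<integral>p. ?f \<zeta> i p \<bullet> ?f \<zeta>' j p \<partial>PT) = c i j" if "i < N" "j < N" for i j
  proof (cases "i = j")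
    case False
    have "?J i \<inter> ?J j = {}"
      using False grid_mono[OF D(1), of "Suc i" j] grid_mono[OF D(1), of "Suc j" i] that
      by (cases i j rule: linorder_cases) auto
    then have "(\<lambda>p. ?f \<zeta> i p \<bullet> ?f \<zeta>' j p) = (\<lambda>p. 0)"
      by (intro ext) (auto simp: indicator_def)
    then show ?thesis using False by (simp only: c_def if_False integral_zero)
  next
    case True
    have eq: "?f \<zeta> i p \<bullet> ?f \<zeta>' i p = indicator (?J i) (fst p) * (\<zeta> i (snd p) \<bullet> \<zeta>' i (snd p))" for p
      by (simp add: indicator_def)
    have "(\<integral>p. ?f \<zeta> i p \<bullet> ?f \<zeta>' i p \<partial>PT)
       = (\<integral>s. (\<integral>\<omega>. indicator (?J i) s * (\<zeta> i \<omega> \<bullet> \<zeta>' i \<omega>) \<partial>M) \<partial>time)"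
      unfolding eq
      by (rule integral_PT_fst[of "\<lambda>s \<omega>. indicator (?J i) s * (\<zeta> i \<omega> \<bullet> \<zeta>' i \<omega>)"])
         (rule int'[OF that(1) that(1), unfolded eq])
    also have "\<dots> = (\<integral>s. indicator (?J i) s * (\<integral>\<omega>. \<zeta> i \<omega> \<bullet> \<zeta>' i \<omega> \<partial>M) \<partial>time)"
      by (intro Bochner_Integration.integral_cong refl) simp
    also have "\<dots> = (\<integral>s. indicator {0..T} s *\<^sub>R (indicator (?J i) s * (\<integral>\<omega>. \<zeta> i \<omega> \<bullet> \<zeta>' i \<omega> \<partial>M)) \<partial>lborel)"
      by (rule integral_restrict_space) simp
    also have "\<dots> = (\<integral>s. indicator (?J i) s * (\<integral>\<omega>. \<zeta> i \<omega> \<bullet> \<zeta>' i \<omega> \<partial>M) \<partial>lborel)"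
      using le[OF that(1)] by (intro Bochner_Integration.integral_cong refl) (auto split: split_indicator)
    also have "\<dots> = c i j"
      using le[OF that(1)] True by (simp add: c_def)
    finally show ?thesis using True by simp
  qed
  have "(\<integral>\<omega>. simple_integral W N \<tau> \<zeta> T \<omega> \<bullet> simple_integral W N \<tau> \<zeta>' T \<omega> \<partial>M)
     = (\<integral>\<omega>. (\<Sum>i<N. \<Sum>j<N. (\<Delta> i \<omega> *\<^sub>R \<zeta> i \<omega>) \<bullet> (\<Delta> j \<omega> *\<^sub>R \<zeta>' j \<omega>)) \<partial>M)"
    by (simp only: si inner_sum_left inner_sum_right) (subst sum.swap, rule refl)
  also have "\<dots> = (\<Sum>i<N. \<Sum>j<N. \<integral>\<omega>. (\<Delta> i \<omega> *\<^sub>R \<zeta> i \<omega>) \<bullet> (\<Delta> j \<omega> *\<^sub>R \<zeta>' j \<omega>) \<partial>M)"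
    by (rule integral_double_sum) (rule int)
  also have "\<dots> = (\<Sum>i<N. \<Sum>j<N. c i j)"
    by (intro sum.cong refl lhs) simp_all
  also have "\<dots> = (\<Sum>i<N. \<Sum>j<N. \<integral>p. ?f \<zeta> i p \<bullet> ?f \<zeta>' j p \<partial>PT)"
    by (intro sum.cong refl rhs[symmetric]) simp_all
  also have "\<dots> = (\<integral>p. (\<Sum>i<N. \<Sum>j<N. ?f \<zeta> i p \<bullet> ?f \<zeta>' j p) \<partial>PT)"
    by (rule integral_double_sum[symmetric]) (rule int')
  also have "\<dots> = (\<integral>p. simple_process N \<tau> \<zeta> (fst p) (snd p) \<bullet> simple_process N \<tau> \<zeta>' (fst p) (snd p) \<partial>PT)"
    by (simp only: simple_process_def inner_sum_left inner_sum_right) (subst sum.swap, rule refl)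
  finally show ?thesis .
qed

lemma ito_integral_approx:
  fixes \<sigma> I :: "real \<Rightarrow> 'a \<Rightarrow> 'b::euclidean_space"
  assumes "ito_integral M W T \<sigma> I"
  shows "\<exists>k t \<xi>. (\<forall>j::nat. simple_integrand M W T (k j) (t j) (\<xi> j)) \<and>
    (\<lambda>j. \<integral>\<^sup>+p. ennreal ((norm (simple_process (k j) (t j) (\<xi> j) (fst p) (snd p) - \<sigma> (fst p) (snd p)))\<^sup>2) \<partial>PT) \<longlonglongrightarrow> 0 \<and>
    (\<forall>r\<in>{0..T}. (\<lambda>j. \<integral>\<^sup>+\<omega>. ennreal ((norm (simple_integral W (k j) (t j) (\<xi> j) r \<omega> - I r \<omega>))\<^sup>2) \<partial>M) \<longlonglongrightarrow> 0)"
proof -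
  have "\<sigma> \<in> L2_processes M W T" using assms by (simp add: ito_integral_def)
  note [measurable] = square_integrable_measurable[OF L2_processesD(1)[OF this]]
  have eq: "(\<integral>\<^sup>+\<omega>. (\<integral>\<^sup>+s\<in>{0..T}. ennreal ((norm (simple_process k t \<xi> s \<omega> - \<sigma> s \<omega>))\<^sup>2) \<partial>lborel) \<partial>M)
    = (\<integral>\<^sup>+p. ennreal ((norm (simple_process k t \<xi> (fst p) (snd p) - \<sigma> (fst p) (snd p)))\<^sup>2) \<partial>PT)"
    if S: "simple_integrand M W T k t \<xi>" for k t \<xi>
  proof -
    note [measurable] = square_integrable_measurable[OF square_integrable_simple_process(2)[OF S]]
    show ?thesis
      by (rule iterated_nn_integral[of "\<lambda>s \<omega>. ennreal ((norm (simple_process k t \<xi> s \<omega> - \<sigma> s \<omega>))\<^sup>2)"]) measurable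
  qed
  from assms obtain k t \<xi> where
    S: "\<forall>j::nat. simple_integrand M W T (k j) (t j) (\<xi> j)" and lim:
    "(\<lambda>j. \<integral>\<^sup>+\<omega>. (\<integral>\<^sup>+s\<in>{0..T}. ennreal ((norm (simple_process (k j) (t j) (\<xi> j) s \<omega> - \<sigma> s \<omega>))\<^sup>2) \<partial>lborel) \<partial>M)
        \<longlonglongrightarrow> 0"
    "\<forall>r\<in>{0..T}. (\<lambda>j. \<integral>\<^sup>+\<omega>. ennreal ((norm (simple_integral W (k j) (t j) (\<xi> j) r \<omega> - I r \<omega>))\<^sup>2) \<partial>M) \<longlonglongrightarrow> 0"
    unfolding ito_integral_def by blast
  show ?thesis
    using S lim(2) lim(1)[unfolded eq[OF S[rule_format]]]
    by (intro exI[of _ k] exI[of _ t] exI[of _ \<xi>]) simp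
qed

lemma ito_integralD:
  assumes "ito_integral M W T \<sigma> I"
  shows "\<sigma> \<in> L2_processes M W T" "adapted M W T I"
    and "\<And>\<omega>. \<omega> \<in> space M \<Longrightarrow> continuous_on {0..T} (\<lambda>t. I t \<omega>)"
    and "\<And>t. t \<in> {0..T} \<Longrightarrow> I t \<in> borel_measurable M"
  using assms by (auto simp: ito_integral_def adapted_def intro: measurable_F_M)

lemma ito_square_integrable:
  assumes I: "ito_integral M W T \<sigma> I" and r: "r \<in> {0..T}"
  shows "square_integrable M (I r)"
proof -
  obtain k t \<xi> where S: "\<And>j::nat. simple_integrand M W T (k j) (t j) (\<xi> j)"
    and pl: "(\<lambda>j. \<integral>\<^sup>+p. ennreal ((norm (simple_process (k j) (t j) (\<xi> j) (fst p) (snd p) - \<sigma> (fst p) (snd p)))\<^sup>2) \<partial>PT) \<longlonglongrightarrow> 0"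
    and il: "\<And>r. r \<in> {0..T} \<Longrightarrow> (\<lambda>j. \<integral>\<^sup>+\<omega>. ennreal ((norm (simple_integral W (k j) (t j) (\<xi> j) r \<omega> - I r \<omega>))\<^sup>2) \<partial>M) \<longlonglongrightarrow> 0"
    using ito_integral_approx[OF I] by blast
  show ?thesis
    by (rule square_integrable_limit[OF square_integrable_simple_integral[OF S] ito_integralD(4)[OF I r] il[OF r]])
       (use r in simp)
qed

text \<open>
The martingale property of the stochastic integral, in the weak form in which it is needed.
\<close>

lemma ito_orthogonal:
  assumes I: "ito_integral M W T \<sigma> I" and sr: "0 \<le> s" "s \<le> r" "r \<le> T"
    and \<eta>: "\<eta> \<in> borel_measurable (F s)" "square_integrable M \<eta>"
  shows "(\<integral>\<omega>. \<eta> \<omega> \<bullet> (I r \<omega> - I s \<omega>) \<partial>M) = 0"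
proof -
  obtain k t \<xi> where S: "\<And>j::nat. simple_integrand M W T (k j) (t j) (\<xi> j)"
    and pl: "(\<lambda>j. \<integral>\<^sup>+p. ennreal ((norm (simple_process (k j) (t j) (\<xi> j) (fst p) (snd p) - \<sigma> (fst p) (snd p)))\<^sup>2) \<partial>PT) \<longlonglongrightarrow> 0"
    and il: "\<And>r. r \<in> {0..T} \<Longrightarrow> (\<lambda>j. \<integral>\<^sup>+\<omega>. ennreal ((norm (simple_integral W (k j) (t j) (\<xi> j) r \<omega> - I r \<omega>))\<^sup>2) \<partial>M) \<longlonglongrightarrow> 0"
    using ito_integral_approx[OF I] by blast
  let ?S = "\<lambda>j r. simple_integral W (k j) (t j) (\<xi> j) r"
  have r: "r \<in> {0..T}" and s: "s \<in> {0..T}" using sr by auto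
  have sq: "square_integrable M (?S j r)" "square_integrable M (?S j s)" for j
    using sr by (auto intro!: square_integrable_simple_integral[OF S])
  have "(\<lambda>j. \<integral>\<omega>. \<eta> \<omega> \<bullet> (?S j r \<omega> - ?S j s \<omega>) \<partial>M) \<longlonglongrightarrow> (\<integral>\<omega>. \<eta> \<omega> \<bullet> (I r \<omega> - I s \<omega>) \<partial>M)"
  proof (rule integral_inner_tendsto)
    show "(\<lambda>j. \<integral>\<^sup>+\<omega>. ennreal ((norm ((?S j r \<omega> - ?S j s \<omega>) - (I r \<omega> - I s \<omega>)))\<^sup>2) \<partial>M) \<longlonglongrightarrow> 0"
      by (intro nn_integral_norm_diff_tendsto il square_integrable_measurable[OF sq(1)]
          square_integrable_measurable[OF sq(2)] ito_integralD(4)[OF I] r s)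
    show "(\<lambda>\<omega>. I r \<omega> - I s \<omega>) \<in> borel_measurable M"
      by (intro borel_measurable_diff ito_integralD(4)[OF I] r s)
    show "square_integrable M (\<lambda>\<omega>. ?S j r \<omega> - ?S j s \<omega>)" for j
      by (intro square_integrable_diff sq)
  qed (use \<eta> in \<open>simp_all add: square_integrable_measurable\<close>)
  moreover have "(\<integral>\<omega>. \<eta> \<omega> \<bullet> (?S j r \<omega> - ?S j s \<omega>) \<partial>M) = 0" for j
    by (rule simple_integral_orthogonal[OF S sr(1,2) \<eta>])
  ultimately show ?thesis
    by (simp add: LIMSEQ_const_iff)
qed

text \<open>
The two approximating sequences are put on common grids term by term, which gives the polarised
isometry directly.
\<close>

lemma ito_isometry:
  fixes \<sigma> \<sigma>' :: "real \<Rightarrow> 'a \<Rightarrow> 'b::euclidean_space"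
  assumes I: "ito_integral M W T \<sigma> I" and I': "ito_integral M W T \<sigma>' I'"
  shows "(\<integral>\<omega>. I T \<omega> \<bullet> I' T \<omega> \<partial>M) = (\<integral>p. \<sigma> (fst p) (snd p) \<bullet> \<sigma>' (fst p) (snd p) \<partial>PT)"
proof -
  obtain k t \<xi> where S: "\<And>j::nat. simple_integrand M W T (k j) (t j) (\<xi> j)"
    and pl: "(\<lambda>j. \<integral>\<^sup>+p. ennreal ((norm (simple_process (k j) (t j) (\<xi> j) (fst p) (snd p) - \<sigma> (fst p) (snd p)))\<^sup>2) \<partial>PT) \<longlonglongrightarrow> 0"
    and il: "\<And>r. r \<in> {0..T} \<Longrightarrow> (\<lambda>j. \<integral>\<^sup>+\<omega>. ennreal ((norm (simple_integral W (k j) (t j) (\<xi> j) r \<omega> - I r \<omega>))\<^sup>2) \<partial>M) \<longlonglongrightarrow> 0"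
    using ito_integral_approx[OF I] by blast
  obtain k' t' \<xi>' where S': "\<And>j::nat. simple_integrand M W T (k' j) (t' j) (\<xi>' j)"
    and pl': "(\<lambda>j. \<integral>\<^sup>+p. ennreal ((norm (simple_process (k' j) (t' j) (\<xi>' j) (fst p) (snd p) - \<sigma>' (fst p) (snd p)))\<^sup>2) \<partial>PT) \<longlonglongrightarrow> 0"
    and il': "\<And>r. r \<in> {0..T} \<Longrightarrow> (\<lambda>j. \<integral>\<^sup>+\<omega>. ennreal ((norm (simple_integral W (k' j) (t' j) (\<xi>' j) r \<omega> - I' r \<omega>))\<^sup>2) \<partial>M) \<longlonglongrightarrow> 0"
    using ito_integral_approx[OF I'] by blast
  have T: "T \<in> {0..T}" "0 \<le> T" using T_pos by auto
  note m = ito_integralD[OF I] ito_integralD[OF I']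
  have "(\<lambda>j. \<integral>\<omega>. simple_integral W (k j) (t j) (\<xi> j) T \<omega> \<bullet> simple_integral W (k' j) (t' j) (\<xi>' j) T \<omega> \<partial>M)
     \<longlonglongrightarrow> (\<integral>\<omega>. I T \<omega> \<bullet> I' T \<omega> \<partial>M)"
    by (intro integral_inner_tendsto square_integrable_simple_integral S S' il il' m T)
  moreover have "(\<lambda>j. \<integral>p. simple_process (k j) (t j) (\<xi> j) (fst p) (snd p) \<bullet> simple_process (k' j) (t' j) (\<xi>' j) (fst p) (snd p) \<partial>PT)
     \<longlonglongrightarrow> (\<integral>p. \<sigma> (fst p) (snd p) \<bullet> \<sigma>' (fst p) (snd p) \<partial>PT)"
    by (intro integral_inner_tendsto square_integrable_simple_process(2)[OF S] square_integrable_simple_process(2)[OF S'] pl pl'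
       square_integrable_measurable[OF L2_processesD(1)[OF m(1)]] square_integrable_measurable[OF L2_processesD(1)[OF m(5)]])
  moreover have "(\<integral>\<omega>. simple_integral W (k j) (t j) (\<xi> j) T \<omega> \<bullet> simple_integral W (k' j) (t' j) (\<xi>' j) T \<omega> \<partial>M)
     = (\<integral>p. simple_process (k j) (t j) (\<xi> j) (fst p) (snd p) \<bullet> simple_process (k' j) (t' j) (\<xi>' j) (fst p) (snd p) \<partial>PT)" for j
  proof -
    obtain N \<tau> \<zeta> \<zeta>' where "simple_integrand M W T N \<tau> \<zeta>" "simple_integrand M W T N \<tau> \<zeta>'"
    "simple_process N \<tau> \<zeta> = simple_process (k j) (t j) (\<xi> j)" "simple_process N \<tau> \<zeta>' = simple_process (k' j) (t' j) (\<xi>' j)"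
    "simple_integral W N \<tau> \<zeta> = simple_integral W (k j) (t j) (\<xi> j)" "simple_integral W N \<tau> \<zeta>' = simple_integral W (k' j) (t' j) (\<xi>' j)"
      by (rule common_grid[OF S S'])
    with simple_isometry[of N \<tau> \<zeta> \<zeta>'] show ?thesis by simp
  qed
  ultimately show ?thesis
    using LIMSEQ_unique by auto
qed

lemma simple_integrand_diff:
  fixes \<xi> \<xi>' :: "nat \<Rightarrow> 'a \<Rightarrow> 'b::euclidean_space"
  assumes S: "simple_integrand M W T k t \<xi>" and S': "simple_integrand M W T k' t' \<xi>'"
  shows "\<exists>N \<tau> \<zeta>. simple_integrand M W T N \<tau> \<zeta> \<and>
    (\<forall>s \<omega>. simple_process N \<tau> \<zeta> s \<omega> = simple_process k t \<xi> s \<omega> - simple_process k' t' \<xi>' s \<omega>) \<and>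
    (\<forall>s \<omega>. simple_integral W N \<tau> \<zeta> s \<omega> = simple_integral W k t \<xi> s \<omega> - simple_integral W k' t' \<xi>' s \<omega>)"
proof -
  obtain N \<tau> \<zeta> \<zeta>' where Z: "simple_integrand M W T N \<tau> \<zeta>" "simple_integrand M W T N \<tau> \<zeta>'"
    and eqs: "simple_process k t \<xi> = simple_process N \<tau> \<zeta>" "simple_process k' t' \<xi>' = simple_process N \<tau> \<zeta>'"
    "simple_integral W k t \<xi> = simple_integral W N \<tau> \<zeta>" "simple_integral W k' t' \<xi>' = simple_integral W N \<tau> \<zeta>'"
    by (rule common_grid[OF S S']) metis
  note D = simple_integrandD[OF Z(1)] and D' = simple_integrandD[OF Z(2)]
  have "\<exists>C. \<forall>\<omega>\<in>space M. norm (\<zeta> i \<omega> - \<zeta>' i \<omega>) \<le> C" if i: "i < N" for i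
  proof -
    obtain A B where "\<forall>\<omega>\<in>space M. norm (\<zeta> i \<omega>) \<le> A" "\<forall>\<omega>\<in>space M. norm (\<zeta>' i \<omega>) \<le> B"
      using D(4)[OF i] D'(4)[OF i] by blast
    then have "\<forall>\<omega>\<in>space M. norm (\<zeta> i \<omega> - \<zeta>' i \<omega>) \<le> A + B"
      by (meson add_mono norm_triangle_ineq4 order_trans)
    then show ?thesis by blast
  qed
  then have "simple_integrand M W T N \<tau> (\<lambda>i \<omega>. \<zeta> i \<omega> - \<zeta>' i \<omega>)"
    using D(1) D(2)[of 0] D(2)[of N] D(3) D'(3) by (auto simp: simple_integrand_def intro!: borel_measurable_diff)
  moreover have "simple_process N \<tau> (\<lambda>i \<omega>. \<zeta> i \<omega> - \<zeta>' i \<omega>) s \<omega> = simple_process k t \<xi> s \<omega> - simple_process k' t' \<xi>' s \<omega>"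
    "simple_integral W N \<tau> (\<lambda>i \<omega>. \<zeta> i \<omega> - \<zeta>' i \<omega>) s \<omega> = simple_integral W k t \<xi> s \<omega> - simple_integral W k' t' \<xi>' s \<omega>" for s \<omega>
    unfolding eqs by (simp_all add: simple_process_def simple_integral_def scaleR_diff_right sum_subtractf)
  ultimately show ?thesis by blast
qed

text \<open>
The integrand of the difference is prescribed only for almost every time, because the mean of a
difference of controls is the difference of the means only at almost every time.
\<close>

lemma ito_integral_diff:
  fixes \<sigma> \<sigma>' \<sigma>'' :: "real \<Rightarrow> 'a \<Rightarrow> 'b::euclidean_space"
  assumes I: "ito_integral M W T \<sigma> I" and I': "ito_integral M W T \<sigma>' I'"
    and \<sigma>'': "\<sigma>'' \<in> L2_processes M W T"
    and eq: "AE s in time. \<forall>\<omega>\<in>space M. \<sigma>'' s \<omega> = \<sigma> s \<omega> - \<sigma>' s \<omega>"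
  shows "ito_integral M W T \<sigma>'' (\<lambda>s \<omega>. I s \<omega> - I' s \<omega>)"
proof -
  obtain k t \<xi> where S: "\<And>j::nat. simple_integrand M W T (k j) (t j) (\<xi> j)"
    and pl: "(\<lambda>j. \<integral>\<^sup>+p. ennreal ((norm (simple_process (k j) (t j) (\<xi> j) (fst p) (snd p) - \<sigma> (fst p) (snd p)))\<^sup>2) \<partial>PT) \<longlonglongrightarrow> 0"
    and il: "\<And>r. r \<in> {0..T} \<Longrightarrow> (\<lambda>j. \<integral>\<^sup>+\<omega>. ennreal ((norm (simple_integral W (k j) (t j) (\<xi> j) r \<omega> - I r \<omega>))\<^sup>2) \<partial>M) \<longlonglongrightarrow> 0"
    using ito_integral_approx[OF I] by blast
  obtain k' t' \<xi>' where S': "\<And>j::nat. simple_integrand M W T (k' j) (t' j) (\<xi>' j)"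
    and pl': "(\<lambda>j. \<integral>\<^sup>+p. ennreal ((norm (simple_process (k' j) (t' j) (\<xi>' j) (fst p) (snd p) - \<sigma>' (fst p) (snd p)))\<^sup>2) \<partial>PT) \<longlonglongrightarrow> 0"
    and il': "\<And>r. r \<in> {0..T} \<Longrightarrow> (\<lambda>j. \<integral>\<^sup>+\<omega>. ennreal ((norm (simple_integral W (k' j) (t' j) (\<xi>' j) r \<omega> - I' r \<omega>))\<^sup>2) \<partial>M) \<longlonglongrightarrow> 0"
    using ito_integral_approx[OF I'] by blast
  have "\<forall>j. \<exists>N \<tau> \<zeta>. simple_integrand M W T N \<tau> \<zeta> \<and>
    (\<forall>s \<omega>. simple_process N \<tau> \<zeta> s \<omega> = simple_process (k j) (t j) (\<xi> j) s \<omega> - simple_process (k' j) (t' j) (\<xi>' j) s \<omega>) \<and>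
    (\<forall>s \<omega>. simple_integral W N \<tau> \<zeta> s \<omega> = simple_integral W (k j) (t j) (\<xi> j) s \<omega> - simple_integral W (k' j) (t' j) (\<xi>' j) s \<omega>)"
    using simple_integrand_diff[OF S S'] by blast
  then obtain N \<tau> \<zeta> where Z: "\<And>j. simple_integrand M W T (N j) (\<tau> j) (\<zeta> j)"
    and P: "\<And>j s \<omega>. simple_process (N j) (\<tau> j) (\<zeta> j) s \<omega> = simple_process (k j) (t j) (\<xi> j) s \<omega> - simple_process (k' j) (t' j) (\<xi>' j) s \<omega>"
    and Q: "\<And>j s \<omega>. simple_integral W (N j) (\<tau> j) (\<zeta> j) s \<omega> = simple_integral W (k j) (t j) (\<xi> j) s \<omega> - simple_integral W (k' j) (t' j) (\<xi>' j) s \<omega>"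
    by metis
  note m = ito_integralD[OF I] ito_integralD[OF I']
  note [measurable] = square_integrable_measurable[OF L2_processesD(1)[OF m(1)]]
    square_integrable_measurable[OF L2_processesD(1)[OF m(5)]] square_integrable_measurable[OF L2_processesD(1)[OF \<sigma>'']]
    square_integrable_measurable[OF square_integrable_simple_process(2)[OF S]]
    square_integrable_measurable[OF square_integrable_simple_process(2)[OF S']]
    square_integrable_measurable[OF square_integrable_simple_process(2)[OF Z]]
  have "AE s in time. AE \<omega> in M. \<sigma>'' (fst (s, \<omega>)) (snd (s, \<omega>)) = \<sigma> (fst (s, \<omega>)) (snd (s, \<omega>)) - \<sigma>' (fst (s, \<omega>)) (snd (s, \<omega>))"
    using eq by eventually_elim (auto intro: AE_I2)
  then have ae: "AE p in PT. \<sigma>'' (fst p) (snd p) = \<sigma> (fst p) (snd p) - \<sigma>' (fst p) (snd p)"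
    by (intro PT.AE_pair_measure) measurable
  have "(\<lambda>j. \<integral>\<^sup>+\<omega>. (\<integral>\<^sup>+s\<in>{0..T}. ennreal ((norm (simple_process (N j) (\<tau> j) (\<zeta> j) s \<omega> - \<sigma>'' s \<omega>))\<^sup>2) \<partial>lborel) \<partial>M)
     = (\<lambda>j. \<integral>\<^sup>+p. ennreal ((norm ((simple_process (k j) (t j) (\<xi> j) (fst p) (snd p) - simple_process (k' j) (t' j) (\<xi>' j) (fst p) (snd p))
            - (\<sigma> (fst p) (snd p) - \<sigma>' (fst p) (snd p))))\<^sup>2) \<partial>PT)"
  proof
    fix j
    have "(\<integral>\<^sup>+\<omega>. (\<integral>\<^sup>+s\<in>{0..T}. ennreal ((norm (simple_process (N j) (\<tau> j) (\<zeta> j) s \<omega> - \<sigma>'' s \<omega>))\<^sup>2) \<partial>lborel) \<partial>M)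
      = (\<integral>\<^sup>+p. ennreal ((norm (simple_process (N j) (\<tau> j) (\<zeta> j) (fst p) (snd p) - \<sigma>'' (fst p) (snd p)))\<^sup>2) \<partial>PT)"
      by (rule iterated_nn_integral[of "\<lambda>s \<omega>. ennreal ((norm (simple_process (N j) (\<tau> j) (\<zeta> j) s \<omega> - \<sigma>'' s \<omega>))\<^sup>2)"]) measurable
    also have "\<dots> = (\<integral>\<^sup>+p. ennreal ((norm ((simple_process (k j) (t j) (\<xi> j) (fst p) (snd p) - simple_process (k' j) (t' j) (\<xi>' j) (fst p) (snd p))
            - (\<sigma> (fst p) (snd p) - \<sigma>' (fst p) (snd p))))\<^sup>2) \<partial>PT)"
      using ae by (intro nn_integral_cong_AE) (auto simp: P)
    finally show "(\<integral>\<^sup>+\<omega>. (\<integral>\<^sup>+s\<in>{0..T}. ennreal ((norm (simple_process (N j) (\<tau> j) (\<zeta> j) s \<omega> - \<sigma>'' s \<omega>))\<^sup>2) \<partial>lborel) \<partial>M) = \<dots>" .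
  qed
  also have "\<dots> \<longlonglongrightarrow> 0"
    by (intro nn_integral_norm_diff_tendsto pl pl') measurable
  finally have lim1: "(\<lambda>j. \<integral>\<^sup>+\<omega>. (\<integral>\<^sup>+s\<in>{0..T}. ennreal ((norm (simple_process (N j) (\<tau> j) (\<zeta> j) s \<omega> - \<sigma>'' s \<omega>))\<^sup>2) \<partial>lborel) \<partial>M) \<longlonglongrightarrow> 0" .
  have lim2: "(\<lambda>j. \<integral>\<^sup>+\<omega>. ennreal ((norm (simple_integral W (N j) (\<tau> j) (\<zeta> j) r \<omega> - (I r \<omega> - I' r \<omega>)))\<^sup>2) \<partial>M) \<longlonglongrightarrow> 0"
    if r: "r \<in> {0..T}" for r
    unfolding Q using r
    by (intro nn_integral_norm_diff_tendsto il il' m square_integrable_measurable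
        square_integrable_simple_integral[OF S] square_integrable_simple_integral[OF S']) auto
  show ?thesis
    unfolding ito_integral_def
  proof (intro conjI ballI exI[of _ N] exI[of _ \<tau>] exI[of _ \<zeta>] allI)
    show "adapted M W T (\<lambda>s \<omega>. I s \<omega> - I' s \<omega>)"
      using m(2,6) by (auto simp: adapted_def intro!: borel_measurable_diff)
  qed (use \<sigma>'' m Z lim1 lim2 in \<open>auto intro!: continuous_intros\<close>)
qed

section \<open>The product rule in expectation\<close>

lemma time_measurable_id: "(\<lambda>s. s) \<in> borel_measurable time"
  by (rule measurable_restrict_space1) simp

text \<open>
Turns an integral with variable upper limit into one over a fixed measure space, ready for Fubini.
\<close>

lemma set_integral_upto:
  fixes f :: "real \<Rightarrow> 'b::euclidean_space"
  assumes "s \<in> {0..T}"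
  shows "(LBINT r:{0..s}. f r) = (\<integral>r. indicator {..s} r *\<^sub>R f r \<partial>time)"
proof -
  have "(\<integral>r. indicator {..s} r *\<^sub>R f r \<partial>time) = (\<integral>r. indicator {0..T} r *\<^sub>R (indicator {..s} r *\<^sub>R f r) \<partial>lborel)"
    by (rule integral_restrict_space) simp
  also have "\<dots> = (LBINT r:{0..s}. f r)"
    unfolding set_lebesgue_integral_def using assms
    by (intro Bochner_Integration.integral_cong refl) (auto split: split_indicator)
  finally show ?thesis by simp
qed

text \<open>
The left-hand side is the integral of \<open>f r \<bullet> g s\<close> over the square \<open>[0, T]\<^sup>2\<close>.  The two terms on the
right are the integrals over the triangles \<open>r \<le> s\<close> and \<open>s < r\<close>; the diagonal is negligible.
\<close>

lemma integral_product_triangles: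
  fixes f g :: "real \<Rightarrow> 'b::euclidean_space"
  assumes f: "integrable time f" and g: "integrable time g"
  shows "(\<integral>s. f s \<partial>time) \<bullet> (\<integral>s. g s \<partial>time)
    = (\<integral>s. (LBINT r:{0..s}. f r) \<bullet> g s + f s \<bullet> (LBINT r:{0..s}. g r) \<partial>time)"
proof -
  interpret TT: pair_sigma_finite time time ..
  note [measurable] = time_measurable_id borel_measurable_integrable[OF f] borel_measurable_integrable[OF g]
  define h where "h r s = f r \<bullet> g s" for r s
  have h: "integrable (time \<Otimes>\<^sub>M time) (\<lambda>p. h (fst p) (snd p))"
  proof (rule TT.Fubini_integrable)
    show "integrable time (\<lambda>r. \<integral>s. norm (h (fst (r, s)) (snd (r, s))) \<partial>time)"
    proof (rule Bochner_Integration.integrable_bound)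
      show "integrable time (\<lambda>r. norm (f r) * (\<integral>s. norm (g s) \<partial>time))"
        using f by auto
      have "(\<integral>s. norm (h r s) \<partial>time) \<le> norm (f r) * (\<integral>s. norm (g s) \<partial>time)" for r
      proof -
        have "(\<integral>s. norm (h r s) \<partial>time) \<le> (\<integral>s. norm (f r) * norm (g s) \<partial>time)"
          using g unfolding h_def by (intro integral_mono) (auto simp: Cauchy_Schwarz_ineq2)
        then show ?thesis by simp
      qed
      then show "AE r in time. norm (\<integral>s. norm (h (fst (r, s)) (snd (r, s))) \<partial>time) \<le> norm (norm (f r) * (\<integral>s. norm (g s) \<partial>time))"
        by (auto intro!: AE_I2 order_trans[OF _ abs_ge_self])
    qed (simp add: h_def)
    show "AE r in time. integrable time (\<lambda>s. h (fst (r, s)) (snd (r, s)))"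
      unfolding h_def using g by auto
  qed (simp add: h_def)
  have U: "integrable (time \<Otimes>\<^sub>M time) (\<lambda>(r, s). indicator {..s} r *\<^sub>R h r s)"
    by (rule Bochner_Integration.integrable_bound[OF h])
       (auto simp: case_prod_beta' h_def indicator_def of_bool_def)
  have V: "integrable (time \<Otimes>\<^sub>M time) (\<lambda>(r, s). indicator {..<r} s *\<^sub>R h r s)"
    by (rule Bochner_Integration.integrable_bound[OF h])
       (auto simp: case_prod_beta' h_def indicator_def of_bool_def)
  have U_eq: "(\<integral>r. indicator {..s} r *\<^sub>R h r s \<partial>time) = (LBINT r:{0..s}. f r) \<bullet> g s" if "s \<in> {0..T}" for s
  proof -
    have "integrable time (\<lambda>r. indicator {..s} r *\<^sub>R f r)"
      by (rule Bochner_Integration.integrable_bound[OF f]) (auto simp: indicator_def of_bool_def)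
    then show ?thesis
      unfolding set_integral_upto[OF that] by (simp add: h_def flip: integral_inner_left)
  qed
  have V_eq: "(\<integral>s. indicator {..<r} s *\<^sub>R h r s \<partial>time) = f r \<bullet> (LBINT s:{0..r}. g s)" if "r \<in> {0..T}" for r
  proof -
    have "integrable time (\<lambda>s. indicator {..r} s *\<^sub>R g s)"
      by (rule Bochner_Integration.integrable_bound[OF g]) (auto simp: indicator_def of_bool_def)
    then have "f r \<bullet> (LBINT s:{0..r}. g s) = (\<integral>s. f r \<bullet> (indicator {..r} s *\<^sub>R g s) \<partial>time)"
      unfolding set_integral_upto[OF that] by (subst integral_inner_right) auto
    also have "\<dots> = (\<integral>s. indicator {..<r} s *\<^sub>R h r s \<partial>time)"
    proof (rule integral_cong_AE)
      \<comment> \<open>The triangle \<open>s < r\<close> is open along its diagonal, the integral up to \<open>r\<close> is not.\<close>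
      have "AE s in lborel. s \<noteq> r" by (rule AE_lborel_singleton)
      then show "AE s in time. f r \<bullet> (indicator {..r} s *\<^sub>R g s) = indicator {..<r} s *\<^sub>R h r s"
        unfolding AE_time_iff by eventually_elim (auto simp: h_def indicator_def of_bool_def)
    qed (auto simp: h_def)
    finally show ?thesis by simp
  qed
  have "(\<integral>s. f s \<partial>time) \<bullet> (\<integral>s. g s \<partial>time) = (\<integral>r. (\<integral>s. h r s \<partial>time) \<partial>time)"
    using f g by (simp add: h_def)
  also have "\<dots> = (\<integral>p. h (fst p) (snd p) \<partial>(time \<Otimes>\<^sub>M time))"
    using TT.integral_fst'[OF h] by simp
  also have "\<dots> = (\<integral>p. (case p of (r, s) \<Rightarrow> indicator {..s} r *\<^sub>R h r s) + (case p of (r, s) \<Rightarrow> indicator {..<r} s *\<^sub>R h r s) \<partial>(time \<Otimes>\<^sub>M time))"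
    by (intro Bochner_Integration.integral_cong refl) (auto simp: indicator_def)
  also have "\<dots> = (\<integral>s. (\<integral>r. indicator {..s} r *\<^sub>R h r s \<partial>time) \<partial>time) + (\<integral>r. (\<integral>s. indicator {..<r} s *\<^sub>R h r s \<partial>time) \<partial>time)"
    using U V by (subst Bochner_Integration.integral_add) (auto simp: TT.integral_fst TT.integral_snd)
  also have "\<dots> = (\<integral>s. (\<integral>r. indicator {..s} r *\<^sub>R h r s \<partial>time) + (\<integral>r. indicator {..<s} r *\<^sub>R h s r \<partial>time) \<partial>time)"
    using TT.integrable_snd[OF U] TT.integrable_fst[OF V] by (rule Bochner_Integration.integral_add[symmetric])
  also have "\<dots> = (\<integral>s. (LBINT r:{0..s}. f r) \<bullet> g s + f s \<bullet> (LBINT r:{0..s}. g r) \<partial>time)"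
    by (intro Bochner_Integration.integral_cong refl) (use U_eq V_eq in \<open>simp add: space_time\<close>)
  finally show ?thesis .
qed

lemma integrable_PT_snd:
  fixes g :: "'a \<Rightarrow> real"
  assumes g: "integrable M g"
  shows "integrable PT (\<lambda>p. g (snd p))"
proof (rule integrableI_bounded)
  note [measurable] = borel_measurable_integrable[OF g]
  show m: "(\<lambda>p. g (snd p)) \<in> borel_measurable PT" by measurable
  have fin: "emeasure time (space time) < \<infinity>"
    using time.emeasure_finite[of "space time"] unfolding top.not_eq_extremum infinity_ennreal_def .
  have "(\<integral>\<^sup>+p. ennreal (norm (g (snd p))) \<partial>PT) = (\<integral>\<^sup>+\<omega>. (\<integral>\<^sup>+s. ennreal (norm (g \<omega>)) \<partial>time) \<partial>M)"
    by (subst PT.nn_integral_snd[symmetric]) auto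
  also have "\<dots> = (\<integral>\<^sup>+\<omega>. ennreal (norm (g \<omega>)) * emeasure time (space time) \<partial>M)"
    by simp
  also have "\<dots> = (\<integral>\<^sup>+\<omega>. ennreal (norm (g \<omega>)) \<partial>M) * emeasure time (space time)"
    by (rule nn_integral_multc) simp
  also have "\<dots> < \<infinity>"
    using g fin by (auto simp: integrable_iff_bounded ennreal_mult_less_top)
  finally show "(\<integral>\<^sup>+p. ennreal (norm (g (snd p))) \<partial>PT) < \<infinity>" .
qed

lemma square_integrable_PT_snd:
  fixes f :: "'a \<Rightarrow> 'b::euclidean_space"
  assumes "square_integrable M f"
  shows "square_integrable PT (\<lambda>p. f (snd p))"
  using assms integrable_PT_snd[of "\<lambda>\<omega>. (norm (f \<omega>))\<^sup>2"] by (auto simp: square_integrable_def)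

lemma integral_inner_drift:
  fixes b :: "real \<Rightarrow> 'a \<Rightarrow> 'b::euclidean_space"
  assumes b: "square_integrable PT (\<lambda>p. b (fst p) (snd p))" and \<eta>: "square_integrable M \<eta>"
  shows "(\<integral>\<omega>. (\<integral>s. b s \<omega> \<partial>time) \<bullet> \<eta> \<omega> \<partial>M) = (\<integral>p. b (fst p) (snd p) \<bullet> \<eta> (snd p) \<partial>PT)"
proof -
  have int: "integrable PT (case_prod (\<lambda>s \<omega>. b s \<omega> \<bullet> \<eta> \<omega>))"
    using integrable_inner_square_integrable[OF b square_integrable_PT_snd[OF \<eta>]] by (simp add: case_prod_beta')
  have "integrable PT (case_prod b)"
    using square_integrable_integrable(3)[OF b] by (simp add: case_prod_beta')
  note m = borel_measurable_integrable[OF PT.integrable_snd[OF this]]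
  have "(\<integral>\<omega>. (\<integral>s. b s \<omega> \<partial>time) \<bullet> \<eta> \<omega> \<partial>M) = (\<integral>\<omega>. (\<integral>s. b s \<omega> \<bullet> \<eta> \<omega> \<partial>time) \<partial>M)"
  proof (rule integral_cong_AE)
    show "AE \<omega> in M. (\<integral>s. b s \<omega> \<partial>time) \<bullet> \<eta> \<omega> = (\<integral>s. b s \<omega> \<bullet> \<eta> \<omega> \<partial>time)"
      using AE_square_integrable_section(2)[OF b]
      by eventually_elim (simp add: square_integrable_integrable)
    show "(\<lambda>\<omega>. (\<integral>s. b s \<omega> \<partial>time) \<bullet> \<eta> \<omega>) \<in> borel_measurable M"
      using m square_integrable_measurable[OF \<eta>] by (rule borel_measurable_inner)
    show "(\<lambda>\<omega>. \<integral>s. b s \<omega> \<bullet> \<eta> \<omega> \<partial>time) \<in> borel_measurable M"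
      by (rule borel_measurable_integrable[OF PT.integrable_snd[OF int]])
  qed
  also have "\<dots> = (\<integral>p. b (fst p) (snd p) \<bullet> \<eta> (snd p) \<partial>PT)"
    using PT.integral_snd[OF int] by (simp add: case_prod_beta')
  finally show ?thesis .
qed

text \<open>
The left-hand side is the time integral of \<open>E \<langle>b s, I T\<rangle>\<close>, and \<open>b s\<close> is orthogonal to the increment
\<open>I T - I s\<close>.
\<close>

lemma integral_drift_ito:
  fixes b :: "real \<Rightarrow> 'a \<Rightarrow> 'b::euclidean_space"
  assumes b: "b \<in> L2_processes M W T" and I: "ito_integral M W T \<sigma> I"
    and sqI: "square_integrable PT (\<lambda>p. I (fst p) (snd p))"
  shows "(\<integral>\<omega>. (\<integral>s. b s \<omega> \<partial>time) \<bullet> I T \<omega> \<partial>M) = (\<integral>p. b (fst p) (snd p) \<bullet> I (fst p) (snd p) \<partial>PT)"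
proof -
  note sqb = L2_processesD(1)[OF b]
  have T: "T \<in> {0..T}" using T_pos by auto
  note IT = ito_square_integrable[OF I T]
  have int1: "integrable PT (\<lambda>p. b (fst p) (snd p) \<bullet> I T (snd p))"
    by (rule integrable_inner_square_integrable[OF sqb square_integrable_PT_snd[OF IT]])
  have int2: "integrable PT (\<lambda>p. b (fst p) (snd p) \<bullet> I (fst p) (snd p))"
    by (rule integrable_inner_square_integrable[OF sqb sqI])
  have "(\<integral>\<omega>. (\<integral>s. b s \<omega> \<partial>time) \<bullet> I T \<omega> \<partial>M) = (\<integral>p. b (fst p) (snd p) \<bullet> I T (snd p) \<partial>PT)"
    by (rule integral_inner_drift[OF sqb IT])
  also have "\<dots> = (\<integral>s. (\<integral>\<omega>. b s \<omega> \<bullet> I T \<omega> \<partial>M) \<partial>time)"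
    by (rule integral_PT_fst[OF int1])
  also have "\<dots> = (\<integral>s. (\<integral>\<omega>. b s \<omega> \<bullet> I s \<omega> \<partial>M) \<partial>time)"
  proof (rule integral_cong_AE)
    show "(\<lambda>s. \<integral>\<omega>. b s \<omega> \<bullet> I T \<omega> \<partial>M) \<in> borel_measurable time"
      using PT.integrable_fst[of "\<lambda>s \<omega>. b s \<omega> \<bullet> I T \<omega>"] int1 by (simp add: case_prod_beta')
    show "(\<lambda>s. \<integral>\<omega>. b s \<omega> \<bullet> I s \<omega> \<partial>M) \<in> borel_measurable time"
      using PT.integrable_fst[of "\<lambda>s \<omega>. b s \<omega> \<bullet> I s \<omega>"] int2 by (simp add: case_prod_beta')
    show "AE s in time. (\<integral>\<omega>. b s \<omega> \<bullet> I T \<omega> \<partial>M) = (\<integral>\<omega>. b s \<omega> \<bullet> I s \<omega> \<partial>M)"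
      using AE_square_integrable_section(1)[OF sqb] AE_space
    proof eventually_elim
      case (elim s)
      then have s: "s \<in> {0..T}" by (simp add: space_time)
      have "(\<integral>\<omega>. b s \<omega> \<bullet> (I T \<omega> - I s \<omega>) \<partial>M) = 0"
        using s elim by (intro ito_orthogonal[OF I] L2_processesD(2)[OF b]) auto
      moreover have "(\<integral>\<omega>. b s \<omega> \<bullet> (I T \<omega> - I s \<omega>) \<partial>M) = (\<integral>\<omega>. b s \<omega> \<bullet> I T \<omega> \<partial>M) - (\<integral>\<omega>. b s \<omega> \<bullet> I s \<omega> \<partial>M)"
        unfolding inner_diff_right
        by (intro Bochner_Integration.integral_diff integrable_inner_square_integrable elim IT ito_square_integrable[OF I s])
      ultimately show ?case by simp
    qed
  qed
  also have "\<dots> = (\<integral>p. b (fst p) (snd p) \<bullet> I (fst p) (snd p) \<partial>PT)"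
    by (rule integral_PT_fst[OF int2, symmetric])
  finally show ?thesis .
qed

text \<open>
By Cauchy--Schwarz in time, \<open>|B t|\<^sup>2 \<le> T \<cdot> \<integral>|b|\<^sup>2\<close> uniformly in \<open>t\<close>.
\<close>

lemma square_integrable_drift:
  fixes b B :: "real \<Rightarrow> 'a \<Rightarrow> 'b::euclidean_space"
  assumes b: "square_integrable PT (\<lambda>p. b (fst p) (snd p))"
    and B: "(\<lambda>p. B (fst p) (snd p)) \<in> borel_measurable PT"
    and eq: "AE \<omega> in M. \<forall>t\<in>{0..T}. B t \<omega> = (LBINT s:{0..t}. b s \<omega>)"
  shows "square_integrable PT (\<lambda>p. B (fst p) (snd p))"
proof -
  define g where "g \<omega> = (\<integral>s. (norm (b s \<omega>))\<^sup>2 \<partial>time)" for \<omega>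
  have ib: "integrable PT (\<lambda>p. (norm (b (fst p) (snd p)))\<^sup>2)" using b by (simp add: square_integrable_def)
  have g: "integrable M g"
    unfolding g_def using PT.integrable_snd[of "\<lambda>s \<omega>. (norm (b s \<omega>))\<^sup>2"] ib by (simp add: case_prod_beta')
  have g0: "0 \<le> g \<omega>" for \<omega> unfolding g_def by (intro integral_nonneg_AE) auto
  have mT: "measure time {0..T} = T"
    using T_pos by (simp add: measure_restrict_space)
  have bound: "AE \<omega> in M. \<forall>t\<in>{0..T}. (norm (B t \<omega>))\<^sup>2 \<le> T * g \<omega>"
    using eq AE_square_integrable_section(2)[OF b]
  proof eventually_elim
    case (elim \<omega>)
    have nb: "square_integrable time (\<lambda>s. norm (b s \<omega>))" using elim(2) by (auto simp: square_integrable_def)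
    show ?case
    proof
      fix t assume t: "t \<in> {0..T}"
      have "norm (B t \<omega>) = norm (\<integral>r. indicator {..t} r *\<^sub>R b r \<omega> \<partial>time)"
        using elim(1) t by (simp add: set_integral_upto)
      also have "\<dots> \<le> (\<integral>r. norm (indicator {..t} r *\<^sub>R b r \<omega>) \<partial>time)"
        by (rule integral_norm_bound)
      also have "\<dots> \<le> (\<integral>r. norm (b r \<omega>) \<partial>time)"
        using square_integrable_integrable(2)[OF nb] by (intro integral_mono_AE') (auto simp: indicator_def)
      also have "\<dots> \<le> sqrt (g \<omega>) * sqrt T"
        using integral_inner_le[OF nb, of "\<lambda>_. 1"] by (simp add: square_integrable_def mT g_def)
      finally have "(norm (B t \<omega>))\<^sup>2 \<le> (sqrt (g \<omega>) * sqrt T)\<^sup>2" by (intro power_mono) auto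
      then show "(norm (B t \<omega>))\<^sup>2 \<le> T * g \<omega>"
        using g0[of \<omega>] T_pos by (simp add: power_mult_distrib mult.commute)
    qed
  qed
  note [measurable] = B borel_measurable_integrable[OF g]
  have "AE s in time. AE \<omega> in M. (norm (B (fst (s, \<omega>)) (snd (s, \<omega>))))\<^sup>2 \<le> T * g (snd (s, \<omega>))"
  proof (rule AE_I2)
    fix s assume s: "s \<in> space time"
    show "AE \<omega> in M. (norm (B (fst (s, \<omega>)) (snd (s, \<omega>))))\<^sup>2 \<le> T * g (snd (s, \<omega>))"
      using bound by eventually_elim (use s in \<open>simp add: space_time\<close>)
  qed
  then have "AE p in PT. (norm (B (fst p) (snd p)))\<^sup>2 \<le> T * g (snd p)"
    by (intro PT.AE_pair_measure) measurable
  then show ?thesis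
    using integrable_PT_snd[OF integrable_mult_right[OF g, of T]]
    by (intro square_integrable_mono[OF B]) auto
qed

text \<open>
The absolutely continuous part is taken to be \<open>X t - X 0 - I t\<close> rather than the integral of \<open>b\<close>: the
two agree almost surely for all times, but the former is continuous on every path and therefore
jointly measurable.
\<close>

lemma ito_decomposition:
  fixes X b \<sigma> :: "real \<Rightarrow> 'a \<Rightarrow> 'b::euclidean_space"
  assumes X: "X \<in> sup_L2_processes M W T" and b: "b \<in> L2_processes M W T"
    and d: "ito_differential M W T X b \<sigma>"
  shows "\<exists>I B. ito_integral M W T \<sigma> I \<and> (\<forall>t \<omega>. X t \<omega> = X 0 \<omega> + B t \<omega> + I t \<omega>) \<and>
    (AE \<omega> in M. \<forall>t\<in>{0..T}. B t \<omega> = (LBINT s:{0..t}. b s \<omega>)) \<and> (AE \<omega> in M. I 0 \<omega> = 0) \<and>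
    square_integrable PT (\<lambda>p. B (fst p) (snd p)) \<and> square_integrable PT (\<lambda>p. I (fst p) (snd p)) \<and>
    square_integrable M (B T)"
proof -
  obtain I where I: "ito_integral M W T \<sigma> I"
    and eq: "AE \<omega> in M. \<forall>t\<in>{0..T}. X t \<omega> = X 0 \<omega> + (LBINT s:{0..t}. b s \<omega>) + I t \<omega>"
    using d by (auto simp: ito_differential_def)
  define B where "B t \<omega> = X t \<omega> - X 0 \<omega> - I t \<omega>" for t \<omega>
  have zero: "0 \<in> {0..T}" and T: "T \<in> {0..T}" using T_pos by auto
  note D = sup_L2_processesD[OF X] and E = ito_integralD[OF I]
  have B_eq: "AE \<omega> in M. \<forall>t\<in>{0..T}. B t \<omega> = (LBINT s:{0..t}. b s \<omega>)"
    using eq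
  proof eventually_elim
    case (elim \<omega>)
    show ?case
    proof
      fix t assume "t \<in> {0..T}"
      with elim have "X t \<omega> = X 0 \<omega> + (LBINT s:{0..t}. b s \<omega>) + I t \<omega>" by (rule bspec)
      then show "B t \<omega> = (LBINT s:{0..t}. b s \<omega>)" by (simp add: B_def)
    qed
  qed
  have I_0: "AE \<omega> in M. I 0 \<omega> = 0"
    using eq
  proof eventually_elim
    case (elim \<omega>)
    have "(LBINT s:{0..0}. b s \<omega>) = 0"
      unfolding set_lebesgue_integral_def
    proof (rule integral_eq_zero_AE)
      show "AE s in lborel. indicator {0..0} s *\<^sub>R b s \<omega> = 0"
        using AE_lborel_singleton[of "0 :: real"] by eventually_elim (simp add: indicator_def)
    qed
    moreover have "X 0 \<omega> = X 0 \<omega> + (LBINT s:{0..0}. b s \<omega>) + I 0 \<omega>"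
      using elim zero by (rule bspec)
    ultimately show ?case by simp
  qed
  have mB: "(\<lambda>p. B (fst p) (snd p)) \<in> borel_measurable PT"
    unfolding B_def
    by (rule continuous_jointly_measurable) (auto intro!: borel_measurable_diff D E continuous_intros zero)
  have sqX: "square_integrable PT (\<lambda>p. X (fst p) (snd p))"
    by (rule L2_processesD(1)[OF sup_L2_subset_L2[OF X]])
  have sqX0: "square_integrable PT (\<lambda>p. X 0 (snd p))"
    by (rule square_integrable_PT_snd[OF sup_L2_square_integrable[OF X zero]])
  have sqB: "square_integrable PT (\<lambda>p. B (fst p) (snd p))"
    by (rule square_integrable_drift[OF L2_processesD(1)[OF b] mB B_eq])
  have "square_integrable PT (\<lambda>p. X (fst p) (snd p) - X 0 (snd p) - B (fst p) (snd p))"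
    by (intro square_integrable_diff sqX sqX0 sqB)
  then have sqI: "square_integrable PT (\<lambda>p. I (fst p) (snd p))" by (simp add: B_def)
  have "square_integrable M (B T)"
    unfolding B_def[abs_def]
    by (intro square_integrable_diff sup_L2_square_integrable[OF X] ito_square_integrable[OF I] T zero)
  with I B_eq I_0 sqB sqI show ?thesis
    by (intro exI[of _ I] exI[of _ B]) (simp add: B_def)
qed

text \<open>
Each of the nine products in the expansion of \<open>\<langle>X T, Y T\<rangle>\<close> is evaluated separately; the results
reassemble into the integral on the right.
\<close>

theorem expected_product_rule:
  fixes X Y b b' \<sigma> \<sigma>' :: "real \<Rightarrow> 'a \<Rightarrow> 'b::euclidean_space"
  assumes X: "X \<in> sup_L2_processes M W T" and b: "b \<in> L2_processes M W T"
    and dX: "ito_differential M W T X b \<sigma>"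
    and Y: "Y \<in> sup_L2_processes M W T" and b': "b' \<in> L2_processes M W T"
    and dY: "ito_differential M W T Y b' \<sigma>'"
  shows "(\<integral>\<omega>. X T \<omega> \<bullet> Y T \<omega> \<partial>M) = (\<integral>\<omega>. X 0 \<omega> \<bullet> Y 0 \<omega> \<partial>M) +
    (\<integral>p. X (fst p) (snd p) \<bullet> b' (fst p) (snd p) + b (fst p) (snd p) \<bullet> Y (fst p) (snd p)
        + \<sigma> (fst p) (snd p) \<bullet> \<sigma>' (fst p) (snd p) \<partial>PT)"
proof -
  obtain I B where I: "ito_integral M W T \<sigma> I" and X_eq: "\<And>t \<omega>. X t \<omega> = X 0 \<omega> + B t \<omega> + I t \<omega>"
    and B_eq: "AE \<omega> in M. \<forall>t\<in>{0..T}. B t \<omega> = (LBINT s:{0..t}. b s \<omega>)" and I0: "AE \<omega> in M. I 0 \<omega> = 0"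
    and sqB: "square_integrable PT (\<lambda>p. B (fst p) (snd p))" and sqI: "square_integrable PT (\<lambda>p. I (fst p) (snd p))"
    and sqBT: "square_integrable M (B T)"
    using ito_decomposition[OF X b dX] by blast
  obtain I' B' where I': "ito_integral M W T \<sigma>' I'" and Y_eq: "\<And>t \<omega>. Y t \<omega> = Y 0 \<omega> + B' t \<omega> + I' t \<omega>"
    and B'_eq: "AE \<omega> in M. \<forall>t\<in>{0..T}. B' t \<omega> = (LBINT s:{0..t}. b' s \<omega>)" and I'0: "AE \<omega> in M. I' 0 \<omega> = 0"
    and sqB': "square_integrable PT (\<lambda>p. B' (fst p) (snd p))" and sqI': "square_integrable PT (\<lambda>p. I' (fst p) (snd p))"
    and sqB'T: "square_integrable M (B' T)"
    using ito_decomposition[OF Y b' dY] by blast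
  have zero: "0 \<in> {0..T}" and T: "T \<in> {0..T}" using T_pos by auto
  note sqb = L2_processesD(1)[OF b] and sqb' = L2_processesD(1)[OF b']
  note sq\<sigma> = L2_processesD(1)[OF ito_integralD(1)[OF I]] and sq\<sigma>' = L2_processesD(1)[OF ito_integralD(1)[OF I']]
  note sqX0 = sup_L2_square_integrable[OF X zero] and sqY0 = sup_L2_square_integrable[OF Y zero]
  note sqIT = ito_square_integrable[OF I T] and sqI'T = ito_square_integrable[OF I' T]
  note int = integrable_inner_square_integrable
  note mBT = square_integrable_measurable[OF sqBT] and mB'T = square_integrable_measurable[OF sqB'T]
  have BT: "AE \<omega> in M. B T \<omega> = (\<integral>s. b s \<omega> \<partial>time)"
    using B_eq by eventually_elim (use T in \<open>simp add: set_integral_time\<close>)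
  have B'T: "AE \<omega> in M. B' T \<omega> = (\<integral>s. b' s \<omega> \<partial>time)"
    using B'_eq by eventually_elim (use T in \<open>simp add: set_integral_time\<close>)
  have mb: "(\<lambda>\<omega>. \<integral>s. b s \<omega> \<partial>time) \<in> borel_measurable M" "(\<lambda>\<omega>. \<integral>s. b' s \<omega> \<partial>time) \<in> borel_measurable M"
    using PT.integrable_snd[of b] PT.integrable_snd[of b'] square_integrable_integrable(3)[OF sqb]
      square_integrable_integrable(3)[OF sqb'] by (simp_all add: case_prod_beta')
  have drift: "(\<integral>\<omega>. B T \<omega> \<bullet> \<eta> \<omega> \<partial>M) = (\<integral>\<omega>. (\<integral>s. b s \<omega> \<partial>time) \<bullet> \<eta> \<omega> \<partial>M)"
    if \<eta>: "square_integrable M \<eta>" for \<eta>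
    using BT mb mBT square_integrable_measurable[OF \<eta>] by (intro integral_cong_AE) auto
  have drift': "(\<integral>\<omega>. \<eta> \<omega> \<bullet> B' T \<omega> \<partial>M) = (\<integral>\<omega>. (\<integral>s. b' s \<omega> \<partial>time) \<bullet> \<eta> \<omega> \<partial>M)"
    if \<eta>: "square_integrable M \<eta>" for \<eta>
    using B'T mb mB'T square_integrable_measurable[OF \<eta>] by (intro integral_cong_AE) (auto simp: inner_commute)

  have X0B': "(\<integral>\<omega>. X 0 \<omega> \<bullet> B' T \<omega> \<partial>M) = (\<integral>p. X 0 (snd p) \<bullet> b' (fst p) (snd p) \<partial>PT)"
    unfolding drift'[OF sqX0] integral_inner_drift[OF sqb' sqX0] by (simp add: inner_commute)
  have BY0: "(\<integral>\<omega>. B T \<omega> \<bullet> Y 0 \<omega> \<partial>M) = (\<integral>p. b (fst p) (snd p) \<bullet> Y 0 (snd p) \<partial>PT)"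
    unfolding drift[OF sqY0] integral_inner_drift[OF sqb sqY0] ..
  have BI': "(\<integral>\<omega>. B T \<omega> \<bullet> I' T \<omega> \<partial>M) = (\<integral>p. b (fst p) (snd p) \<bullet> I' (fst p) (snd p) \<partial>PT)"
    unfolding drift[OF sqI'T] integral_drift_ito[OF b I' sqI'] ..
  have IB': "(\<integral>\<omega>. I T \<omega> \<bullet> B' T \<omega> \<partial>M) = (\<integral>p. I (fst p) (snd p) \<bullet> b' (fst p) (snd p) \<partial>PT)"
    unfolding drift'[OF sqIT] integral_drift_ito[OF b' I sqI] by (simp add: inner_commute)
  have II': "(\<integral>\<omega>. I T \<omega> \<bullet> I' T \<omega> \<partial>M) = (\<integral>p. \<sigma> (fst p) (snd p) \<bullet> \<sigma>' (fst p) (snd p) \<partial>PT)"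
    by (rule ito_isometry[OF I I'])
  \<comment> \<open>At time zero the stochastic integral vanishes, so its terminal value is an increment.\<close>
  have orth: "(\<integral>\<omega>. \<eta> \<omega> \<bullet> K T \<omega> \<partial>M) = 0"
    if K: "ito_integral M W T \<rho> K" "AE \<omega> in M. K 0 \<omega> = 0" and \<eta>: "\<eta> \<in> borel_measurable (F 0)" "square_integrable M \<eta>"
    for K \<rho> and \<eta> :: "'a \<Rightarrow> 'b"
  proof -
    have "(\<integral>\<omega>. \<eta> \<omega> \<bullet> K T \<omega> \<partial>M) = (\<integral>\<omega>. \<eta> \<omega> \<bullet> (K T \<omega> - K 0 \<omega>) \<partial>M)"
      using K(2) ito_integralD(4)[OF K(1)] T zero square_integrable_measurable[OF \<eta>(2)]
      by (intro integral_cong_AE) (auto intro!: borel_measurable_inner borel_measurable_diff)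
    also have "\<dots> = 0"
      using T_pos by (intro ito_orthogonal[OF K(1)] \<eta>) auto
    finally show ?thesis .
  qed
  have X0I': "(\<integral>\<omega>. X 0 \<omega> \<bullet> I' T \<omega> \<partial>M) = 0"
    by (rule orth[OF I' I'0 sup_L2_processesD(2)[OF X zero] sqX0])
  have IY0: "(\<integral>\<omega>. I T \<omega> \<bullet> Y 0 \<omega> \<partial>M) = 0"
    using orth[OF I I0 sup_L2_processesD(2)[OF Y zero] sqY0] by (simp add: inner_commute)
  have BB': "(\<integral>\<omega>. B T \<omega> \<bullet> B' T \<omega> \<partial>M)
      = (\<integral>p. B (fst p) (snd p) \<bullet> b' (fst p) (snd p) \<partial>PT) + (\<integral>p. b (fst p) (snd p) \<bullet> B' (fst p) (snd p) \<partial>PT)"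
  proof -
    have i: "integrable PT (case_prod (\<lambda>s \<omega>. B s \<omega> \<bullet> b' s \<omega> + b s \<omega> \<bullet> B' s \<omega>))"
      using int[OF sqB sqb'] int[OF sqb sqB'] by (simp add: case_prod_beta')
    have "(\<integral>\<omega>. B T \<omega> \<bullet> B' T \<omega> \<partial>M) = (\<integral>\<omega>. (\<integral>s. B s \<omega> \<bullet> b' s \<omega> + b s \<omega> \<bullet> B' s \<omega> \<partial>time) \<partial>M)"
    proof (rule integral_cong_AE)
      show "AE \<omega> in M. B T \<omega> \<bullet> B' T \<omega> = (\<integral>s. B s \<omega> \<bullet> b' s \<omega> + b s \<omega> \<bullet> B' s \<omega> \<partial>time)"
        using BT B'T B_eq B'_eq AE_square_integrable_section(2)[OF sqb] AE_square_integrable_section(2)[OF sqb']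
      proof eventually_elim
        case (elim \<omega>)
        have "B T \<omega> \<bullet> B' T \<omega> = (\<integral>s. (LBINT r:{0..s}. b r \<omega>) \<bullet> b' s \<omega> + b s \<omega> \<bullet> (LBINT r:{0..s}. b' r \<omega>) \<partial>time)"
          unfolding elim(1,2) by (intro integral_product_triangles square_integrable_integrable elim)
        also have "\<dots> = (\<integral>s. B s \<omega> \<bullet> b' s \<omega> + b s \<omega> \<bullet> B' s \<omega> \<partial>time)"
          using elim(3,4) by (intro Bochner_Integration.integral_cong refl) (simp add: space_time)
        finally show ?case .
      qed
      show "(\<lambda>\<omega>. \<integral>s. B s \<omega> \<bullet> b' s \<omega> + b s \<omega> \<bullet> B' s \<omega> \<partial>time) \<in> borel_measurable M"
        by (rule borel_measurable_integrable[OF PT.integrable_snd[OF i]])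
    qed (intro borel_measurable_inner mBT mB'T)
    also have "\<dots> = (\<integral>p. B (fst p) (snd p) \<bullet> b' (fst p) (snd p) + b (fst p) (snd p) \<bullet> B' (fst p) (snd p) \<partial>PT)"
      using PT.integral_snd[OF i] by (simp add: case_prod_beta')
    also have "\<dots> = (\<integral>p. B (fst p) (snd p) \<bullet> b' (fst p) (snd p) \<partial>PT) + (\<integral>p. b (fst p) (snd p) \<bullet> B' (fst p) (snd p) \<partial>PT)"
      by (rule Bochner_Integration.integral_add[OF int[OF sqB sqb'] int[OF sqb sqB']])
    finally show ?thesis .
  qed

  have lhs: "(\<integral>\<omega>. X T \<omega> \<bullet> Y T \<omega> \<partial>M) =
      (\<integral>\<omega>. X 0 \<omega> \<bullet> Y 0 \<omega> \<partial>M) + (\<integral>\<omega>. X 0 \<omega> \<bullet> B' T \<omega> \<partial>M) + (\<integral>\<omega>. X 0 \<omega> \<bullet> I' T \<omega> \<partial>M)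
      + ((\<integral>\<omega>. B T \<omega> \<bullet> Y 0 \<omega> \<partial>M) + (\<integral>\<omega>. B T \<omega> \<bullet> B' T \<omega> \<partial>M) + (\<integral>\<omega>. B T \<omega> \<bullet> I' T \<omega> \<partial>M))
      + ((\<integral>\<omega>. I T \<omega> \<bullet> Y 0 \<omega> \<partial>M) + (\<integral>\<omega>. I T \<omega> \<bullet> B' T \<omega> \<partial>M) + (\<integral>\<omega>. I T \<omega> \<bullet> I' T \<omega> \<partial>M))"
    unfolding X_eq[of T] Y_eq[of T] inner_add_left inner_add_right
    using sqX0 sqY0 sqBT sqB'T sqIT sqI'T by (simp add: int)
  note sqX0' = square_integrable_PT_snd[OF sqX0] and sqY0' = square_integrable_PT_snd[OF sqY0]
  have rhs: "(\<integral>p. X (fst p) (snd p) \<bullet> b' (fst p) (snd p) + b (fst p) (snd p) \<bullet> Y (fst p) (snd p)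
        + \<sigma> (fst p) (snd p) \<bullet> \<sigma>' (fst p) (snd p) \<partial>PT)
     = (\<integral>p. X 0 (snd p) \<bullet> b' (fst p) (snd p) \<partial>PT) + (\<integral>p. B (fst p) (snd p) \<bullet> b' (fst p) (snd p) \<partial>PT)
       + (\<integral>p. I (fst p) (snd p) \<bullet> b' (fst p) (snd p) \<partial>PT)
       + ((\<integral>p. b (fst p) (snd p) \<bullet> Y 0 (snd p) \<partial>PT) + (\<integral>p. b (fst p) (snd p) \<bullet> B' (fst p) (snd p) \<partial>PT)
       + (\<integral>p. b (fst p) (snd p) \<bullet> I' (fst p) (snd p) \<partial>PT))
       + (\<integral>p. \<sigma> (fst p) (snd p) \<bullet> \<sigma>' (fst p) (snd p) \<partial>PT)"
    unfolding X_eq[of "fst _"] Y_eq[of "fst _"] inner_add_left inner_add_right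
    using sqX0' sqY0' sqB sqB' sqI sqI' sqb sqb' sq\<sigma> sq\<sigma>' by (simp add: int)
  show ?thesis
    unfolding lhs rhs X0B' BY0 BI' IB' II' X0I' IY0 BB' by simp
qed

section \<open>Linearity of the state equation\<close>

lemma mean_diff:
  fixes \<phi> \<psi> :: "real \<Rightarrow> 'a \<Rightarrow> 'b::euclidean_space"
  assumes "\<phi> \<in> L2_processes M W T" "\<psi> \<in> L2_processes M W T"
  shows "AE s in time. mean M (\<lambda>s \<omega>. \<phi> s \<omega> - \<psi> s \<omega>) s = mean M \<phi> s - mean M \<psi> s"
  using AE_square_integrable_section(1)[OF L2_processesD(1)[OF assms(1)]]
    AE_square_integrable_section(1)[OF L2_processesD(1)[OF assms(2)]]
proof eventually_elim
  case (elim s)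
  then show ?case
    unfolding mean_def by (intro Bochner_Integration.integral_diff square_integrable_integrable)
qed

lemma mf_linear_L2:
  fixes A A' :: "real \<Rightarrow> real^'n^'l" and B B' :: "real \<Rightarrow> real^'m^'l"
  assumes "L_infty T A" "L_infty T B" "L_infty T A'" "L_infty T B'"
    and "X \<in> L2_processes M W T" "u \<in> L2_processes M W T"
  shows "(\<lambda>s \<omega>. A s *v X s \<omega> + B s *v u s \<omega> + A' s *v mean M X s + B' s *v mean M u s) \<in> L2_processes M W T"
  by (intro L2_processes_add L2_coefficient L2_mean assms)

lemma mf_linear_diff:
  fixes A A' :: "real \<Rightarrow> real^'n^'l" and B B' :: "real \<Rightarrow> real^'m^'l"
  assumes X: "X \<in> L2_processes M W T" "X' \<in> L2_processes M W T"
    and u: "u \<in> L2_processes M W T" "u' \<in> L2_processes M W T"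
  shows "AE s in time. \<forall>\<omega>\<in>space M.
     A s *v (X' s \<omega> - X s \<omega>) + B s *v (u' s \<omega> - u s \<omega>)
       + A' s *v mean M (\<lambda>s \<omega>. X' s \<omega> - X s \<omega>) s + B' s *v mean M (\<lambda>s \<omega>. u' s \<omega> - u s \<omega>) s
   = (A s *v X' s \<omega> + B s *v u' s \<omega> + A' s *v mean M X' s + B' s *v mean M u' s)
     - (A s *v X s \<omega> + B s *v u s \<omega> + A' s *v mean M X s + B' s *v mean M u s)"
  using mean_diff[OF X(2,1)] mean_diff[OF u(2,1)]
  by eventually_elim (simp add: matrix_vector_mult_diff_distrib)

lemma ito_differential_diff:
  fixes X X' b b' b'' \<sigma> \<sigma>' \<sigma>'' :: "real \<Rightarrow> 'a \<Rightarrow> 'b::euclidean_space"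
  assumes d: "ito_differential M W T X b \<sigma>" and d': "ito_differential M W T X' b' \<sigma>'"
    and b: "b \<in> L2_processes M W T" "b' \<in> L2_processes M W T" "b'' \<in> L2_processes M W T"
    and \<sigma>'': "\<sigma>'' \<in> L2_processes M W T"
    and eqb: "AE s in time. \<forall>\<omega>\<in>space M. b'' s \<omega> = b s \<omega> - b' s \<omega>"
    and eq\<sigma>: "AE s in time. \<forall>\<omega>\<in>space M. \<sigma>'' s \<omega> = \<sigma> s \<omega> - \<sigma>' s \<omega>"
  shows "ito_differential M W T (\<lambda>s \<omega>. X s \<omega> - X' s \<omega>) b'' \<sigma>''"
proof -
  obtain I where I: "ito_integral M W T \<sigma> I"
    and eq: "AE \<omega> in M. \<forall>t\<in>{0..T}. X t \<omega> = X 0 \<omega> + (LBINT s:{0..t}. b s \<omega>) + I t \<omega>"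
    using d by (auto simp: ito_differential_def)
  obtain I' where I': "ito_integral M W T \<sigma>' I'"
    and eq': "AE \<omega> in M. \<forall>t\<in>{0..T}. X' t \<omega> = X' 0 \<omega> + (LBINT s:{0..t}. b' s \<omega>) + I' t \<omega>"
    using d' by (auto simp: ito_differential_def)
  note sec = AE_square_integrable_section(2)[OF L2_processesD(1)]
  have "AE \<omega> in M. set_integrable lborel {0..T} (\<lambda>s. b'' s \<omega>)"
    using sec[OF b(3)] by eventually_elim (simp add: set_integrable_time square_integrable_integrable)
  moreover have "AE \<omega> in M. \<forall>t\<in>{0..T}. X t \<omega> - X' t \<omega>
      = X 0 \<omega> - X' 0 \<omega> + (LBINT s:{0..t}. b'' s \<omega>) + (I t \<omega> - I' t \<omega>)"
    using eq eq' sec[OF b(1)] sec[OF b(2)] sec[OF b(3)] AE_space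
  proof eventually_elim
    case (elim \<omega>)
    show ?case
    proof
      fix t assume t: "t \<in> {0..T}"
      note [measurable] = time_measurable_id
      have int: "integrable time (\<lambda>s. indicator {..t} s *\<^sub>R f s)" if "square_integrable time f" for f :: "real \<Rightarrow> 'b"
        by (rule Bochner_Integration.integrable_bound[OF square_integrable_integrable(2)[OF that]])
           (use square_integrable_measurable[OF that] in \<open>auto simp: indicator_def of_bool_def\<close>)
      have "(LBINT s:{0..t}. b'' s \<omega>) = (\<integral>s. indicator {..t} s *\<^sub>R b s \<omega> - indicator {..t} s *\<^sub>R b' s \<omega> \<partial>time)"
        unfolding set_integral_upto[OF t]
      proof (rule integral_cong_AE)
        show "AE s in time. indicator {..t} s *\<^sub>R b'' s \<omega> = indicator {..t} s *\<^sub>R b s \<omega> - indicator {..t} s *\<^sub>R b' s \<omega>"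
          using eqb by eventually_elim (use elim in \<open>simp add: scaleR_diff_right\<close>)
      qed (intro borel_measurable_integrable int elim borel_measurable_diff)+
      also have "\<dots> = (LBINT s:{0..t}. b s \<omega>) - (LBINT s:{0..t}. b' s \<omega>)"
        unfolding set_integral_upto[OF t] by (intro Bochner_Integration.integral_diff int elim)
      finally have "(LBINT s:{0..t}. b'' s \<omega>) = (LBINT s:{0..t}. b s \<omega>) - (LBINT s:{0..t}. b' s \<omega>)" .
      moreover have "X t \<omega> = X 0 \<omega> + (LBINT s:{0..t}. b s \<omega>) + I t \<omega>"
        using elim(1) t by (rule bspec)
      moreover have "X' t \<omega> = X' 0 \<omega> + (LBINT s:{0..t}. b' s \<omega>) + I' t \<omega>"
        using elim(2) t by (rule bspec)
      ultimately show "X t \<omega> - X' t \<omega> = X 0 \<omega> - X' 0 \<omega> + (LBINT s:{0..t}. b'' s \<omega>) + (I t \<omega> - I' t \<omega>)"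
        by (simp only: algebra_simps)
    qed
  qed
  ultimately show ?thesis
    unfolding ito_differential_def
    using ito_integral_diff[OF I I' \<sigma>'' eq\<sigma>] by (intro conjI exI[of _ "\<lambda>s \<omega>. I s \<omega> - I' s \<omega>"])
qed

lemma state_process_diff:
  fixes c :: "('n::finite, 'm::finite) mf_coeffs"
  assumes coeffs: "L_infty T (cA c)" "L_infty T (cA_hat c)" "L_infty T (cA1 c)" "L_infty T (cA1_hat c)"
    "L_infty T (cB c)" "L_infty T (cB_hat c)" "L_infty T (cB1 c)" "L_infty T (cB1_hat c)"
    and u: "u \<in> L2_processes M W T" "u' \<in> L2_processes M W T"
    and X: "state_process M W T c x u X" and X': "state_process M W T c x u' X'"
  shows "state_process M W T c 0 (\<lambda>s \<omega>. u' s \<omega> - u s \<omega>) (\<lambda>s \<omega>. X' s \<omega> - X s \<omega>)"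
proof -
  have sX: "X \<in> sup_L2_processes M W T" "X' \<in> sup_L2_processes M W T"
    using X X' by (auto simp: state_process_def)
  note L = sup_L2_subset_L2[OF sX(1)] sup_L2_subset_L2[OF sX(2)]
  note d = X[unfolded state_process_def, THEN conjunct2, THEN conjunct1]
    and d' = X'[unfolded state_process_def, THEN conjunct2, THEN conjunct1]
  have init: "AE \<omega> in M. X 0 \<omega> = x" "AE \<omega> in M. X' 0 \<omega> = x"
    using X X' by (auto simp: state_process_def)
  have "AE \<omega> in M. X' 0 \<omega> - X 0 \<omega> = 0"
    using init by eventually_elim simp
  moreover have "ito_differential M W T (\<lambda>s \<omega>. X' s \<omega> - X s \<omega>)
       (\<lambda>s \<omega>. cA c s *v (X' s \<omega> - X s \<omega>) + cB c s *v (u' s \<omega> - u s \<omega>)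
              + cA_hat c s *v mean M (\<lambda>s \<omega>. X' s \<omega> - X s \<omega>) s + cB_hat c s *v mean M (\<lambda>s \<omega>. u' s \<omega> - u s \<omega>) s)
       (\<lambda>s \<omega>. cA1 c s *v (X' s \<omega> - X s \<omega>) + cB1 c s *v (u' s \<omega> - u s \<omega>)
              + cA1_hat c s *v mean M (\<lambda>s \<omega>. X' s \<omega> - X s \<omega>) s + cB1_hat c s *v mean M (\<lambda>s \<omega>. u' s \<omega> - u s \<omega>) s)"
    by (rule ito_differential_diff[OF d' d mf_linear_L2[OF _ _ _ _ L(2) u(2)] mf_linear_L2[OF _ _ _ _ L(1) u(1)]
          mf_linear_L2[OF _ _ _ _ L2_processes_diff[OF L(2,1)] L2_processes_diff[OF u(2,1)]]
          mf_linear_L2[OF _ _ _ _ L2_processes_diff[OF L(2,1)] L2_processes_diff[OF u(2,1)]]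
          mf_linear_diff[OF L u] mf_linear_diff[OF L u]])
       (rule coeffs)+
  ultimately show ?thesis
    unfolding state_process_def using sup_L2_diff[OF sX(2,1)] by simp
qed

section \<open>The polar form of the cost\<close>

definition running_form ::
  "('n::finite, 'm::finite) mf_coeffs \<Rightarrow> (real \<Rightarrow> 'a \<Rightarrow> real^'n) \<Rightarrow> (real \<Rightarrow> 'a \<Rightarrow> real^'m) \<Rightarrow>
   (real \<Rightarrow> 'a \<Rightarrow> real^'n) \<Rightarrow> (real \<Rightarrow> 'a \<Rightarrow> real^'m) \<Rightarrow> real \<Rightarrow> 'a \<Rightarrow> real" where
  "running_form c X u X' u' s \<omega> =
     (cQ c s *v X s \<omega>) \<bullet> X' s \<omega> + (cQ_hat c s *v mean M X s) \<bullet> mean M X' s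
     + (cR c s *v u s \<omega>) \<bullet> u' s \<omega> + (cR_hat c s *v mean M u s) \<bullet> mean M u' s"

definition terminal_form ::
  "('n::finite, 'm::finite) mf_coeffs \<Rightarrow> (real \<Rightarrow> 'a \<Rightarrow> real^'n) \<Rightarrow> (real \<Rightarrow> 'a \<Rightarrow> real^'n) \<Rightarrow> real" where
  "terminal_form c X X' =
     (\<integral>\<omega>. (cG c *v X T \<omega>) \<bullet> X' T \<omega> \<partial>M) + (cG_hat c *v mean M X T) \<bullet> mean M X' T"

text \<open>
The polar form of the cost: bilinear up to null sets of times, symmetric for symmetric weights, and
equal to the cost functional on the diagonal.
\<close>

definition cost_form ::
  "('n::finite, 'm::finite) mf_coeffs \<Rightarrow> (real \<Rightarrow> 'a \<Rightarrow> real^'n) \<Rightarrow> (real \<Rightarrow> 'a \<Rightarrow> real^'m) \<Rightarrow>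
   (real \<Rightarrow> 'a \<Rightarrow> real^'n) \<Rightarrow> (real \<Rightarrow> 'a \<Rightarrow> real^'m) \<Rightarrow> real" where
  "cost_form c X u X' u' =
     (\<integral>p. running_form c X u X' u' (fst p) (snd p) \<partial>PT) + terminal_form c X X'"

lemma integrable_inner_L2:
  assumes "\<phi> \<in> L2_processes M W T" "\<psi> \<in> L2_processes M W T"
  shows "integrable PT (\<lambda>p. \<phi> (fst p) (snd p) \<bullet> \<psi> (fst p) (snd p))"
  by (intro integrable_inner_square_integrable L2_processesD(1) assms)

lemma integrable_running_form:
  assumes w: "L_infty T (cQ c)" "L_infty T (cQ_hat c)" "L_infty T (cR c)" "L_infty T (cR_hat c)"
    and X: "X \<in> L2_processes M W T" "X' \<in> L2_processes M W T"
    and u: "u \<in> L2_processes M W T" "u' \<in> L2_processes M W T"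
  shows "integrable PT (\<lambda>p. running_form c X u X' u' (fst p) (snd p))"
  unfolding running_form_def
  by (intro Bochner_Integration.integrable_add
      integrable_inner_L2[OF L2_coefficient[OF w(1) X(1)] X(2)]
      integrable_inner_L2[OF L2_coefficient[OF w(2) L2_mean[OF X(1)]] L2_mean[OF X(2)]]
      integrable_inner_L2[OF L2_coefficient[OF w(3) u(1)] u(2)]
      integrable_inner_L2[OF L2_coefficient[OF w(4) L2_mean[OF u(1)]] L2_mean[OF u(2)]])

lemma integrable_terminal:
  fixes S :: "real^'k^'l"
  assumes "X \<in> sup_L2_processes M W T" "X' \<in> sup_L2_processes M W T"
  shows "integrable M (\<lambda>\<omega>. (S *v X T \<omega>) \<bullet> X' T \<omega>)"
  by (rule integrable_inner_square_integrable[OF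
        square_integrable_matrix_vector_mult[OF sup_L2_square_integrable[OF assms(1)]] sup_L2_square_integrable[OF assms(2)]])
     (use T_pos in auto)

lemma cost_functional_eq_cost_form:
  assumes w: "L_infty T (cQ c)" "L_infty T (cQ_hat c)" "L_infty T (cR c)" "L_infty T (cR_hat c)"
    and X: "X \<in> sup_L2_processes M W T" and u: "u \<in> L2_processes M W T"
  shows "cost_functional M T c X u = cost_form c X u X u"
proof -
  note int = integrable_running_form[OF w sup_L2_subset_L2[OF X] sup_L2_subset_L2[OF X] u u]
  have "cost_functional M T c X u = (LINT \<omega>|M. (LBINT s:{0..T}. running_form c X u X u s \<omega>)
        + (cG c *v X T \<omega>) \<bullet> X T \<omega> + (cG_hat c *v mean M X T) \<bullet> mean M X T)"
    by (simp add: cost_functional_def running_form_def)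
  also have "\<dots> = (LINT \<omega>|M. (LBINT s:{0..T}. running_form c X u X u s \<omega>)) + terminal_form c X X"
    using iterated_integral(2)[OF int] integrable_terminal[OF X X, of "cG c"]
    by (simp add: terminal_form_def prob_space)
  finally show ?thesis
    by (simp add: cost_form_def iterated_integral(1)[OF int])
qed

lemma cost_form_expansion:
  fixes c :: "('n::finite, 'm::finite) mf_coeffs"
  assumes w: "L_infty T (cQ c)" "L_infty T (cQ_hat c)" "L_infty T (cR c)" "L_infty T (cR_hat c)"
    and symQ: "AE s in time. symmetric_matrix (cQ c s) \<and> symmetric_matrix (cQ_hat c s)"
    and symR: "AE s in time. symmetric_matrix (cR c s) \<and> symmetric_matrix (cR_hat c s)"
    and symG: "symmetric_matrix (cG c)" "symmetric_matrix (cG_hat c)"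
    and X: "X \<in> sup_L2_processes M W T" and X': "X' \<in> sup_L2_processes M W T"
    and u: "u \<in> L2_processes M W T" and u': "u' \<in> L2_processes M W T"
  defines "\<xi> \<equiv> \<lambda>s \<omega>. X' s \<omega> - X s \<omega>" and "v \<equiv> \<lambda>s \<omega>. u' s \<omega> - u s \<omega>"
  shows "cost_form c X' u' X' u' = cost_form c X u X u + 2 * cost_form c X u \<xi> v + cost_form c \<xi> v \<xi> v"
proof -
  have \<xi>: "\<xi> \<in> sup_L2_processes M W T" unfolding \<xi>_def by (rule sup_L2_diff[OF X' X])
  have v: "v \<in> L2_processes M W T" unfolding v_def by (rule L2_processes_diff[OF u' u])
  note L = sup_L2_subset_L2
  note int = integrable_running_form[OF w]
  have "AE s in time. \<forall>\<omega>. running_form c X' u' X' u' s \<omega>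
      = running_form c X u X u s \<omega> + 2 * running_form c X u \<xi> v s \<omega> + running_form c \<xi> v \<xi> v s \<omega>"
    using mean_diff[OF L[OF X'] L[OF X]] mean_diff[OF u' u] symQ symR
  proof eventually_elim
    case (elim s)
    show ?case
    proof
      fix \<omega>
      have m: "mean M \<xi> s = mean M X' s - mean M X s" "mean M v s = mean M u' s - mean M u s"
        using elim by (auto simp: \<xi>_def v_def)
      show "running_form c X' u' X' u' s \<omega>
        = running_form c X u X u s \<omega> + 2 * running_form c X u \<xi> v s \<omega> + running_form c \<xi> v \<xi> v s \<omega>"
        unfolding running_form_def m
        using quadratic_expansion[of "cQ c s" "X' s \<omega>" "X s \<omega>"] quadratic_expansion[of "cQ_hat c s" "mean M X' s" "mean M X s"]
          quadratic_expansion[of "cR c s" "u' s \<omega>" "u s \<omega>"] quadratic_expansion[of "cR_hat c s" "mean M u' s" "mean M u s"] elim(3,4)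
        by (simp add: \<xi>_def v_def)
    qed
  qed
  then have "AE s in time. AE \<omega> in M. running_form c X' u' X' u' (fst (s, \<omega>)) (snd (s, \<omega>))
      = running_form c X u X u (fst (s, \<omega>)) (snd (s, \<omega>)) + 2 * running_form c X u \<xi> v (fst (s, \<omega>)) (snd (s, \<omega>))
        + running_form c \<xi> v \<xi> v (fst (s, \<omega>)) (snd (s, \<omega>))"
    by eventually_elim simp
  moreover note i = int[OF L[OF X'] L[OF X'] u' u'] int[OF L[OF X] L[OF X] u u] int[OF L[OF X] L[OF \<xi>] u v] int[OF L[OF \<xi>] L[OF \<xi>] v v]
  note [measurable] = i[THEN borel_measurable_integrable]
  ultimately have "AE p in PT. running_form c X' u' X' u' (fst p) (snd p)
      = running_form c X u X u (fst p) (snd p) + 2 * running_form c X u \<xi> v (fst p) (snd p)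
        + running_form c \<xi> v \<xi> v (fst p) (snd p)"
    by (intro PT.AE_pair_measure) measurable
  then have "(\<integral>p. running_form c X' u' X' u' (fst p) (snd p) \<partial>PT)
     = (\<integral>p. running_form c X u X u (fst p) (snd p) + 2 * running_form c X u \<xi> v (fst p) (snd p)
        + running_form c \<xi> v \<xi> v (fst p) (snd p) \<partial>PT)"
    by (intro integral_cong_AE) measurable
  also have "\<dots> = (\<integral>p. running_form c X u X u (fst p) (snd p) \<partial>PT) + 2 * (\<integral>p. running_form c X u \<xi> v (fst p) (snd p) \<partial>PT)
      + (\<integral>p. running_form c \<xi> v \<xi> v (fst p) (snd p) \<partial>PT)"
    using i by simp
  finally have running: "(\<integral>p. running_form c X' u' X' u' (fst p) (snd p) \<partial>PT) = \<dots>" .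
  have T: "T \<in> {0..T}" using T_pos by auto
  have mT: "mean M \<xi> T = mean M X' T - mean M X T"
    unfolding mean_def \<xi>_def
    by (intro Bochner_Integration.integral_diff square_integrable_integrable sup_L2_square_integrable X X' T)
  have "(\<integral>\<omega>. (cG c *v X' T \<omega>) \<bullet> X' T \<omega> \<partial>M)
     = (\<integral>\<omega>. (cG c *v X T \<omega>) \<bullet> X T \<omega> + 2 * ((cG c *v X T \<omega>) \<bullet> \<xi> T \<omega>) + (cG c *v \<xi> T \<omega>) \<bullet> \<xi> T \<omega> \<partial>M)"
    unfolding \<xi>_def by (intro Bochner_Integration.integral_cong refl quadratic_expansion symG)
  also have "\<dots> = (\<integral>\<omega>. (cG c *v X T \<omega>) \<bullet> X T \<omega> \<partial>M) + 2 * (\<integral>\<omega>. (cG c *v X T \<omega>) \<bullet> \<xi> T \<omega> \<partial>M)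
      + (\<integral>\<omega>. (cG c *v \<xi> T \<omega>) \<bullet> \<xi> T \<omega> \<partial>M)"
    using integrable_terminal[OF X X] integrable_terminal[OF X \<xi>] integrable_terminal[OF \<xi> \<xi>] by simp
  finally have "terminal_form c X' X' = terminal_form c X X + 2 * terminal_form c X \<xi> + terminal_form c \<xi> \<xi>"
    unfolding terminal_form_def mT using quadratic_expansion[OF symG(2), of "mean M X' T" "mean M X T"] by simp
  with running show ?thesis by (simp add: cost_form_def)
qed

section \<open>Vanishing of the first variation\<close>

text \<open>
Inside an inner product with a deterministic function, a process may be replaced by its mean.
\<close>

lemma integral_inner_mean:
  fixes g :: "real \<Rightarrow> 'b::euclidean_space"
  assumes g: "(\<lambda>s \<omega>. g s) \<in> L2_processes M W T" and \<psi>: "\<psi> \<in> L2_processes M W T"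
  shows "has_bochner_integral PT (\<lambda>p. g (fst p) \<bullet> mean M \<psi> (fst p) - g (fst p) \<bullet> \<psi> (fst p) (snd p)) 0"
proof -
  note i1 = integrable_inner_L2[OF g L2_mean[OF \<psi>]] and i2 = integrable_inner_L2[OF g \<psi>]
  have i1': "integrable PT (case_prod (\<lambda>s \<omega>. g s \<bullet> mean M \<psi> s))"
    and i2': "integrable PT (case_prod (\<lambda>s \<omega>. g s \<bullet> \<psi> s \<omega>))"
    using i1 i2 by (simp_all add: case_prod_beta')
  have "(\<integral>p. g (fst p) \<bullet> \<psi> (fst p) (snd p) \<partial>PT) = (\<integral>s. (\<integral>\<omega>. g s \<bullet> \<psi> s \<omega> \<partial>M) \<partial>time)"
    by (rule integral_PT_fst[OF i2])
  also have "\<dots> = (\<integral>s. (\<integral>\<omega>. g s \<bullet> mean M \<psi> s \<partial>M) \<partial>time)"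
  proof (rule integral_cong_AE)
    show "(\<lambda>s. \<integral>\<omega>. g s \<bullet> \<psi> s \<omega> \<partial>M) \<in> borel_measurable time"
      by (rule borel_measurable_integrable[OF PT.integrable_fst[OF i2']])
    show "(\<lambda>s. \<integral>\<omega>. g s \<bullet> mean M \<psi> s \<partial>M) \<in> borel_measurable time"
      by (rule borel_measurable_integrable[OF PT.integrable_fst[OF i1']])
    show "AE s in time. (\<integral>\<omega>. g s \<bullet> \<psi> s \<omega> \<partial>M) = (\<integral>\<omega>. g s \<bullet> mean M \<psi> s \<partial>M)"
      using AE_square_integrable_section(1)[OF L2_processesD(1)[OF \<psi>]]
      by eventually_elim (simp add: mean_def prob_space square_integrable_integrable)
  qed
  also have "\<dots> = (\<integral>p. g (fst p) \<bullet> mean M \<psi> (fst p) \<partial>PT)"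
    by (rule integral_PT_fst[OF i1, symmetric])
  finally show ?thesis
    using i1 i2 by (simp add: has_bochner_integral_iff)
qed

text \<open>
Replacing \<open>\<psi>\<close> and \<open>\<phi>\<close> by their means makes both terms equal to \<open>\<langle>A E[\<phi>], E[\<psi>]\<rangle>\<close>.
\<close>

lemma integral_mean_adjoint:
  fixes A :: "real \<Rightarrow> real^'k^'l"
  assumes A: "L_infty T A" and \<phi>: "\<phi> \<in> L2_processes M W T" and \<psi>: "\<psi> \<in> L2_processes M W T"
  shows "has_bochner_integral PT (\<lambda>p. (A (fst p) *v mean M \<phi> (fst p)) \<bullet> \<psi> (fst p) (snd p)
     - (transpose (A (fst p)) *v mean M \<psi> (fst p)) \<bullet> \<phi> (fst p) (snd p)) 0"
  using has_bochner_integral_diff[OF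
      integral_inner_mean[OF L2_coefficient[OF L_infty_transpose[OF A] L2_mean[OF \<psi>]] \<phi>]
      integral_inner_mean[OF L2_coefficient[OF A L2_mean[OF \<phi>]] \<psi>]]
  by (simp add: inner_transpose del: transpose_matrix_vector)

text \<open>
The adjoint pair \<open>(Y, Z)\<close> represents the first variation of the cost: by duality it is the pairing
of the left-hand side of the stationarity relation with \<open>v\<close>.
\<close>

lemma cost_form_stationary:
  fixes c :: "('n::finite, 'm::finite) mf_coeffs"
  assumes coeffs: "L_infty T (cA c)" "L_infty T (cA_hat c)" "L_infty T (cA1 c)" "L_infty T (cA1_hat c)"
    "L_infty T (cB c)" "L_infty T (cB_hat c)" "L_infty T (cB1 c)" "L_infty T (cB1_hat c)"
    and w: "L_infty T (cQ c)" "L_infty T (cQ_hat c)" "L_infty T (cR c)" "L_infty T (cR_hat c)"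
    and sol: "mf_fbsde_solution M W T c x X u Y Z"
    and v: "v \<in> L2_processes M W T" and \<xi>_state: "state_process M W T c 0 v \<xi>"
  shows "cost_form c X u \<xi> v = 0"
proof -
  let ?Ds = "\<lambda>s \<omega>. cA c s *v \<xi> s \<omega> + cB c s *v v s \<omega> + cA_hat c s *v mean M \<xi> s + cB_hat c s *v mean M v s"
  let ?Ss = "\<lambda>s \<omega>. cA1 c s *v \<xi> s \<omega> + cB1 c s *v v s \<omega> + cA1_hat c s *v mean M \<xi> s + cB1_hat c s *v mean M v s"
  let ?Db = "\<lambda>s \<omega>. - (transpose (cA c s) *v Y s \<omega> + transpose (cA1 c s) *v Z s \<omega> + cQ c s *v X s \<omega>
              + transpose (cA_hat c s) *v mean M Y s + transpose (cA1_hat c s) *v mean M Z s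
              + cQ_hat c s *v mean M X s)"
  let ?St = "\<lambda>s \<omega>. cR c s *v u s \<omega> + cR_hat c s *v mean M u s
        + transpose (cB c s) *v Y s \<omega> + transpose (cB1 c s) *v Z s \<omega>
        + transpose (cB_hat c s) *v mean M Y s + transpose (cB1_hat c s) *v mean M Z s"
  have X: "X \<in> sup_L2_processes M W T" and u: "u \<in> L2_processes M W T"
    and Y: "Y \<in> sup_L2_processes M W T" and Z: "Z \<in> L2_processes M W T"
    and dY: "ito_differential M W T Y ?Db Z"
    and YT: "AE \<omega> in M. Y T \<omega> = cG c *v X T \<omega> + cG_hat c *v mean M X T"
    and St: "AE s in lborel. s \<in> {0..T} \<longrightarrow> (AE \<omega> in M. ?St s \<omega> = 0)"
    using sol by (auto simp: mf_fbsde_solution_def)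
  have \<xi>: "\<xi> \<in> sup_L2_processes M W T" and d\<xi>: "ito_differential M W T \<xi> ?Ds ?Ss" and \<xi>0: "AE \<omega> in M. \<xi> 0 \<omega> = 0"
    using \<xi>_state by (auto simp: state_process_def)
  note L\<xi> = sup_L2_subset_L2[OF \<xi>] and LX = sup_L2_subset_L2[OF X] and LY = sup_L2_subset_L2[OF Y]
  have Ds: "?Ds \<in> L2_processes M W T" and Ss: "?Ss \<in> L2_processes M W T"
    by (intro mf_linear_L2 coeffs L\<xi> v)+
  have Db: "?Db \<in> L2_processes M W T"
    by (intro L2_processes_add L2_processes_minus L2_coefficient L2_mean L_infty_transpose coeffs w LX LY Z)
  have LSt: "?St \<in> L2_processes M W T"
    by (intro L2_processes_add L2_coefficient L2_mean L_infty_transpose coeffs w LY Z u)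
  have T: "T \<in> {0..T}" and zero: "0 \<in> {0..T}" using T_pos by auto
  note sqXT = sup_L2_square_integrable[OF X T] and sqYT = sup_L2_square_integrable[OF Y T]
    and sq\<xi>T = sup_L2_square_integrable[OF \<xi> T]

  have "(\<integral>\<omega>. \<xi> 0 \<omega> \<bullet> Y 0 \<omega> \<partial>M) = 0"
  proof (rule integral_eq_zero_AE)
    show "AE \<omega> in M. \<xi> 0 \<omega> \<bullet> Y 0 \<omega> = 0"
      using \<xi>0 by eventually_elim simp
  qed
  then have dual: "(\<integral>\<omega>. \<xi> T \<omega> \<bullet> Y T \<omega> \<partial>M) =
    (\<integral>p. \<xi> (fst p) (snd p) \<bullet> ?Db (fst p) (snd p) + ?Ds (fst p) (snd p) \<bullet> Y (fst p) (snd p)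
        + ?Ss (fst p) (snd p) \<bullet> Z (fst p) (snd p) \<partial>PT)"
    using expected_product_rule[OF \<xi> Ds d\<xi> Y Db dY] by simp
  have "terminal_form c X \<xi> = (\<integral>\<omega>. (cG c *v X T \<omega> + cG_hat c *v mean M X T) \<bullet> \<xi> T \<omega> \<partial>M)"
    unfolding terminal_form_def inner_add_left
    using integrable_terminal[OF X \<xi>, of "cG c"] square_integrable_integrable(1)[OF sq\<xi>T]
    by (simp add: mean_def)
  also have "\<dots> = (\<integral>\<omega>. \<xi> T \<omega> \<bullet> Y T \<omega> \<partial>M)"
  proof (rule integral_cong_AE)
    show "AE \<omega> in M. (cG c *v X T \<omega> + cG_hat c *v mean M X T) \<bullet> \<xi> T \<omega> = \<xi> T \<omega> \<bullet> Y T \<omega>"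
      using YT by eventually_elim (simp add: inner_commute)
  qed (use sqXT sqYT sq\<xi>T in \<open>auto simp: square_integrable_def intro!: borel_measurable_inner borel_measurable_add borel_measurable_matrix_vector_mult\<close>)
  finally have terminal: "terminal_form c X \<xi> =
    (\<integral>p. \<xi> (fst p) (snd p) \<bullet> ?Db (fst p) (snd p) + ?Ds (fst p) (snd p) \<bullet> Y (fst p) (snd p)
        + ?Ss (fst p) (snd p) \<bullet> Z (fst p) (snd p) \<partial>PT)"
    unfolding dual .

  note [measurable] = square_integrable_measurable[OF L2_processesD(1)[OF LSt]]
  have "AE s in time. AE \<omega> in M. ?St (fst (s, \<omega>)) (snd (s, \<omega>)) = 0"
    using St by (simp add: AE_time_iff)
  then have St_PT: "AE p in PT. ?St (fst p) (snd p) = 0"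
    by (rule PT.AE_pair_measure[rotated]) measurable
  have st: "has_bochner_integral PT (\<lambda>p. ?St (fst p) (snd p) \<bullet> v (fst p) (snd p)) 0"
  proof -
    have "(\<integral>p. ?St (fst p) (snd p) \<bullet> v (fst p) (snd p) \<partial>PT) = 0"
    proof (rule integral_eq_zero_AE)
      show "AE p in PT. ?St (fst p) (snd p) \<bullet> v (fst p) (snd p) = 0"
        using St_PT by eventually_elim (simp only: inner_zero_left)
    qed
    then show ?thesis using integrable_inner_L2[OF LSt v] by (simp add: has_bochner_integral_iff)
  qed
  note z =
    integral_inner_mean[OF L2_coefficient[OF w(2) L2_mean[OF LX]] L\<xi>]
    integral_inner_mean[OF L2_coefficient[OF w(4) L2_mean[OF u]] v]
    integral_mean_adjoint[OF coeffs(2) L\<xi> LY] integral_mean_adjoint[OF coeffs(4) L\<xi> Z]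
    integral_mean_adjoint[OF coeffs(6) v LY] integral_mean_adjoint[OF coeffs(8) v Z]
  \<comment> \<open>These six differences and the stationarity relation, paired with \<open>v\<close>, add up to the integrand of the first variation.\<close>
  note total = has_bochner_integral_add[OF has_bochner_integral_add[OF has_bochner_integral_add[OF
      has_bochner_integral_add[OF has_bochner_integral_add[OF has_bochner_integral_add[OF z(1) z(2)] z(3)] z(4)] z(5)] z(6)] st]

  have "cost_form c X u \<xi> v = (\<integral>p. running_form c X u \<xi> v (fst p) (snd p) +
      (\<xi> (fst p) (snd p) \<bullet> ?Db (fst p) (snd p) + ?Ds (fst p) (snd p) \<bullet> Y (fst p) (snd p)
        + ?Ss (fst p) (snd p) \<bullet> Z (fst p) (snd p)) \<partial>PT)"
    unfolding cost_form_def terminal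
    by (intro Bochner_Integration.integral_add[symmetric] Bochner_Integration.integrable_add
        integrable_running_form[OF w LX L\<xi> u v] integrable_inner_L2[OF L\<xi> Db] integrable_inner_L2[OF Ds LY] integrable_inner_L2[OF Ss Z])
  also have "\<dots> = 0"
  proof (rule has_bochner_integral_integral_eq[OF has_bochner_integral_cong[THEN iffD1, OF refl _ _ total]])
    fix p
    show "(cQ_hat c (fst p) *v mean M X (fst p)) \<bullet> mean M \<xi> (fst p) -
        (cQ_hat c (fst p) *v mean M X (fst p)) \<bullet> \<xi> (fst p) (snd p) +
        ((cR_hat c (fst p) *v mean M u (fst p)) \<bullet> mean M v (fst p) -
         (cR_hat c (fst p) *v mean M u (fst p)) \<bullet> v (fst p) (snd p)) +
        ((cA_hat c (fst p) *v mean M \<xi> (fst p)) \<bullet> Y (fst p) (snd p) -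
         (transpose (cA_hat c (fst p)) *v mean M Y (fst p)) \<bullet> \<xi> (fst p) (snd p)) +
        ((cA1_hat c (fst p) *v mean M \<xi> (fst p)) \<bullet> Z (fst p) (snd p) -
         (transpose (cA1_hat c (fst p)) *v mean M Z (fst p)) \<bullet> \<xi> (fst p) (snd p)) +
        ((cB_hat c (fst p) *v mean M v (fst p)) \<bullet> Y (fst p) (snd p) -
         (transpose (cB_hat c (fst p)) *v mean M Y (fst p)) \<bullet> v (fst p) (snd p)) +
        ((cB1_hat c (fst p) *v mean M v (fst p)) \<bullet> Z (fst p) (snd p) -
         (transpose (cB1_hat c (fst p)) *v mean M Z (fst p)) \<bullet> v (fst p) (snd p)) +
        ?St (fst p) (snd p) \<bullet> v (fst p) (snd p)
      = running_form c X u \<xi> v (fst p) (snd p) +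
        (\<xi> (fst p) (snd p) \<bullet> ?Db (fst p) (snd p) + ?Ds (fst p) (snd p) \<bullet> Y (fst p) (snd p)
        + ?Ss (fst p) (snd p) \<bullet> Z (fst p) (snd p))"
      unfolding inner_commute[of "\<xi> (fst p) (snd p)"] running_form_def
      by (simp add: inner_add_left inner_diff_left inner_minus_left inner_transpose del: transpose_matrix_vector)
  qed simp
  finally show ?thesis .
qed

end

section \<open>Sufficiency of the optimality system\<close>

theorem theorem3p2:
  fixes M :: "'a measure"
    and W :: "real \<Rightarrow> 'a \<Rightarrow> real"
    and T :: real
    and c :: "('n::finite, 'm::finite) mf_coeffs"
    and \<Theta>2 :: "(real \<Rightarrow> 'a \<Rightarrow> real^'m) \<Rightarrow> (real \<Rightarrow> 'a \<Rightarrow> real^'m)"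
    and x :: "real^'n"
    and X Y Z :: "real \<Rightarrow> 'a \<Rightarrow> real^'n"
    and u :: "real \<Rightarrow> 'a \<Rightarrow> real^'m"
  assumes "0 < T"
    and "prob_space M" and "complete_measure M"
    and "brownian_motion M W"
    and "L_infty T (cA c)" and "L_infty T (cA_hat c)"
    and "L_infty T (cA1 c)" and "L_infty T (cA1_hat c)"
    and "L_infty T (cB c)" and "L_infty T (cB_hat c)"
    and "L_infty T (cB1 c)" and "L_infty T (cB1_hat c)"
    and "L_infty T (cQ c)" and "L_infty T (cQ_hat c)"
    and "L_infty T (cR c)" and "L_infty T (cR_hat c)"
    and "AE s in lborel. s \<in> {0..T} \<longrightarrow> symmetric_matrix (cQ c s) \<and> symmetric_matrix (cQ_hat c s)"
    and "AE s in lborel. s \<in> {0..T} \<longrightarrow> symmetric_matrix (cR c s) \<and> symmetric_matrix (cR_hat c s)"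
    and "symmetric_matrix (cG c)" and "symmetric_matrix (cG_hat c)"
    and "is_Theta2 M W T c \<Theta>2"
    and "nonneg_operator M W T \<Theta>2"
    and "mf_fbsde_solution M W T c x X u Y Z"
  shows "optimal_pair M W T c x X u"
proof -
  interpret brownian_setup M W T
    using assms(1,2,4) by (simp add: brownian_setup_def brownian_setup_axioms_def)
  note coeffs = assms(5-12) and w = assms(13-16)
  have symQ: "AE s in time. symmetric_matrix (cQ c s) \<and> symmetric_matrix (cQ_hat c s)"
    and symR: "AE s in time. symmetric_matrix (cR c s) \<and> symmetric_matrix (cR_hat c s)"
    unfolding AE_time_iff by (fact assms(17), fact assms(18))
  note sol = assms(23)
  have u: "u \<in> L2_processes M W T" and state: "state_process M W T c x u X"
    using sol by (simp_all add: mf_fbsde_solution_def state_process_def)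
  have X: "X \<in> sup_L2_processes M W T"
    using state by (simp add: state_process_def)
  \<comment> \<open>The form \<open>\<langle>\<Theta>\<^sub>2 v, v\<rangle>\<close> is the infimum of the cost over the states started at zero and driven by \<open>v\<close>.\<close>
  have nonneg: "0 \<le> cost_functional M T c \<xi> v"
    if v: "v \<in> L2_processes M W T" and \<xi>: "state_process M W T c 0 v \<xi>" for v \<xi>
  proof -
    have "0 \<le> ereal (L2_inner M T (\<Theta>2 v) v)"
      using assms(22) v by (simp add: nonneg_operator_def)
    also have "\<dots> = mf_J M W T c 0 v"
      using assms(21) v by (simp add: is_Theta2_def)
    also have "\<dots> \<le> ereal (cost_functional M T c \<xi> v)"
      unfolding mf_J_def using \<xi> by (intro INF_lower) simp
    finally show ?thesis by simp
  qed
  have cost_le: "cost_functional M T c X u \<le> cost_functional M T c X' u'"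
    if u': "u' \<in> L2_processes M W T" and X'_state: "state_process M W T c x u' X'" for u' X'
  proof -
    let ?\<xi> = "\<lambda>s \<omega>. X' s \<omega> - X s \<omega>" and ?v = "\<lambda>s \<omega>. u' s \<omega> - u s \<omega>"
    have X': "X' \<in> sup_L2_processes M W T"
      using X'_state by (simp add: state_process_def)
    have \<xi>_state: "state_process M W T c 0 ?v ?\<xi>"
      by (rule state_process_diff[OF coeffs u u' state X'_state])
    have v: "?v \<in> L2_processes M W T"
      by (rule L2_processes_diff[OF u' u])
    have "cost_functional M T c X' u' = cost_functional M T c X u + 2 * cost_form c X u ?\<xi> ?v
        + cost_functional M T c ?\<xi> ?v"
      unfolding cost_functional_eq_cost_form[OF w X' u'] cost_functional_eq_cost_form[OF w X u]
        cost_functional_eq_cost_form[OF w sup_L2_diff[OF X' X] v]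
      by (rule cost_form_expansion[OF w symQ symR assms(19,20) X X' u u'])
    also have "cost_form c X u ?\<xi> ?v = 0"
      by (rule cost_form_stationary[OF coeffs w sol v \<xi>_state])
    finally show ?thesis
      using nonneg[OF v \<xi>_state] by simp
  qed
  have "mf_J M W T c x u \<le> mf_J M W T c x u'" if u': "u' \<in> L2_processes M W T" for u'
  proof -
    have "mf_J M W T c x u \<le> ereal (cost_functional M T c X u)"
      unfolding mf_J_def using state by (intro INF_lower) simp
    also have "\<dots> \<le> mf_J M W T c x u'"
      unfolding mf_J_def by (intro INF_greatest) (auto intro: cost_le[OF u'])
    finally show ?thesis .
  qed
  then have "mf_J M W T c x u = (INF u'\<in>L2_processes M W T. mf_J M W T c x u')"
    by (intro antisym INF_greatest INF_lower u)
  with u state show ?thesis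
    by (simp add: optimal_pair_def optimal_control_def)
qed

end
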